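(* Let $n\ge2$, let $\mu=(\mu_1,\dots,\mu_k)\vdash n$ have distinct odd parts, and let $i$ be an integer. Let $M=\prod_{j=1}^k\mu_j$ and $m=\mathrm{lcm}(\mu_1,\dots,\mu_k)$. Write $M=\prod_{j=1}^r p_j^{e_j}$, where $p_1,\dots,p_r$ are distinct primes, $e_1,\dots,e_s$ are odd, and $e_{s+1},\dots,e_r$ are even (all positive). Suppose that $m=\prod_{j=1}^r p_j^{f_j}$ and $i\equiv u_jp_j^{d_j}\pmod{p_j^{f_j}}$ with $u_j$ coprime to $p_j$ and $0\le d_j\le f_j$. Then $d^{\phi(\mu)}_{\mu,i}\ne0$ if and only if $d_j=f_j-1$ for $j=1,\dots,s$, and $d_j\in\{f_j-1,f_j\}$ for $j=s+1,\dots,r$. When this happens, $$d^{\phi(\mu)}_{\mu,i}=\frac{\sqrt{\epsilon_\mu M}}{m}\prod_{j=1}^s p_j^{f_j-1}\left(\frac{u_j\,m/p_j^{f_j}}{p_j}\right)g(p_j)\prod_{j=s+1}^r\bigl(-p_j^{f_j-1}\bigr)\prod_{j:\,d_j=f_j}(1-p_j),$$ where $\epsilon_\mu=(-1)^{\sum_{j=1}^k(\mu_j-1)/2}$. In particular, $$\bigl|d^{\phi(\mu)}_{\mu,i}\bigr|=\sqrt{\frac{M}{\prod_{j=1}^s p_j}}\;\frac{\prod_{j:\,d_j=f_j}(p_j-1)}{\prod_{j=s+1}^r p_j}.$$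
   Context: For every positive integer $N$, $\zeta_N$ denotes a primitive $N$th root of unity in $\mathbb C$, chosen compatibly (for instance $\zeta_N=e^{2\pi\sqrt{-1}/N}$), so that $\zeta_{ab}^a=\zeta_b$. The symbol $\left(\frac{\cdot}{p}\right)$ is the Legendre symbol and $g(p)=\sum_{l=0}^{p-1}\left(\frac lp\right)\zeta_p^l$ is the quadratic Gauss sum. Empty products equal $1$. The Frobenius coordinates of a partition $\lambda$ are $(a_1,\dots,a_d\mid b_1,\dots,b_d)$, where $d=\#\{t:\lambda_t\ge t\}$, $a_t=\lambda_t-t$, $b_t=\lambda'_t-t$ ($\lambda'$ is the conjugate partition). For $\mu=(\mu_1,\dots,\mu_k)$ with distinct odd parts, $\phi(\mu)$ is the self-conjugate partition with Frobenius coordinates $(a_1,\dots,a_k\mid a_1,\dots,a_k)$, $a_t=(\mu_t-1)/2$. For a self-conjugate $\lambda\vdash n$, the restriction to $A_n$ of the irreducible complex representation $V_\lambda$ of $S_n$ corresponding to $\lambda$ is a direct sum $V_\lambda^+\oplus V_\lambda^-$ of two irreducible representations, with characters $\chi_\lambda^\pm$. For $\mu$ with distinct odd parts and $\lambda=\phi(\mu)$, the permutation $w_\mu\in A_n$ of cycle type $\mu$ and the labelling $\pm$ are such that (following Frobenius) $\chi_\lambda^\pm(w_\mu)=\frac12\left(\epsilon_\mu\pm\sqrt{\epsilon_\mu M}\right)$, with the same square root $\sqrt{\epsilon_\mu M}$ throughout. Let $a^{\lambda^\pm}_{\mu,i}$ denote the multiplicity of $\zeta_m^i$ as an eigenvalue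 of $w_\mu$ in $V_\lambda^\pm$, and set $d^\lambda_{\mu,i}=a^{\lambda^+}_{\mu,i}-a^{\lambda^-}_{\mu,i}$.
   Formalization: The closed formula for d carries an additional factor ε_μ on its right-hand side; as printed it has the wrong sign when ε_μ = −1 (for μ=(3), i=1, it gives −1 while d=+1). The equivalence and the absolute-value formula are unchanged. *)

theory Defs
  imports
    Complex_Main
    "HOL-Library.Multiset"
    "HOL-Library.Function_Algebras"
    "HOL-Combinatorics.Orbits"
    "HOL-Number_Theory.Number_Theory"
    "HOL-Algebra.Sym_Groups"
begin

section \<open>Roots of unity and the quadratic Gauss sum\<close>

definition primitive_root_of_unity :: "nat \<Rightarrow> complex \<Rightarrow> bool" where
  "primitive_root_of_unity N z \<longleftrightarrow> z ^ N = 1 \<and> (\<forall>k. 0 < k \<and> k < N \<longrightarrow> z ^ k \<noteq> 1)"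

definition compatible_roots :: "(nat \<Rightarrow> complex) \<Rightarrow> bool" where
  "compatible_roots \<zeta> \<longleftrightarrow>
     (\<forall>N>0. primitive_root_of_unity N (\<zeta> N)) \<and>
     (\<forall>a>0. \<forall>b>0. \<zeta> (a * b) ^ a = \<zeta> b)"

definition gauss_sum :: "(nat \<Rightarrow> complex) \<Rightarrow> nat \<Rightarrow> complex" where
  "gauss_sum \<zeta> p = (\<Sum>l<p. of_int (Legendre (int l) (int p)) * \<zeta> p ^ l)"


section \<open>Partitions\<close>

definition is_partition :: "nat list \<Rightarrow> bool" where
  "is_partition lam \<longleftrightarrow> sorted_wrt (\<ge>) lam \<and> 0 \<notin> set lam"

text \<open>Parts are indexed from 1, with \<open>part lam t = 0\<close> beyond the length (and for \<open>t = 0\<close>).\<close>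

definition part :: "nat list \<Rightarrow> nat \<Rightarrow> nat" where
  "part lam t = (if 1 \<le> t \<and> t \<le> length lam then lam ! (t - 1) else 0)"

definition conj_part :: "nat list \<Rightarrow> nat \<Rightarrow> nat" where
  "conj_part lam t = card {s. 1 \<le> s \<and> s \<le> length lam \<and> t \<le> part lam s}"

definition durfee :: "nat list \<Rightarrow> nat" where
  "durfee lam = card {t. 1 \<le> t \<and> t \<le> part lam t}"

definition frobenius_coords :: "nat list \<Rightarrow> nat list \<times> nat list" where
  "frobenius_coords lam =
     (map (\<lambda>t. part lam t - t) [1..<durfee lam + 1],
      map (\<lambda>t. conj_part lam t - t) [1..<durfee lam + 1])"

definition phi :: "nat list \<Rightarrow> nat list" where
  "phi \<mu> = (THE lam. is_partition lam \<and>
     frobenius_coords lam = (map (\<lambda>x. (x - 1) div 2) \<mu>, map (\<lambda>x. (x - 1) div 2) \<mu>))"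

definition sgn_eps :: "nat list \<Rightarrow> int" where
  "sgn_eps \<mu> = (-1) ^ (\<Sum>x\<leftarrow>\<mu>. (x - 1) div 2)"

text \<open>Fixed points are orbits of size 1, so they are counted.\<close>

definition cycle_type :: "nat \<Rightarrow> (nat \<Rightarrow> nat) \<Rightarrow> nat multiset" where
  "cycle_type n w = image_mset card (mset_set (orbit w ` {1..n}))"


section \<open>Complex-valued functions as a complex vector space\<close>

definition cscale :: "complex \<Rightarrow> ('a \<Rightarrow> complex) \<Rightarrow> 'a \<Rightarrow> complex" where
  "cscale c f = (\<lambda>x. c * f x)"

interpretation cfun: vector_space "cscale :: complex \<Rightarrow> ('a \<Rightarrow> complex) \<Rightarrow> 'a \<Rightarrow> complex"
  by unfold_locales (simp_all add: cscale_def fun_eq_iff algebra_simps)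

text \<open>The trace on a finite-dimensional subspace \<open>V\<close> of a linear map preserving \<open>V\<close>, read off
  from the matrix in a basis of \<open>V\<close>; the value does not depend on the basis chosen.\<close>

definition trace_on :: "('a \<Rightarrow> complex) set \<Rightarrow> (('a \<Rightarrow> complex) \<Rightarrow> ('a \<Rightarrow> complex)) \<Rightarrow> complex" where
  "trace_on V f =
     (let B = (SOME B. cfun.independent B \<and> cfun.span B = V)
      in \<Sum>b\<in>B. cfun.representation B (f b) b)"


section \<open>Specht modules\<close>

text \<open>A tabloid is encoded as the function sending a row index to the set of entries of that row.
  Vectors of the permutation module are complex functions on tabloids.\<close>

type_synonym tabloid = "nat \<Rightarrow> nat set"
type_synonym tvec = "tabloid \<Rightarrow> complex"

definition cells :: "nat list \<Rightarrow> (nat \<times> nat) set" where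
  "cells lam = {(s, t). 1 \<le> s \<and> 1 \<le> t \<and> t \<le> part lam s}"

definition tableaux :: "nat \<Rightarrow> nat list \<Rightarrow> (nat \<times> nat \<Rightarrow> nat) set" where
  "tableaux n lam = {T. bij_betw T (cells lam) {1..n}}"

definition row_tabloid :: "nat list \<Rightarrow> (nat \<times> nat \<Rightarrow> nat) \<Rightarrow> tabloid" where
  "row_tabloid lam T = (\<lambda>s. T ` {c \<in> cells lam. fst c = s})"

definition perm_tabloid :: "(nat \<Rightarrow> nat) \<Rightarrow> tabloid \<Rightarrow> tabloid" where
  "perm_tabloid g t = (\<lambda>s. g ` t s)"

text \<open>The linear extension of the action of permutations on tabloids: \<open>g\<close> sends the indicator
  function of \<open>t\<close> to that of \<open>g t\<close>.\<close>

definition act :: "(nat \<Rightarrow> nat) \<Rightarrow> tvec \<Rightarrow> tvec" where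
  "act g v = (\<lambda>t. v (perm_tabloid (inv_into UNIV g) t))"

definition column_group :: "nat \<Rightarrow> nat list \<Rightarrow> (nat \<times> nat \<Rightarrow> nat) \<Rightarrow> (nat \<Rightarrow> nat) set" where
  "column_group n lam T =
     {g. g permutes {1..n} \<and>
         (\<forall>j. g ` (T ` {c \<in> cells lam. snd c = j}) = T ` {c \<in> cells lam. snd c = j})}"

definition polytabloid :: "nat \<Rightarrow> nat list \<Rightarrow> (nat \<times> nat \<Rightarrow> nat) \<Rightarrow> tvec" where
  "polytabloid n lam T =
     (\<lambda>t. \<Sum>g\<in>column_group n lam T.
        of_int (sign g) * (if t = perm_tabloid g (row_tabloid lam T) then 1 else 0))"

definition specht :: "nat \<Rightarrow> nat list \<Rightarrow> tvec set" where
  "specht n lam = cfun.span (polytabloid n lam ` tableaux n lam)"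


section \<open>Restriction to the alternating group\<close>

definition invariant_subspace :: "(nat \<Rightarrow> nat) set \<Rightarrow> tvec set \<Rightarrow> bool" where
  "invariant_subspace G V \<longleftrightarrow> cfun.subspace V \<and> (\<forall>g\<in>G. \<forall>v\<in>V. act g v \<in> V)"

definition irreducible_rep :: "(nat \<Rightarrow> nat) set \<Rightarrow> tvec set \<Rightarrow> bool" where
  "irreducible_rep G V \<longleftrightarrow> invariant_subspace G V \<and> V \<noteq> {0} \<and>
     (\<forall>W. W \<subseteq> V \<and> invariant_subspace G W \<longrightarrow> W = {0} \<or> W = V)"

definition alt_splitting :: "nat \<Rightarrow> nat list \<Rightarrow> tvec set \<Rightarrow> tvec set \<Rightarrow> bool" where
  "alt_splitting n lam Vp Vm \<longleftrightarrow>
     irreducible_rep (carrier (alt_group n)) Vp \<and>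
     irreducible_rep (carrier (alt_group n)) Vm \<and>
     specht n lam = {x + y | x y. x \<in> Vp \<and> y \<in> Vm} \<and> Vp \<inter> Vm = {0}"

definition rep_character :: "tvec set \<Rightarrow> (nat \<Rightarrow> nat) \<Rightarrow> complex" where
  "rep_character V g = trace_on V (act g)"

text \<open>Geometric multiplicity, which agrees with the algebraic one because \<open>g\<close> has finite order.\<close>

definition eigen_mult :: "tvec set \<Rightarrow> (nat \<Rightarrow> nat) \<Rightarrow> complex \<Rightarrow> nat" where
  "eigen_mult V g z = cfun.dim {v \<in> V. act g v = cscale z v}"

end

theory Submission
  imports Defs "HOL-Computational_Algebra.Polynomial"
begin

text \<open>Let \<open>\<Delta>\<close> be the difference of the characters of \<open>Vp\<close> and \<open>Vm\<close>. An odd permutation maps \<open>Vp\<close> onto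
  \<open>Vm\<close>: otherwise \<open>Vp\<close> would be invariant under the symmetric group, against the irreducibility of
  the Specht module, or else the two characters would agree. Hence conjugation by \<open>g\<close> multiplies
  \<open>\<Delta>\<close> by the sign of \<open>g\<close>. So \<open>\<Delta>\<close> vanishes at \<open>w\<^sup>k\<close> when \<open>k\<close> is not prime to \<open>m\<close>, because \<open>w\<^sup>k\<close>
  then commutes with an odd permutation, and \<open>\<Delta> (w\<^sup>k) = \<plusminus> R\<close> otherwise. The signs form a
  character of the units modulo \<open>m\<close>; since the multiplicities are integers, its value at a large prime
  \<open>q\<close> is the Legendre symbol of \<open>\<epsilon> M\<close> modulo \<open>q\<close>, so by quadratic reciprocity it is the product
  of the Legendre symbols modulo \<open>p\<^sub>1, \<dots>, p\<^sub>s\<close>. The multiplicities are the Fourier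
  coefficients of \<open>k \<mapsto> \<Delta> (w\<^sup>k)\<close>, and the Chinese remainder theorem factors them into sums
  modulo the prime powers \<open>p\<^sub>j\<close> to the \<open>f\<^sub>j\<close>, each of which is a Gauss or Ramanujan sum.\<close>

section \<open>Traces on spaces of complex functions\<close>

text \<open>The character of the units met here is the Jacobi symbol modulo \<open>M\<close>.
  Conjugacy in the symmetric group yields only that some sign occurs at \<open>w ^^ k\<close>; its
  value is extracted from arithmetic, where \<open>R\<close> enters only through its square
  \<open>sgn_eps \<mu> * M\<close>. The congruence argument works for large primes \<open>q\<close>
  only: modulo \<open>q\<close> it must separate 1 from -1, and \<open>q\<close> may divide neither
  \<open>M\<close> nor the number of units modulo \<open>m\<close>. Multiplicativity and periodicity
  then fill in the remaining residue classes. On the representation side the two halves are not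
  constructed: they form any splitting whose characters at \<open>w\<close> differ by the nonzero
  \<open>R\<close>. That one value, with the irreducibility of the Specht module, forces odd
  permutations to exchange them. The sum for a multiplicity runs over inverse powers of the
  eigenvalue, so the exponent \<open>i\<close> enters as \<open>- i\<close>. This produces one
  factor \<open>Legendre (- 1)\<close> for each prime of odd exponent, and their product is again
  \<open>sgn_eps \<mu>\<close>.\<close>

abbreviation clinear :: "(('a \<Rightarrow> complex) \<Rightarrow> ('b \<Rightarrow> complex)) \<Rightarrow> bool" where
  "clinear \<equiv> Vector_Spaces.linear cscale cscale"

lemma clinear_iff:
  "clinear f \<longleftrightarrow> (\<forall>x y. f (x + y) = f x + f y) \<and> (\<forall>c x. f (cscale c x) = cscale c (f x))"
  by (auto simp: Vector_Spaces.linear_iff cfun.vector_space_axioms)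

lemma clinear_add: "clinear f \<Longrightarrow> f (x + y) = f x + f y"
  and clinear_cscale: "clinear f \<Longrightarrow> f (cscale c x) = cscale c (f x)"
  by (auto simp: clinear_iff)

lemma clinear_zero: "clinear f \<Longrightarrow> f 0 = 0"
  using clinear_add[of f 0 0] by simp

lemma clinear_sum: "clinear f \<Longrightarrow> f (sum g A) = (\<Sum>a\<in>A. f (g a))"
  by (induction A rule: infinite_finite_induct) (auto simp: clinear_zero clinear_add)

lemma clinear_diff: "clinear f \<Longrightarrow> f (x - y) = f x - f y"
  using clinear_add[of f "x - y" y] by (simp add: algebra_simps)

definition basis_of :: "('a \<Rightarrow> complex) set \<Rightarrow> ('a \<Rightarrow> complex) set \<Rightarrow> bool" where
  "basis_of V B \<longleftrightarrow> cfun.independent B \<and> cfun.span B = V"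

text \<open>\<open>S\<close> may lie outside \<open>V\<close>, so the property passes to subspaces
  without a new spanning set. It has to be tracked because the space of all functions on tabloids is
  infinite-dimensional.\<close>

definition fin_dim :: "('a \<Rightarrow> complex) set \<Rightarrow> bool" where
  "fin_dim V \<longleftrightarrow> cfun.subspace V \<and> (\<exists>S. finite S \<and> V \<subseteq> cfun.span S)"

lemma fin_dim_basis:
  assumes "fin_dim V"
  shows "\<exists>B. basis_of V B"
proof -
  have V: "cfun.subspace V" using assms by (simp add: fin_dim_def)
  obtain B where "B \<subseteq> V" "cfun.independent B" "V \<subseteq> cfun.span B"
    using cfun.maximal_independent_subset by blast
  then show ?thesis
    using V unfolding basis_of_def by (metis cfun.span_subspace)
qed

lemma basis_of_finite:
  assumes "fin_dim V" "basis_of V B"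
  shows "finite B"
proof -
  obtain S where "finite S" "V \<subseteq> cfun.span S" using assms(1) by (auto simp: fin_dim_def)
  moreover have "B \<subseteq> V" using assms(2) cfun.span_superset by (auto simp: basis_of_def)
  ultimately show ?thesis
    using cfun.independent_span_bound[of S B] assms(2) by (auto simp: basis_of_def)
qed

lemma fin_dim_subset: "fin_dim V \<Longrightarrow> W \<subseteq> V \<Longrightarrow> cfun.subspace W \<Longrightarrow> fin_dim W"
  unfolding fin_dim_def by blast

text \<open>Both traces are the double sum of
  \<open>cfun.representation C b c * cfun.representation B (f c) b\<close>: on one side expand
  \<open>b\<close> in \<open>C\<close> before applying \<open>f\<close>, on the other expand
  \<open>f c\<close> in \<open>B\<close>.\<close>

lemma basis_trace_unique:
  assumes f: "clinear f" "f ` V \<subseteq> V"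
    and B: "basis_of V B" "finite B" and C: "basis_of V C" "finite C"
  shows "(\<Sum>b\<in>B. cfun.representation B (f b) b) = (\<Sum>c\<in>C. cfun.representation C (f c) c)"
proof -
  have indB: "cfun.independent B" and indC: "cfun.independent C"
    and sB: "cfun.span B = V" and sC: "cfun.span C = V"
    using B C by (auto simp: basis_of_def)
  have BV: "B \<subseteq> V" and CV: "C \<subseteq> V" using sB sC cfun.span_superset by auto
  have 1: "cfun.representation B (f b) b =
      (\<Sum>c\<in>C. cfun.representation C b c * cfun.representation B (f c) b)" if "b \<in> B" for b
  proof -
    have "b = (\<Sum>c\<in>C. cscale (cfun.representation C b c) c)"
      using that BV sC C(2) by (intro cfun.sum_representation_eq[OF indC, symmetric]) auto
    then have "f b = (\<Sum>c\<in>C. cscale (cfun.representation C b c) (f c))"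
      by (metis (no_types, lifting) clinear_cscale clinear_sum f(1) sum.cong)
    moreover have "cscale x (f c) \<in> cfun.span B" if "c \<in> C" for x c
      using that CV f(2) sB by (intro cfun.span_scale) auto
    ultimately have "cfun.representation B (f b) =
        (\<lambda>b'. \<Sum>c\<in>C. cfun.representation B (cscale (cfun.representation C b c) (f c)) b')"
      using cfun.representation_sum[OF indB, of C "\<lambda>c. cscale (cfun.representation C b c) (f c)"] by simp
    moreover have "cfun.representation B (cscale x (f c)) b' = x * cfun.representation B (f c) b'" if "c \<in> C" for x c b'
      using that CV f(2) sB by (subst cfun.representation_scale[OF indB]) auto
    ultimately show ?thesis by simp
  qed
  have 2: "cfun.representation C (f c) c =
      (\<Sum>b\<in>B. cfun.representation B (f c) b * cfun.representation C b c)" if "c \<in> C" for c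
  proof -
    have "f c = (\<Sum>b\<in>B. cscale (cfun.representation B (f c) b) b)"
      using that CV f(2) sB B(2) by (intro cfun.sum_representation_eq[OF indB, symmetric]) auto
    moreover have "cscale x b \<in> cfun.span C" if "b \<in> B" for x b
      using that BV sC by (intro cfun.span_scale) auto
    ultimately have "cfun.representation C (f c) =
        (\<lambda>c'. \<Sum>b\<in>B. cfun.representation C (cscale (cfun.representation B (f c) b) b) c')"
      using cfun.representation_sum[OF indC, of B "\<lambda>b. cscale (cfun.representation B (f c) b) b"] by metis
    moreover have "cfun.representation C (cscale x b) c' = x * cfun.representation C b c'" if "b \<in> B" for x b c'
      using that BV sC by (subst cfun.representation_scale[OF indC]) auto
    ultimately show ?thesis by simp
  qed
  show ?thesis
    by (simp add: 1 2 mult.commute) (rule sum.swap)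
qed

text \<open>\<open>trace_on\<close> fixes its basis by a choice operator; from here on any
  convenient basis may be used, such as one adapted to a direct sum.\<close>

lemma trace_on_eq:
  assumes "fin_dim V" "clinear f" "f ` V \<subseteq> V" "basis_of V B"
  shows "trace_on V f = (\<Sum>b\<in>B. cfun.representation B (f b) b)"
proof -
  define C where "C = (SOME B. cfun.independent B \<and> cfun.span B = V)"
  have C: "basis_of V C"
    using someI_ex[OF fin_dim_basis[OF assms(1), unfolded basis_of_def]] by (simp add: C_def basis_of_def)
  have "trace_on V f = (\<Sum>b\<in>C. cfun.representation C (f b) b)"
    by (simp add: trace_on_def C_def Let_def)
  also have "\<dots> = (\<Sum>b\<in>B. cfun.representation B (f b) b)"
    using assms C by (intro basis_trace_unique) (auto intro: basis_of_finite)
  finally show ?thesis .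
qed

lemma trace_on_sum:
  fixes c :: "'i \<Rightarrow> complex" and f :: "'i \<Rightarrow> ('a \<Rightarrow> complex) \<Rightarrow> ('a \<Rightarrow> complex)"
  assumes "fin_dim V" "\<And>i. i \<in> I \<Longrightarrow> clinear (f i)" "\<And>i. i \<in> I \<Longrightarrow> f i ` V \<subseteq> V"
  shows "trace_on V (\<lambda>v. \<Sum>i\<in>I. cscale (c i) (f i v)) = (\<Sum>i\<in>I. c i * trace_on V (f i))"
proof -
  obtain B where B: "basis_of V B" using fin_dim_basis assms(1) by blast
  have indB: "cfun.independent B" and sB: "cfun.span B = V" using B by (auto simp: basis_of_def)
  have BV: "B \<subseteq> V" using sB cfun.span_superset by auto
  let ?F = "\<lambda>v. \<Sum>i\<in>I. cscale (c i) (f i v)"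
  have subV: "cfun.subspace V" using assms(1) by (simp add: fin_dim_def)
  have lin: "clinear ?F"
  proof -
    have "?F (x + y) = ?F x + ?F y" for x y
      unfolding sum.distrib[symmetric] cfun.scale_right_distrib[symmetric]
      by (intro sum.cong refl arg_cong[where f = "cscale _"]) (simp add: clinear_add[OF assms(2)])
    moreover have "?F (cscale a x) = cscale a (?F x)" for a x
      unfolding cfun.scale_sum_right
      by (intro sum.cong refl) (simp add: clinear_cscale[OF assms(2)] cfun.scale_left_commute)
    ultimately show ?thesis by (simp add: clinear_iff)
  qed
  have im: "?F ` V \<subseteq> V"
    using assms(3) subV by (auto intro!: cfun.subspace_sum cfun.subspace_scale)
  have "cfun.representation B (?F b) b = (\<Sum>i\<in>I. c i * cfun.representation B (f i b) b)" if b: "b \<in> B" for b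
  proof -
    have in_sp: "f i b \<in> cfun.span B" if "i \<in> I" for i using that b BV assms(3) sB by auto
    have "cfun.representation B (?F b) = (\<lambda>b'. \<Sum>i\<in>I. cfun.representation B (cscale (c i) (f i b)) b')"
      by (rule cfun.representation_sum[OF indB]) (auto intro: in_sp cfun.span_scale)
    then show ?thesis by (simp add: cfun.representation_scale[OF indB in_sp])
  qed
  then show ?thesis
    using trace_on_eq[OF assms(1) lin im B] trace_on_eq[OF assms(1) assms(2,3) B]
    by (simp add: sum_distrib_left sum.swap[of _ I B])
qed

lemma independent_Un_trivial_Int:
  assumes "cfun.independent A" "cfun.independent B" "finite B" "cfun.span A \<inter> cfun.span B = {0}"
  shows "cfun.independent (A \<union> B)"
  using assms(3,2,4)
proof (induction B rule: finite_induct)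
  case empty
  then show ?case using assms(1) by simp
next
  case (insert b B)
  have sub: "cfun.span A \<inter> cfun.span B = {0}"
  proof -
    have "cfun.span B \<subseteq> cfun.span (insert b B)" by (intro cfun.span_mono) auto
    then show ?thesis using insert.prems cfun.span_zero by blast
  qed
  have bB: "b \<notin> cfun.span B" and ib: "cfun.independent B"
    using insert.prems(1) insert.hyps(2) by (auto simp: cfun.independent_insert)
  have "b \<notin> cfun.span (A \<union> B)"
  proof
    assume "b \<in> cfun.span (A \<union> B)"
    then obtain x y where xy: "b = x + y" "x \<in> cfun.span A" "y \<in> cfun.span B"
      by (auto simp: cfun.span_Un)
    \<comment> \<open>The part of \<open>b\<close> along \<open>A\<close> lies in both spans, so it
      vanishes and \<open>b\<close> would already be in the span of \<open>B\<close>.\<close>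
    have "x = b - y" using xy by simp
    moreover have "y \<in> cfun.span (insert b B)" using xy(3) cfun.span_mono[of B "insert b B"] by auto
    ultimately have "x \<in> cfun.span (insert b B)"
      by (simp add: cfun.span_base cfun.span_diff)
    then have "x = 0" using xy insert.prems(2) by blast
    then show False using xy bB by simp
  qed
  then show ?case using insert.IH[OF ib sub] by (simp add: cfun.independent_insertI)
qed

lemma trace_on_direct_sum:
  assumes f: "clinear f" "f ` A \<subseteq> A" "f ` C \<subseteq> C"
    and fd: "fin_dim A" "fin_dim C" "fin_dim V"
    and V: "V = {x + y | x y. x \<in> A \<and> y \<in> C}" "A \<inter> C = {0}"
  shows "trace_on V f = trace_on A f + trace_on C f"
proof -
  obtain BA BC where BA: "basis_of A BA" and BC: "basis_of C BC"
    using fin_dim_basis fd by blast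
  have fin: "finite BA" "finite BC" using BA BC fd basis_of_finite by blast+
  have ind: "cfun.independent BA" "cfun.independent BC" and sp: "cfun.span BA = A" "cfun.span BC = C"
    using BA BC by (auto simp: basis_of_def)
  have sub: "BA \<subseteq> A" "BC \<subseteq> C" using sp cfun.span_superset by auto
  have disj: "BA \<inter> BC = {}"
  proof -
    have "0 \<notin> BA" using ind(1) cfun.dependent_zero[of BA] by auto
    moreover have "x = 0" if "x \<in> BA" "x \<in> BC" for x
    proof -
      have "x \<in> A \<inter> C" using that sub by (intro IntI subsetD[OF sub(1)] subsetD[OF sub(2)])
      then show ?thesis unfolding V(2) by simp
    qed
    ultimately show ?thesis by (metis disjoint_iff)
  qed
  have indU: "cfun.independent (BA \<union> BC)"
    by (rule independent_Un_trivial_Int[OF ind fin(2)]) (simp add: sp V(2))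
  have B: "basis_of V (BA \<union> BC)"
    unfolding basis_of_def cfun.span_Un sp V(1) using indU by (rule conjI) (rule refl)
  have im: "f ` V \<subseteq> V"
  proof -
    have "f (x + y) \<in> V" if "x \<in> A" "y \<in> C" for x y
    proof -
      have "f x \<in> A" "f y \<in> C" using that f(2,3) by auto
      then show ?thesis unfolding V(1) clinear_add[OF f(1)] by blast
    qed
    then show ?thesis using V(1) by auto
  qed
  have ra: "cfun.representation (BA \<union> BC) (f b) b = cfun.representation BA (f b) b" if "b \<in> BA" for b
  proof -
    have "f b \<in> A" using that sub(1) f(2) by auto
    then show ?thesis using cfun.representation_extend[OF indU, of "f b" BA] by (simp add: sp)
  qed
  have rc: "cfun.representation (BA \<union> BC) (f b) b = cfun.representation BC (f b) b" if "b \<in> BC" for b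
  proof -
    have "f b \<in> C" using that sub(2) f(3) by auto
    then show ?thesis using cfun.representation_extend[OF indU, of "f b" BC] by (simp add: sp)
  qed
  show ?thesis
    unfolding trace_on_eq[OF fd(3) f(1) im B] trace_on_eq[OF fd(1) f(1,2) BA] trace_on_eq[OF fd(2) f(1,3) BC]
    by (simp add: sum.union_disjoint[OF fin disj] ra rc)
qed

lemma fin_dim_image:
  assumes "fin_dim V" "clinear \<phi>"
  shows "fin_dim (\<phi> ` V)"
proof -
  interpret l: Vector_Spaces.linear cscale cscale \<phi> by (rule assms(2))
  obtain S where "finite S" "V \<subseteq> cfun.span S" "cfun.subspace V" using assms(1) by (auto simp: fin_dim_def)
  moreover have "\<phi> ` V \<subseteq> cfun.span (\<phi> ` S)" using l.span_image[of S] \<open>V \<subseteq> _\<close> by auto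
  ultimately show ?thesis unfolding fin_dim_def using l.subspace_image by blast
qed

lemma trace_on_transport:
  assumes V: "fin_dim V" and phi: "clinear \<phi>" "inj \<phi>"
    and f: "clinear f" "f ` V \<subseteq> V" and g: "clinear g" "\<And>v. v \<in> V \<Longrightarrow> g (\<phi> v) = \<phi> (f v)"
  shows "trace_on (\<phi> ` V) g = trace_on V f"
proof -
  interpret l: Vector_Spaces.linear cscale cscale \<phi> by (rule phi(1))
  obtain B where B: "basis_of V B" using fin_dim_basis V by blast
  have indB: "cfun.independent B" and sB: "cfun.span B = V" using B by (auto simp: basis_of_def)
  have BV: "B \<subseteq> V" using sB cfun.span_superset by auto
  have fin: "finite B" using B V basis_of_finite by blast
  have indI: "cfun.independent (\<phi> ` B)"
    using l.independent_injective_image[OF indB] phi(2) by (meson inj_on_subset subset_UNIV)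
  have B': "basis_of (\<phi> ` V) (\<phi> ` B)"
    using indI l.span_image[of B] sB by (simp add: basis_of_def)
  have im: "g ` \<phi> ` V \<subseteq> \<phi> ` V" using f(2) g(2) by auto
  have rep: "cfun.representation (\<phi> ` B) (\<phi> v) (\<phi> b) = cfun.representation B v b"
    if v: "v \<in> V" and b: "b \<in> B" for v b
  proof -
    \<comment> \<open>Transported coordinates. They are set to 0 off the image of \<open>B\<close>,
      since \<open>cfun.representation\<close> is a function on all vectors that vanishes outside
      the basis.\<close>
    let ?r = "\<lambda>c. if c \<in> \<phi> ` B then cfun.representation B v (inv_into UNIV \<phi> c) else 0"
    have inv\<phi>: "inv_into UNIV \<phi> (\<phi> x) = x" for x using phi(2) by simp
    have s: "(\<Sum>c\<in>B. cscale (cfun.representation B v c) c) = v"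
      using cfun.sum_representation_eq[OF indB, of v B] v sB fin by auto
    have "cfun.representation (\<phi> ` B) (\<phi> v) = ?r"
    proof (rule cfun.representation_eqI[OF indI])
      show "\<phi> v \<in> cfun.span (\<phi> ` B)" using l.span_image[of B] sB v by auto
      show "?r c \<noteq> 0 \<Longrightarrow> c \<in> \<phi> ` B" for c by (auto split: if_splits)
      show "finite {b. ?r b \<noteq> 0}"
        by (rule finite_subset[of _ "\<phi> ` B"]) (use fin in auto)
      have "(\<Sum>c | ?r c \<noteq> 0. cscale (?r c) c) = (\<Sum>c\<in>\<phi> ` B. cscale (?r c) c)"
        by (rule sum.mono_neutral_left) (use fin in auto)
      also have "\<dots> = (\<Sum>c\<in>B. cscale (cfun.representation B v c) (\<phi> c))"
        by (subst sum.reindex) (use phi(2) in \<open>auto intro: inj_on_subset simp: inv\<phi>\<close>)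
      also have "\<dots> = \<phi> v"
        by (subst (2) s[symmetric]) (simp add: clinear_sum[OF phi(1)] clinear_cscale[OF phi(1)])
      finally show "(\<Sum>c | ?r c \<noteq> 0. cscale (?r c) c) = \<phi> v" .
    qed
    then show ?thesis using b by (simp add: inv\<phi>)
  qed
  have "trace_on (\<phi> ` V) g = (\<Sum>b\<in>\<phi> ` B. cfun.representation (\<phi> ` B) (g b) b)"
    by (rule trace_on_eq[OF fin_dim_image[OF V phi(1)] g(1) im B'])
  also have "\<dots> = (\<Sum>b\<in>B. cfun.representation (\<phi> ` B) (g (\<phi> b)) (\<phi> b))"
    by (subst sum.reindex) (use phi(2) in \<open>auto intro: inj_on_subset\<close>)
  also have "\<dots> = (\<Sum>b\<in>B. cfun.representation B (f b) b)"
    using BV f(2) by (intro sum.cong) (auto simp: g(2) subset_iff intro!: rep)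
  finally show ?thesis using trace_on_eq[OF V f B] by simp
qed

text \<open>For an idempotent, \<open>V\<close> is the direct sum of the fixed space and the kernel,
  and basis vectors contribute 1 in the first and 0 in the second. Applied later to the averaging
  projection onto an eigenspace, this turns a dimension into a trace.\<close>

lemma trace_on_projection:
  assumes V: "fin_dim V" and P: "clinear P" "P ` V \<subseteq> V" "\<And>v. v \<in> V \<Longrightarrow> P (P v) = P v"
  shows "trace_on V P = of_nat (cfun.dim {v \<in> V. P v = v})"
proof -
  interpret l: Vector_Spaces.linear cscale cscale P by (rule P(1))
  have sV: "cfun.subspace V" using V by (simp add: fin_dim_def)
  let ?A = "{v \<in> V. P v = v}" and ?C = "{v \<in> V. P v = 0}"
  have sA: "cfun.subspace ?A" and sC: "cfun.subspace ?C"
    using sV unfolding cfun.subspace_def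
    by (auto simp: clinear_zero[OF P(1)] clinear_add[OF P(1)] clinear_cscale[OF P(1)])
  have fA: "fin_dim ?A" and fC: "fin_dim ?C"
    using V sA sC by (auto intro!: fin_dim_subset[OF V])
  have 0: "0 \<in> V" using sV by (simp add: cfun.subspace_def)
  have "trace_on V P = trace_on ?A P + trace_on ?C P"
  proof (rule trace_on_direct_sum[OF P(1) _ _ fA fC V])
    show "P ` ?A \<subseteq> ?A" using P by auto
    show "P ` ?C \<subseteq> ?C" using 0 by (auto simp: clinear_zero[OF P(1)])
    show "?A \<inter> ?C = {0}" using 0 by (auto simp: clinear_zero[OF P(1)])
    show "V = {x + y | x y. x \<in> ?A \<and> y \<in> ?C}" (is "_ = ?R")
    proof
      show "V \<subseteq> ?R"
      proof
        fix v assume v: "v \<in> V"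
        have "v = P v + (v - P v)" by simp
        moreover have "v - P v \<in> ?C" using v P sV
          by (auto simp: clinear_diff[OF P(1)] intro: cfun.subspace_diff)
        moreover have "P v \<in> ?A" using v P by auto
        ultimately show "v \<in> ?R" by blast
      qed
      show "?R \<subseteq> V" using sV by (auto intro: cfun.subspace_add)
    qed
  qed
  moreover have "trace_on ?C P = 0"
  proof -
    obtain B where B: "basis_of ?C B" using fin_dim_basis fC by blast
    then have "P b = 0" if "b \<in> B" for b
      using that cfun.span_superset[of B] by (auto simp: basis_of_def)
    moreover have im: "P ` ?C \<subseteq> ?C" using 0 by (auto simp: clinear_zero[OF P(1)])
    ultimately show ?thesis using trace_on_eq[OF fC P(1) im B] by (simp add: cfun.representation_zero)
  qed
  moreover have "trace_on ?A P = of_nat (cfun.dim ?A)"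
  proof -
    obtain B where B: "basis_of ?A B" using fin_dim_basis fA by blast
    then have "cfun.representation B (P b) b = 1" if "b \<in> B" for b
      using that cfun.span_superset[of B] cfun.representation_basis[of B b] by (auto simp: basis_of_def)
    moreover have im: "P ` ?A \<subseteq> ?A" using P by auto
    moreover have "card B = cfun.dim ?A"
      using B cfun.dim_span_eq_card_independent[of B] by (auto simp: basis_of_def)
    ultimately show ?thesis using trace_on_eq[OF fA P(1) im B] by simp
  qed
  ultimately show ?thesis by simp
qed

section \<open>Irreducibility of Specht modules\<close>

lemma bij_comp_inv: "bij g \<Longrightarrow> inv_into UNIV g \<circ> g = id" "bij g \<Longrightarrow> g \<circ> inv_into UNIV g = id"
  by (simp_all add: bij_is_inj bij_is_surj surj_iff[THEN iffD1])

lemma sum_fun_apply: "(\<Sum>a\<in>A. f a) x = (\<Sum>a\<in>A. f a x)"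
  by (induction A rule: infinite_finite_induct) auto

lemma perm_tabloid_comp: "perm_tabloid g (perm_tabloid h t) = perm_tabloid (g \<circ> h) t"
  by (simp add: perm_tabloid_def image_image)

lemma perm_tabloid_id: "perm_tabloid id t = t"
  by (simp add: perm_tabloid_def)

lemma perm_tabloid_inv_left: "bij g \<Longrightarrow> perm_tabloid (inv_into UNIV g) (perm_tabloid g t) = t"
  and perm_tabloid_inv_right: "bij g \<Longrightarrow> perm_tabloid g (perm_tabloid (inv_into UNIV g) t) = t"
  by (simp_all add: perm_tabloid_comp perm_tabloid_id bij_comp_inv)

lemma perm_tabloid_eq_iff: "bij g \<Longrightarrow> perm_tabloid (inv_into UNIV g) t = t' \<longleftrightarrow> t = perm_tabloid g t'"
  by (auto simp: perm_tabloid_inv_left perm_tabloid_inv_right)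

lemma clinear_act: "clinear (act g)"
  by (auto simp: clinear_iff act_def cscale_def fun_eq_iff)

lemma act_comp: "bij g \<Longrightarrow> bij h \<Longrightarrow> act g (act h v) = act (g \<circ> h) v"
  by (simp add: act_def fun_eq_iff perm_tabloid_comp o_inv_distrib)

lemma act_id: "act id v = v"
  by (simp add: act_def perm_tabloid_id)

lemma act_inv_left: "bij g \<Longrightarrow> act (inv_into UNIV g) (act g v) = v"
  and act_inv_right: "bij g \<Longrightarrow> act g (act (inv_into UNIV g) v) = v"
  by (simp_all add: act_comp act_id bij_imp_bij_inv bij_comp_inv)

lemma inj_act: "bij g \<Longrightarrow> inj (act g)"
  by (metis act_inv_left injI)

lemma row_tabloid_comp: "row_tabloid lam (g \<circ> T) = perm_tabloid g (row_tabloid lam T)"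
  by (simp add: row_tabloid_def perm_tabloid_def image_comp)

lemma tableaux_comp: "T \<in> tableaux n lam \<Longrightarrow> g permutes {1..n} \<Longrightarrow> g \<circ> T \<in> tableaux n lam"
  unfolding tableaux_def mem_Collect_eq by (rule bij_betw_trans[OF _ permutes_imp_bij]; assumption)

definition tabloids :: "nat \<Rightarrow> nat list \<Rightarrow> tabloid set" where
  "tabloids n lam = row_tabloid lam ` tableaux n lam"

lemma finite_cells: "finite (cells lam)"
proof -
  have "cells lam \<subseteq> (\<Union>s\<in>{1..length lam}. {s} \<times> {1..part lam s})"
    by (auto simp: cells_def part_def split: if_splits)
  then show ?thesis by (rule finite_subset) auto
qed

lemma cells_row: "{c \<in> cells lam. fst c = s} = Pair s ` {1..part lam s}"
  by (auto simp: cells_def part_def)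

lemma finite_tabloids: "finite (tabloids n lam)"
proof -
  have "tabloids n lam \<subseteq> {t. \<forall>s. (s \<in> {1..length lam} \<longrightarrow> t s \<in> Pow {1..n}) \<and>
      (s \<notin> {1..length lam} \<longrightarrow> t s = {})}"
    by (auto simp: tabloids_def row_tabloid_def tableaux_def bij_betw_def cells_def part_def
        split: if_splits)
  then show ?thesis
    by (rule finite_subset) (intro finite_set_of_finite_funs; simp)
qed

lemma perm_tabloid_mem: "t \<in> tabloids n lam \<Longrightarrow> g permutes {1..n} \<Longrightarrow> perm_tabloid g t \<in> tabloids n lam"
  unfolding tabloids_def by (auto simp flip: row_tabloid_comp intro!: imageI tableaux_comp)

section \<open>Rows and columns of a tableau, and its column group\<close>

definition row_of :: "nat list \<Rightarrow> (nat \<times> nat \<Rightarrow> nat) \<Rightarrow> nat \<Rightarrow> nat" where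
  "row_of lam T a = fst (inv_into (cells lam) T a)"

definition col_of :: "nat list \<Rightarrow> (nat \<times> nat \<Rightarrow> nat) \<Rightarrow> nat \<Rightarrow> nat" where
  "col_of lam T a = snd (inv_into (cells lam) T a)"

context
  fixes n :: nat and lam :: "nat list" and T :: "nat \<times> nat \<Rightarrow> nat"
  assumes T: "T \<in> tableaux n lam"
begin

lemma tableau_entry: "c \<in> cells lam \<Longrightarrow> T c \<in> {1..n}"
  using T by (auto simp: tableaux_def bij_betw_def)

lemma row_of_entry: "c \<in> cells lam \<Longrightarrow> row_of lam T (T c) = fst c"
  and col_of_entry: "c \<in> cells lam \<Longrightarrow> col_of lam T (T c) = snd c"
  using T by (auto simp: tableaux_def bij_betw_def row_of_def col_of_def)

lemma row_col_cell: "a \<in> {1..n} \<Longrightarrow> (row_of lam T a, col_of lam T a) \<in> cells lam"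
  and entry_row_col: "a \<in> {1..n} \<Longrightarrow> T (row_of lam T a, col_of lam T a) = a"
  using T by (auto simp: tableaux_def bij_betw_def row_of_def col_of_def f_inv_into_f inv_into_into)

lemma column_entries: "T ` {c \<in> cells lam. snd c = j} = {a \<in> {1..n}. col_of lam T a = j}" (is "?L = ?R")
proof
  show "?L \<subseteq> ?R" using tableau_entry col_of_entry by blast
  show "?R \<subseteq> ?L"
  proof
    fix a assume a: "a \<in> ?R"
    then have "a = T (row_of lam T a, j)" using entry_row_col by auto
    then show "a \<in> ?L" using row_col_cell a by (auto intro!: image_eqI[of a T "(row_of lam T a, j)"])
  qed
qed

lemma row_tabloid_eq: "row_tabloid lam T s = {a \<in> {1..n}. row_of lam T a = s}"
  (is "_ = ?R")
proof
  show "row_tabloid lam T s \<subseteq> ?R" unfolding row_tabloid_def using tableau_entry row_of_entry by blast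
  show "?R \<subseteq> row_tabloid lam T s"
  proof
    fix a assume a: "a \<in> ?R"
    then have "a = T (s, col_of lam T a)" using entry_row_col by auto
    then show "a \<in> row_tabloid lam T s"
      using row_col_cell a by (auto simp: row_tabloid_def intro!: image_eqI[of a T "(s, col_of lam T a)"])
  qed
qed

text \<open>For a finite column and an injective \<open>g\<close>, containment of the image already
  gives equality. This turns membership in the column group into a pointwise condition on
  \<open>col_of\<close>.\<close>

lemma column_group_eq:
  "column_group n lam T = {g. g permutes {1..n} \<and> (\<forall>a\<in>{1..n}. col_of lam T (g a) = col_of lam T a)}"
proof -
  have "(\<forall>j. g ` {a \<in> {1..n}. col_of lam T a = j} = {a \<in> {1..n}. col_of lam T a = j}) \<longleftrightarrow>
      (\<forall>a\<in>{1..n}. col_of lam T (g a) = col_of lam T a)" (is "?L \<longleftrightarrow> ?R") if g: "g permutes {1..n}" for g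
  proof
    assume L: ?L
    show ?R
    proof
      fix a assume "a \<in> {1..n}"
      then have "g a \<in> g ` {x \<in> {1..n}. col_of lam T x = col_of lam T a}" by auto
      then show "col_of lam T (g a) = col_of lam T a" unfolding L[rule_format] by simp
    qed
  next
    assume R: ?R
    show ?L
    proof
      fix j
      let ?A = "{a \<in> {1..n}. col_of lam T a = j}"
      have "g ` ?A \<subseteq> ?A" using R permutes_in_image[OF g] by auto
      moreover have "card (g ` ?A) = card ?A"
        using permutes_inj[OF g] by (intro card_image) (auto simp: inj_on_def)
      ultimately show "g ` ?A = ?A" by (intro card_subset_eq) auto
    qed
  qed
  then show ?thesis unfolding column_group_def column_entries by auto
qed

lemma column_group_permutes: "g \<in> column_group n lam T \<Longrightarrow> g permutes {1..n}"
  by (simp add: column_group_eq)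

lemma finite_column_group: "finite (column_group n lam T)"
  by (rule finite_subset[OF _ finite_permutations[of "{1..n}"]]) (auto simp: column_group_eq)

lemma column_group_comp: "g \<in> column_group n lam T \<Longrightarrow> h \<in> column_group n lam T \<Longrightarrow> g \<circ> h \<in> column_group n lam T"
  unfolding column_group_eq
  by (auto intro: permutes_compose simp: permutes_in_image[of h "{1..n}", simplified])

lemma column_group_inv: "g \<in> column_group n lam T \<Longrightarrow> inv_into UNIV g \<in> column_group n lam T"
proof -
  assume g: "g \<in> column_group n lam T"
  then have p: "g permutes {1..n}" and c: "\<And>a. a \<in> {1..n} \<Longrightarrow> col_of lam T (g a) = col_of lam T a"
    by (auto simp: column_group_eq)
  have "col_of lam T (inv_into UNIV g a) = col_of lam T a" if "a \<in> {1..n}" for a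
    using c[of "inv_into UNIV g a"] that permutes_in_image[OF permutes_inv[OF p], of a]
    by (simp add: permutes_inverses(1)[OF p])
  then show ?thesis using permutes_inv[OF p] by (simp add: column_group_eq)
qed

text \<open>Distinct elements of the column group give distinct tabloids: if
  \<open>g a = h b\<close> with \<open>a\<close> and \<open>b\<close> in the same row, then they
  also share a column, so \<open>a = b\<close>. Hence exactly one summand of the polytabloid
  survives.\<close>

lemma polytabloid_orbit:
  assumes g: "g \<in> column_group n lam T"
  shows "polytabloid n lam T (perm_tabloid g (row_tabloid lam T)) = of_int (sign g)"
proof -
  have eq: "perm_tabloid g (row_tabloid lam T) = perm_tabloid h (row_tabloid lam T) \<longleftrightarrow> h = g"
    if h: "h \<in> column_group n lam T" for h
  proof
    assume e: "perm_tabloid g (row_tabloid lam T) = perm_tabloid h (row_tabloid lam T)"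
    have "g a = h a" for a
    proof (cases "a \<in> {1..n}")
      case True
      have "g a \<in> g ` row_tabloid lam T (row_of lam T a)" using True row_tabloid_eq by auto
      also have "\<dots> = h ` row_tabloid lam T (row_of lam T a)"
        using fun_cong[OF e, of "row_of lam T a"] by (simp add: perm_tabloid_def)
      finally obtain b where b: "b \<in> {1..n}" "row_of lam T b = row_of lam T a" "g a = h b"
        using row_tabloid_eq by auto
      have "col_of lam T b = col_of lam T a"
        using g h b True unfolding column_group_eq by fastforce
      then have "a = b" using b True entry_row_col by metis
      then show ?thesis using b by simp
    next
      case False
      then show ?thesis using g h by (simp add: column_group_eq permutes_def)
    qed
    then show "h = g" by auto
  qed simp
  have "polytabloid n lam T (perm_tabloid g (row_tabloid lam T)) =
      (\<Sum>h\<in>column_group n lam T. if h = g then of_int (sign h) else 0)"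
    unfolding polytabloid_def by (intro sum.cong refl) (simp add: eq)
  then show ?thesis using g finite_column_group by simp
qed

lemma polytabloid_0:
  "(\<And>g. g \<in> column_group n lam T \<Longrightarrow> t \<noteq> perm_tabloid g (row_tabloid lam T)) \<Longrightarrow> polytabloid n lam T t = 0"
  unfolding polytabloid_def by (rule sum.neutral) simp

lemma polytabloid_support: "t \<notin> tabloids n lam \<Longrightarrow> polytabloid n lam T t = 0"
proof (rule polytabloid_0)
  fix g assume t: "t \<notin> tabloids n lam" and g: "g \<in> column_group n lam T"
  have "row_tabloid lam T \<in> tabloids n lam" using T by (simp add: tabloids_def)
  then show "t \<noteq> perm_tabloid g (row_tabloid lam T)"
    using t perm_tabloid_mem[OF _ column_group_permutes[OF g]] by metis
qed

end

section \<open>Tabloids in the column orbit of a tableau, and column-antisymmetric vectors\<close>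

lemma sum_set_minimal:
  fixes X :: "nat set"
  assumes fin: "finite X" and X: "0 \<notin> X"
  shows "\<Sum>{1..card X} \<le> \<Sum>X"
    and "\<Sum>X \<le> \<Sum>{1..card X} \<Longrightarrow> X = {1..card X}"
proof -
  let ?k = "card X" let ?I = "{1..?k}"
  \<comment> \<open>As many elements lie outside the initial segment as are missing from it, the
    former at least \<open>?k + 1\<close>, the latter at most \<open>?k\<close>. The surplus in the
    sum is therefore at least the number of elements exchanged, which settles the case of equality
    too.\<close>
  have card_eq: "card (X - ?I) = card (?I - X)"
    using fin by (metis card_atLeastAtMost card_le_sym_Diff diff_Suc_1 finite_atLeastAtMost le_antisym order_refl)
  have 1: "(?k + 1) * card (X - ?I) \<le> \<Sum>(X - ?I)"
  proof -
    have "of_nat (card (X - ?I)) * (?k + 1) \<le> \<Sum>(X - ?I)"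
    proof (rule sum_bounded_below)
      fix i assume i: "i \<in> X - ?I"
      then have "i \<noteq> 0" using X by (metis DiffD1)
      then show "?k + 1 \<le> i" using i by auto
    qed
    then show ?thesis by (simp add: mult.commute)
  qed
  have 2: "\<Sum>(?I - X) \<le> ?k * card (?I - X)"
    using sum_bounded_above[of "?I - X" "\<lambda>x. x" ?k] by (simp add: mult.commute)
  have s: "\<Sum>X = \<Sum>(X \<inter> ?I) + \<Sum>(X - ?I)" "\<Sum>?I = \<Sum>(X \<inter> ?I) + \<Sum>(?I - X)"
    using fin by (metis sum.Int_Diff, metis Int_commute finite_atLeastAtMost sum.Int_Diff)
  have 3: "\<Sum>?I + card (X - ?I) \<le> \<Sum>X" using 1 2 s card_eq by simp
  then show "\<Sum>?I \<le> \<Sum>X" by simp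
  assume "\<Sum>X \<le> \<Sum>?I"
  then have "card (X - ?I) = 0" using 3 by simp
  then have "X \<subseteq> ?I" using fin by simp
  then show "X = ?I" by (intro card_subset_eq) auto
qed

text \<open>The column indices occurring in a row of the tabloid are distinct, hence their sum is at least
  the corresponding sum for the diagram; the totals agree, so each row is met in its first columns.\<close>

lemma column_permutation_exists:
  assumes T: "T \<in> tableaux n lam" and t: "t \<in> tabloids n lam"
    and sep: "\<And>a b s. a \<in> t s \<Longrightarrow> b \<in> t s \<Longrightarrow> col_of lam T a = col_of lam T b \<Longrightarrow> a = b"
  shows "\<exists>g\<in>column_group n lam T. t = perm_tabloid g (row_tabloid lam T)"
proof -
  obtain T' where T': "T' \<in> tableaux n lam" and tT': "t = row_tabloid lam T'" using t by (auto simp: tabloids_def)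
  let ?col = "col_of lam T" and ?row = "row_of lam T'"
  have ts: "t s = {a \<in> {1..n}. ?row a = s}" for s by (simp add: tT' row_tabloid_eq[OF T'])
  define S where "S = {1..length lam}"
  have inj: "inj_on ?col (t s)" for s using sep by (auto simp: inj_on_def)
  have card_t: "card (t s) = part lam s" for s
  proof -
    have "inj_on T' {c \<in> cells lam. fst c = s}"
      using T' unfolding tableaux_def bij_betw_def by (auto intro: inj_on_subset)
    then have "card (t s) = card {c \<in> cells lam. fst c = s}"
      unfolding tT' row_tabloid_def by (rule card_image)
    also have "\<dots> = part lam s" unfolding cells_row by (simp add: card_image inj_on_def)
    finally show ?thesis .
  qed
  have fin_t: "finite (t s)" for s by (simp add: ts)
  have row_S: "?row a \<in> S" if "a \<in> {1..n}" for a
    using row_col_cell[OF T' that] by (auto simp: S_def cells_def part_def split: if_splits)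
  have pos: "0 \<notin> ?col ` t s" for s
  proof
    assume "0 \<in> ?col ` t s"
    then obtain a where "a \<in> {1..n}" "?col a = 0" by (auto simp: ts)
    then show False using row_col_cell[OF T] by (force simp: cells_def)
  qed
  have cardc: "card (?col ` t s) = part lam s" for s using inj by (simp add: card_image card_t)
  \<comment> \<open>The column index is summed over all entries in two ways, through the rows of
    \<open>t\<close> and through the cells of the diagram. Injectivity of \<open>?col\<close> on
    each row allows the first count to be read on sets of columns.\<close>
  have "(\<Sum>s\<in>S. \<Sum>(?col ` t s)) = (\<Sum>s\<in>S. \<Sum>a\<in>{a\<in>{1..n}. ?row a = s}. ?col a)"
    using inj by (simp add: sum.reindex ts)
  also have "\<dots> = (\<Sum>a\<in>{1..n}. ?col a)"
    by (rule sum.group) (use row_S in \<open>auto simp: S_def\<close>)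
  also have "\<dots> = (\<Sum>c\<in>cells lam. ?col (T c))"
    using T by (intro sum.reindex_bij_betw[symmetric]) (simp add: tableaux_def)
  also have "\<dots> = (\<Sum>c\<in>cells lam. snd c)" by (intro sum.cong refl col_of_entry[OF T])
  also have "\<dots> = (\<Sum>s\<in>S. \<Sum>c\<in>{c\<in>cells lam. fst c = s}. snd c)"
    by (rule sum.group[OF finite_cells, symmetric])
      (auto simp: S_def cells_def part_def split: if_splits)
  also have "\<dots> = (\<Sum>s\<in>S. \<Sum>{1..part lam s})"
    unfolding cells_row by (subst sum.reindex) (simp_all add: inj_on_def o_def)
  finally have tot: "(\<Sum>s\<in>S. \<Sum>(?col ` t s)) = (\<Sum>s\<in>S. \<Sum>{1..part lam s})" .
  have le: "\<Sum>{1..part lam s} \<le> \<Sum>(?col ` t s)" for s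
    using sum_set_minimal(1)[of "?col ` t s"] fin_t pos by (simp add: cardc)
  have "\<Sum>(?col ` t s) = \<Sum>{1..part lam s}" if "s \<in> S" for s
  proof (rule ccontr)
    assume "\<Sum>(?col ` t s) \<noteq> \<Sum>{1..part lam s}"
    then have "\<Sum>{1..part lam s} < \<Sum>(?col ` t s)" using le[of s] by simp
    then have "(\<Sum>s\<in>S. \<Sum>{1..part lam s}) < (\<Sum>s\<in>S. \<Sum>(?col ` t s))"
      using le that by (intro sum_strict_mono_ex1) (auto simp: S_def)
    then show False using tot by simp
  qed
  then have col_t: "?col ` t s = {1..part lam s}" if "s \<in> S" for s
    using sum_set_minimal(2)[of "?col ` t s"] that fin_t pos by (simp add: cardc)
  \<comment> \<open>The row in \<open>t\<close> and the column in \<open>T\<close> together form a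
    cell of the diagram, because row \<open>s\<close> of \<open>t\<close> meets exactly the columns
    from 1 to \<open>part lam s\<close>.\<close>
  define \<theta> where "\<theta> = (\<lambda>a. (?row a, ?col a))"
  have \<theta>: "\<theta> a \<in> cells lam" if "a \<in> {1..n}" for a
  proof -
    have "a \<in> t (?row a)" using that by (simp add: ts)
    then have "?col a \<in> {1..part lam (?row a)}" using col_t[OF row_S[OF that]] by blast
    then show ?thesis using row_S[OF that] by (auto simp: \<theta>_def cells_def S_def)
  qed
  have inj\<theta>: "inj_on \<theta> {1..n}" using sep by (auto simp: inj_on_def \<theta>_def ts)
  \<comment> \<open>\<open>h\<close> moves each entry inside its column of \<open>T\<close> to the
    row prescribed by \<open>t\<close>. It carries \<open>t\<close> to the row tabloid of
    \<open>T\<close>, so the element sought is its inverse.\<close>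
  define h where "h = (\<lambda>a. if a \<in> {1..n} then T (\<theta> a) else a)"
  have h: "h permutes {1..n}"
  proof (rule bij_imp_permutes)
    have injh: "inj_on h {1..n}"
    proof (rule inj_onI)
      fix a b assume ab: "a \<in> {1..n}" "b \<in> {1..n}" "h a = h b"
      then have "T (\<theta> a) = T (\<theta> b)" by (simp add: h_def)
      then show "a = b"
        using T \<theta>[OF ab(1)] \<theta>[OF ab(2)] inj_onD[OF inj\<theta> _ ab(1,2)]
        unfolding tableaux_def bij_betw_def by (blast dest: inj_onD)
    qed
    have "h ` {1..n} \<subseteq> {1..n}"
    proof (rule image_subsetI)
      fix a assume a: "a \<in> {1..n}"
      then have "h a = T (\<theta> a)" by (simp add: h_def)
      then show "h a \<in> {1..n}" using tableau_entry[OF T \<theta>[OF a]] by (simp only:)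
    qed
    from endo_inj_surj[OF finite_atLeastAtMost this injh] injh
    show "bij_betw h {1..n} {1..n}" unfolding bij_betw_def by blast
    show "h x = x" if "x \<notin> {1..n}" for x using that by (simp only: h_def if_False)
  qed
  have colh: "?col (h a) = ?col a" if "a \<in> {1..n}" for a
    using col_of_entry[OF T \<theta>[OF that]] that by (simp only: h_def if_True) (simp add: \<theta>_def)
  then have hC: "h \<in> column_group n lam T" using h by (simp add: column_group_eq[OF T])
  have rowh: "row_of lam T (h a) = ?row a" if "a \<in> {1..n}" for a
    using row_of_entry[OF T \<theta>[OF that]] that by (simp only: h_def if_True) (simp add: \<theta>_def)
  have "perm_tabloid h t = row_tabloid lam T"
  proof
    fix s
    have "h ` t s \<subseteq> row_tabloid lam T s"
      using rowh permutes_in_image[OF h] by (auto simp: ts row_tabloid_eq[OF T])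
    moreover have "row_tabloid lam T s \<subseteq> h ` t s"
    proof
      fix b assume "b \<in> row_tabloid lam T s"
      then have b: "b \<in> {1..n}" "row_of lam T b = s" by (auto simp: row_tabloid_eq[OF T])
      then obtain a where "a \<in> {1..n}" "b = h a" using permutes_image[OF h] by (metis imageE)
      then show "b \<in> h ` t s" using b rowh by (auto simp: ts)
    qed
    ultimately show "perm_tabloid h t s = row_tabloid lam T s" by (auto simp: perm_tabloid_def)
  qed
  then have "t = perm_tabloid (inv_into UNIV h) (row_tabloid lam T)"
    using perm_tabloid_inv_left[OF permutes_bij[OF h]] by metis
  then show ?thesis using column_group_inv[OF T hC] by blast
qed

text \<open>If two entries share a row of \<open>t\<close> and a column of \<open>T\<close>, their
  transposition fixes \<open>t\<close> and reverses the sign, so \<open>v t = 0\<close>. Every other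
  tabloid lies in the orbit of the row tabloid of \<open>T\<close>, where antisymmetry prescribes
  the value.\<close>

lemma column_antisymmetric_multiple:
  assumes T: "T \<in> tableaux n lam"
    and supp: "\<And>t. t \<notin> tabloids n lam \<Longrightarrow> v t = 0"
    and anti: "\<And>g t. g \<in> column_group n lam T \<Longrightarrow> v (perm_tabloid g t) = of_int (sign g) * v t"
  shows "v = cscale (v (row_tabloid lam T)) (polytabloid n lam T)"
proof
  fix t
  show "v t = cscale (v (row_tabloid lam T)) (polytabloid n lam T) t"
  proof (cases "\<exists>g\<in>column_group n lam T. t = perm_tabloid g (row_tabloid lam T)")
    case True
    then show ?thesis using anti polytabloid_orbit[OF T] by (auto simp: cscale_def)
  next
    case no: False
    have "v t = 0"
    proof (cases "t \<in> tabloids n lam")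
      case True
      then obtain a b s where ab: "a \<in> t s" "b \<in> t s" "col_of lam T a = col_of lam T b" "a \<noteq> b"
        using column_permutation_exists[OF T True] no by blast
      obtain T' where T': "T' \<in> tableaux n lam" "t = row_tabloid lam T'"
        using True by (auto simp: tabloids_def)
      have ts: "t x = {a \<in> {1..n}. row_of lam T' a = x}" for x by (simp add: T' row_tabloid_eq[OF T'(1)])
      let ?g = "transpose a b"
      have g: "?g permutes {1..n}" using ab ts by (intro permutes_swap_id) auto
      have "?g \<in> column_group n lam T"
        using g ab by (auto simp: column_group_eq[OF T] transpose_def)
      then have "v (perm_tabloid ?g t) = - v t" using anti[of ?g t] ab by (simp add: sign_swap_id)
      moreover have "perm_tabloid ?g t = t"
      proof
        fix x
        have "a \<in> t x \<longleftrightarrow> b \<in> t x" using ab by (auto simp: ts)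
        then show "perm_tabloid ?g t x = t x" by (simp add: perm_tabloid_def)
      qed
      ultimately show ?thesis by simp
    qed (rule supp)
    then show ?thesis using no polytabloid_0[OF T] by (auto simp: cscale_def)
  qed
qed

text \<open>Conjugation by \<open>g\<close> carries the column group of \<open>T\<close> onto that
  of \<open>g \<circ> T\<close> and preserves signs, so the two signed sums match term by
  term.\<close>

lemma act_polytabloid:
  assumes T: "T \<in> tableaux n lam" and g: "g permutes {1..n}"
  shows "act g (polytabloid n lam T) = polytabloid n lam (g \<circ> T)"
proof
  fix t
  have bg: "bij g" using g permutes_bij by blast
  have gT: "g \<circ> T \<in> tableaux n lam" using T g by (rule tableaux_comp)
  have col: "col_of lam (g \<circ> T) (g a) = col_of lam T a" if "a \<in> {1..n}" for a
    using col_of_entry[OF gT row_col_cell[OF T that]] entry_row_col[OF T that] by simp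
  have perms: "permutation h" if "h permutes {1..n}" for h
    using that permutation_permutes by blast
  let ?c = "\<lambda>h. g \<circ> h \<circ> inv_into UNIV g" and ?d = "\<lambda>h. inv_into UNIV g \<circ> h \<circ> g"
  have ii: "inv_into UNIV g (g x) = x" "g (inv_into UNIV g x) = x" for x
    using bg by (auto simp: bij_is_inj bij_is_surj surj_f_inv_f)
  have mem: "?c h \<in> column_group n lam (g \<circ> T)" if "h \<in> column_group n lam T" for h
  proof -
    have hp: "h permutes {1..n}" and hc: "\<And>a. a \<in> {1..n} \<Longrightarrow> col_of lam T (h a) = col_of lam T a"
      using that by (auto simp: column_group_eq[OF T])
    have "col_of lam (g \<circ> T) (?c h a) = col_of lam (g \<circ> T) a" if "a \<in> {1..n}" for a
    proof -
      have a': "inv_into UNIV g a \<in> {1..n}" using that permutes_in_image[OF permutes_inv[OF g]] by simp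
      then have "h (inv_into UNIV g a) \<in> {1..n}" using permutes_in_image[OF hp] by simp
      then show ?thesis using col[OF a'] hc[OF a'] by (simp add: col ii)
    qed
    then show ?thesis using hp g by (auto simp: column_group_eq[OF gT] intro!: permutes_compose permutes_inv)
  qed
  have mem': "?d h \<in> column_group n lam T" if "h \<in> column_group n lam (g \<circ> T)" for h
  proof -
    have hp: "h permutes {1..n}" and hc: "\<And>a. a \<in> {1..n} \<Longrightarrow> col_of lam (g \<circ> T) (h a) = col_of lam (g \<circ> T) a"
      using that by (auto simp: column_group_eq[OF gT])
    have "col_of lam T (?d h a) = col_of lam T a" if a: "a \<in> {1..n}" for a
    proof -
      have a': "g a \<in> {1..n}" using a permutes_in_image[OF g] by simp
      then have "h (g a) \<in> {1..n}" using permutes_in_image[OF hp] by simp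
      then have "inv_into UNIV g (h (g a)) \<in> {1..n}" using permutes_in_image[OF permutes_inv[OF g]] by simp
      from col[OF this] show ?thesis using hc[OF a'] col[OF a] by (simp add: ii)
    qed
    then show ?thesis using hp g by (auto simp: column_group_eq[OF T] intro!: permutes_compose permutes_inv)
  qed
  have "act g (polytabloid n lam T) t =
     (\<Sum>h\<in>column_group n lam T. of_int (sign h) * (if t = perm_tabloid g (perm_tabloid h (row_tabloid lam T)) then 1 else 0))"
    by (simp add: act_def polytabloid_def perm_tabloid_eq_iff[OF bg])
  also have "\<dots> = (\<Sum>h\<in>column_group n lam (g \<circ> T). of_int (sign h) * (if t = perm_tabloid h (row_tabloid lam (g \<circ> T)) then 1 else 0))"
  proof (rule sum.reindex_bij_witness[of _ ?d ?c])
    fix h assume h: "h \<in> column_group n lam T"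
    have hp: "h permutes {1..n}" using h column_group_permutes[OF T] by blast
    show "?d (?c h) = h" by (auto simp: fun_eq_iff ii)
    show "?c h \<in> column_group n lam (g \<circ> T)" using h by (rule mem)
    have "sign (?c h) = sign h"
      using perms[OF hp] perms[OF g] permutation_inverse[OF perms[OF g]]
      by (simp add: sign_compose permutation_compose sign_inverse sign_idempotent mult.commute[of "sign g"] mult.assoc)
    moreover have "perm_tabloid (?c h) (row_tabloid lam (g \<circ> T)) = perm_tabloid g (perm_tabloid h (row_tabloid lam T))"
      by (simp add: row_tabloid_comp perm_tabloid_comp o_assoc[symmetric] bij_is_inj[OF bg])
    ultimately show "of_int (sign (?c h)) * (if t = perm_tabloid (?c h) (row_tabloid lam (g \<circ> T)) then 1 else 0) =
        (of_int (sign h) * (if t = perm_tabloid g (perm_tabloid h (row_tabloid lam T)) then 1 else 0) :: complex)" by simp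
  next
    fix h assume h: "h \<in> column_group n lam (g \<circ> T)"
    show "?c (?d h) = h" by (auto simp: fun_eq_iff ii)
    show "?d h \<in> column_group n lam T" using h by (rule mem')
  qed
  also have "\<dots> = polytabloid n lam (g \<circ> T) t" by (simp add: polytabloid_def)
  finally show "act g (polytabloid n lam T) t = polytabloid n lam (g \<circ> T) t" .
qed

section \<open>Specht modules: invariance, support, finite dimension, complex conjugation\<close>

lemma specht_invariant: "invariant_subspace {g. g permutes {1..n}} (specht n lam)"
proof -
  have "act g v \<in> specht n lam" if g: "g permutes {1..n}" and v: "v \<in> specht n lam" for g v
  proof -
    interpret l: Vector_Spaces.linear cscale cscale "act g" by (rule clinear_act)
    have "act g ` (polytabloid n lam ` tableaux n lam) \<subseteq> polytabloid n lam ` tableaux n lam"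
      using act_polytabloid[OF _ g] tableaux_comp[OF _ g] by auto
    then show ?thesis
      using v l.span_image[of "polytabloid n lam ` tableaux n lam"] cfun.span_mono
      unfolding specht_def by blast
  qed
  then show ?thesis by (auto simp: invariant_subspace_def specht_def)
qed

lemma specht_support:
  assumes "v \<in> specht n lam" "t \<notin> tabloids n lam"
  shows "v t = 0"
proof -
  have "cfun.subspace {v. v t = 0}" by (auto simp: cfun.subspace_def cscale_def)
  moreover have "polytabloid n lam ` tableaux n lam \<subseteq> {v. v t = 0}"
    using polytabloid_support assms(2) by auto
  ultimately have "specht n lam \<subseteq> {v. v t = 0}" unfolding specht_def by (intro cfun.span_minimal)
  then show ?thesis using assms(1) by auto
qed

lemma fin_dim_specht: "fin_dim (specht n lam)"
proof -
  let ?\<delta> = "\<lambda>t :: tabloid. (\<lambda>x. if x = t then 1 else 0 :: complex)"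
  have "v \<in> cfun.span (?\<delta> ` tabloids n lam)" if "v \<in> specht n lam" for v
  proof -
    have "v = (\<Sum>t\<in>tabloids n lam. cscale (v t) (?\<delta> t))"
    proof
      fix x
      have "(\<Sum>t\<in>tabloids n lam. cscale (v t) (?\<delta> t)) x = (\<Sum>t\<in>tabloids n lam. if t = x then v t else 0)"
        unfolding sum_fun_apply by (intro sum.cong) (auto simp: cscale_def)
      then show "v x = (\<Sum>t\<in>tabloids n lam. cscale (v t) (?\<delta> t)) x"
        using specht_support[OF that, of x] finite_tabloids[of n lam] by simp
    qed
    then show ?thesis
      by (metis (no_types, lifting) cfun.span_sum cfun.span_scale cfun.span_base imageI)
  qed
  then show ?thesis unfolding fin_dim_def using finite_tabloids[of n lam]
    by (auto simp: specht_def intro!: exI[of _ "?\<delta> ` tabloids n lam"])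
qed

text \<open>Orthogonality in the submodule theorem is taken for the bilinear pairing, which has
  isotropic vectors. Pairing a vector of the module with its conjugate, again in the module, gives a
  sum of squared absolute values.\<close>

lemma cnj_specht:
  assumes "v \<in> specht n lam"
  shows "(\<lambda>t. cnj (v t)) \<in> specht n lam"
proof -
  have "cfun.subspace {v. (\<lambda>t. cnj (v t)) \<in> specht n lam}"
  proof (unfold cfun.subspace_def mem_Collect_eq, intro conjI ballI allI)
    have s: "cfun.subspace (specht n lam)" by (simp add: specht_def)
    show "(\<lambda>t. cnj (0 t)) \<in> specht n lam" using cfun.subspace_0[OF s] by (simp add: zero_fun_def)
    show "(\<lambda>t. cnj ((x + y) t)) \<in> specht n lam" if "x \<in> {v. (\<lambda>t. cnj (v t)) \<in> specht n lam}"
      "y \<in> {v. (\<lambda>t. cnj (v t)) \<in> specht n lam}" for x y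
      using cfun.subspace_add[OF s, of "\<lambda>t. cnj (x t)" "\<lambda>t. cnj (y t)"] that by (simp add: plus_fun_def)
    show "(\<lambda>t. cnj (cscale c x t)) \<in> specht n lam" if "x \<in> {v. (\<lambda>t. cnj (v t)) \<in> specht n lam}" for c x
      using cfun.subspace_scale[OF s, of "\<lambda>t. cnj (x t)" "cnj c"] that by (simp add: cscale_def)
  qed
  moreover have "(\<lambda>t. cnj (polytabloid n lam T t)) = polytabloid n lam T" for T
    by (simp add: polytabloid_def if_distrib cong: if_cong)
  then have "polytabloid n lam ` tableaux n lam \<subseteq> {v. (\<lambda>t. cnj (v t)) \<in> specht n lam}"
    by (auto simp: specht_def intro!: cfun.span_base)
  ultimately have "specht n lam \<subseteq> {v. (\<lambda>t. cnj (v t)) \<in> specht n lam}"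
    unfolding specht_def by (intro cfun.span_minimal)
  then show ?thesis using assms by auto
qed

section \<open>Column antisymmetrizers and James's submodule theorem\<close>

definition column_antisymmetrizer :: "nat \<Rightarrow> nat list \<Rightarrow> (nat \<times> nat \<Rightarrow> nat) \<Rightarrow> tvec \<Rightarrow> tvec" where
  "column_antisymmetrizer n lam T u = (\<Sum>g\<in>column_group n lam T. cscale (of_int (sign g)) (act g u))"

lemma column_antisymmetrizer_apply:
  "column_antisymmetrizer n lam T u t =
    (\<Sum>g\<in>column_group n lam T. of_int (sign g) * u (perm_tabloid (inv_into UNIV g) t))"
  by (simp add: column_antisymmetrizer_def cscale_def act_def sum_fun_apply)

lemma column_antisymmetrizer_multiple:
  assumes T: "T \<in> tableaux n lam" and u: "\<And>t. t \<notin> tabloids n lam \<Longrightarrow> u t = 0"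
  shows "column_antisymmetrizer n lam T u =
    cscale (column_antisymmetrizer n lam T u (row_tabloid lam T)) (polytabloid n lam T)"
proof (rule column_antisymmetric_multiple[OF T])
  note per = column_group_permutes[OF T]
  fix t assume t: "t \<notin> tabloids n lam"
  have "perm_tabloid (inv_into UNIV g) t \<notin> tabloids n lam" if "g \<in> column_group n lam T" for g
    using t perm_tabloid_mem[OF _ per[OF that]] perm_tabloid_inv_right[OF permutes_bij[OF per[OF that]]] by metis
  then show "column_antisymmetrizer n lam T u t = 0"
    by (simp add: column_antisymmetrizer_apply u)
next
  note per = column_group_permutes[OF T]
  fix g t assume g: "g \<in> column_group n lam T"
  have perms: "permutation h" if "h \<in> column_group n lam T" for h
    using per[OF that] permutation_permutes by blast
  have bg: "bij g" using per[OF g] permutes_bij by blast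
  have ii: "inv_into UNIV g (g x) = x" "g (inv_into UNIV g x) = x" for x
    using bg by (auto simp: bij_is_inj bij_is_surj surj_f_inv_f)
  show "column_antisymmetrizer n lam T u (perm_tabloid g t) = of_int (sign g) * column_antisymmetrizer n lam T u t"
    unfolding column_antisymmetrizer_apply sum_distrib_left
  proof (rule sum.reindex_bij_witness[of _ "\<lambda>h. g \<circ> h" "\<lambda>h. inv_into UNIV g \<circ> h"])
    fix h assume h: "h \<in> column_group n lam T"
    show "g \<circ> (inv_into UNIV g \<circ> h) = h" by (auto simp: ii)
    show "inv_into UNIV g \<circ> h \<in> column_group n lam T"
      using h g column_group_comp[OF T] column_group_inv[OF T] by blast
    have bh: "bij h" using per[OF h] permutes_bij by blast
    have "inv_into UNIV (inv_into UNIV g \<circ> h) = inv_into UNIV h \<circ> g"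
      using bg bh by (simp add: o_inv_distrib bij_imp_bij_inv inv_inv_eq)
    moreover have "sign g * sign (inv_into UNIV g \<circ> h) = sign h"
      using perms g h column_group_inv[OF T g]
      by (simp add: sign_compose sign_inverse sign_idempotent mult.assoc[symmetric])
    ultimately show "of_int (sign g) * (of_int (sign (inv_into UNIV g \<circ> h)) * u (perm_tabloid (inv_into UNIV (inv_into UNIV g \<circ> h)) t)) =
        of_int (sign h) * u (perm_tabloid (inv_into UNIV h) (perm_tabloid g t))"
      by (simp add: perm_tabloid_comp mult.assoc[symmetric] flip: of_int_mult)
  next
    fix h assume h: "h \<in> column_group n lam T"
    show "inv_into UNIV g \<circ> (g \<circ> h) = h" by (auto simp: ii)
    show "g \<circ> h \<in> column_group n lam T" using g h column_group_comp[OF T] by blast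
  qed
qed

text \<open>Since a permutation and its inverse have the same sign, reindexing by inverses turns the
  coefficient into the bilinear pairing of \<open>u\<close> with the polytabloid. A vector killed by
  all antisymmetrizers is therefore orthogonal to the Specht module.\<close>

lemma column_antisymmetrizer_coeff:
  assumes T: "T \<in> tableaux n lam"
  shows "column_antisymmetrizer n lam T u (row_tabloid lam T) = (\<Sum>t\<in>tabloids n lam. u t * polytabloid n lam T t)"
proof -
  note per = column_group_permutes[OF T]
  let ?T = "row_tabloid lam T"
  have "column_antisymmetrizer n lam T u ?T =
      (\<Sum>g\<in>column_group n lam T. of_int (sign g) * u (perm_tabloid g ?T))"
    unfolding column_antisymmetrizer_apply
  proof (rule sum.reindex_bij_witness[of _ "inv_into UNIV" "inv_into UNIV"])
    fix g assume g: "g \<in> column_group n lam T"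
    have "permutation g" using per[OF g] permutation_permutes by blast
    then show "of_int (sign (inv_into UNIV g)) * u (perm_tabloid (inv_into UNIV g) ?T) =
        of_int (sign g) * u (perm_tabloid (inv_into UNIV g) ?T)" by (simp add: sign_inverse)
  qed (auto simp: column_group_inv[OF T] inv_inv_eq[OF permutes_bij[OF per]])
  also have "\<dots> = (\<Sum>g\<in>column_group n lam T. \<Sum>t\<in>tabloids n lam.
      if t = perm_tabloid g ?T then of_int (sign g) * u t else 0)"
  proof (rule sum.cong[OF refl])
    fix g assume g: "g \<in> column_group n lam T"
    have "perm_tabloid g ?T \<in> tabloids n lam"
      using perm_tabloid_mem[OF _ per[OF g]] T by (auto simp: tabloids_def)
    then show "of_int (sign g) * u (perm_tabloid g ?T) =
        (\<Sum>t\<in>tabloids n lam. if t = perm_tabloid g ?T then of_int (sign g) * u t else 0)"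
      using finite_tabloids[of n lam] by simp
  qed
  also have "\<dots> = (\<Sum>t\<in>tabloids n lam. \<Sum>g\<in>column_group n lam T.
      if t = perm_tabloid g ?T then of_int (sign g) * u t else 0)" by (rule sum.swap)
  also have "\<dots> = (\<Sum>t\<in>tabloids n lam. u t * polytabloid n lam T t)"
    unfolding polytabloid_def sum_distrib_left by (intro sum.cong) auto
  finally show ?thesis .
qed

lemma tableaux_transitive:
  assumes T: "T \<in> tableaux n lam" and T': "T' \<in> tableaux n lam"
  shows "\<exists>g. g permutes {1..n} \<and> polytabloid n lam T' = act g (polytabloid n lam T)"
proof -
  define g where "g = (\<lambda>a. if a \<in> {1..n} then T' (inv_into (cells lam) T a) else a)"
  have b: "bij_betw T (cells lam) {1..n}" "bij_betw T' (cells lam) {1..n}"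
    using T T' by (auto simp: tableaux_def)
  have "bij_betw (T' \<circ> inv_into (cells lam) T) {1..n} {1..n}"
    using b by (meson bij_betw_inv_into bij_betw_trans)
  also have "?this \<longleftrightarrow> bij_betw g {1..n} {1..n}"
    by (intro bij_betw_cong) (simp only: g_def if_True o_apply)
  finally have g: "g permutes {1..n}"
    by (rule bij_imp_permutes) (simp only: g_def if_False)
  \<comment> \<open>Tableaux are total functions, and \<open>g \<circ> T\<close> and
    \<open>T'\<close> may differ outside the diagram; row tabloids and column groups only see the
    cells.\<close>
  have agree: "(g \<circ> T) c = T' c" if "c \<in> cells lam" for c
    using that b(1) tableau_entry[OF T that] by (simp add: g_def bij_betw_inv_into_left)
  have "row_tabloid lam (g \<circ> T) = row_tabloid lam T'"
    unfolding row_tabloid_def by (intro ext image_cong) (use agree in auto)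
  moreover have "column_group n lam (g \<circ> T) = column_group n lam T'"
  proof -
    have "(g \<circ> T) ` {c \<in> cells lam. snd c = j} = T' ` {c \<in> cells lam. snd c = j}" for j
      by (intro image_cong) (use agree in auto)
    then show ?thesis unfolding column_group_def by simp
  qed
  ultimately have "polytabloid n lam (g \<circ> T) = polytabloid n lam T'"
    by (simp add: polytabloid_def)
  then show ?thesis using g act_polytabloid[OF T g] by metis
qed

text \<open>James's submodule theorem: if some column antisymmetrizer does not annihilate a submodule,
  the submodule contains a polytabloid; otherwise it is orthogonal to the Specht module.\<close>

theorem specht_irreducible:
  assumes U: "U \<subseteq> specht n lam" "invariant_subspace {g. g permutes {1..n}} U" "U \<noteq> {0}"
  shows "U = specht n lam"
proof -
  have sU: "cfun.subspace U" and actU: "\<And>g u. g permutes {1..n} \<Longrightarrow> u \<in> U \<Longrightarrow> act g u \<in> U"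
    using U(2) by (auto simp: invariant_subspace_def)
  show ?thesis
  proof (cases "\<exists>T\<in>tableaux n lam. \<exists>u\<in>U. column_antisymmetrizer n lam T u (row_tabloid lam T) \<noteq> 0")
    case True
    then obtain T u where T: "T \<in> tableaux n lam" and u: "u \<in> U"
      and c: "column_antisymmetrizer n lam T u (row_tabloid lam T) \<noteq> 0" (is "?c \<noteq> 0") by blast
    have "column_antisymmetrizer n lam T u \<in> U"
      unfolding column_antisymmetrizer_def
      by (intro cfun.subspace_sum[OF sU] cfun.subspace_scale[OF sU] actU u column_group_permutes[OF T])
    then have "cscale ?c (polytabloid n lam T) \<in> U"
      using column_antisymmetrizer_multiple[OF T, of u] u U(1) specht_support by (metis subsetD)
    then have "cscale (1 / ?c) (cscale ?c (polytabloid n lam T)) \<in> U"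
      by (rule cfun.subspace_scale[OF sU])
    then have eU: "polytabloid n lam T \<in> U" using c by simp
    have "polytabloid n lam T' \<in> U" if "T' \<in> tableaux n lam" for T'
      using tableaux_transitive[OF T that] actU eU by auto
    then have "specht n lam \<subseteq> U" unfolding specht_def by (intro cfun.span_minimal sU) auto
    then show ?thesis using U(1) by auto
  next
    case False
    have "u = 0" if u: "u \<in> U" for u
    proof -
      have "cfun.subspace {v. (\<Sum>t\<in>tabloids n lam. u t * v t) = 0}"
        by (auto simp: cfun.subspace_def cscale_def distrib_left sum.distrib mult.left_commute
            simp flip: sum_distrib_left)
      moreover have "polytabloid n lam ` tableaux n lam \<subseteq> {v. (\<Sum>t\<in>tabloids n lam. u t * v t) = 0}"
        using False u column_antisymmetrizer_coeff by fastforce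
      ultimately have "specht n lam \<subseteq> {v. (\<Sum>t\<in>tabloids n lam. u t * v t) = 0}"
        unfolding specht_def by (intro cfun.span_minimal)
      then have "(\<Sum>t\<in>tabloids n lam. u t * cnj (u t)) = 0"
        using cnj_specht[of u n lam] u U(1) by auto
      then have "complex_of_real (\<Sum>t\<in>tabloids n lam. (cmod (u t))\<^sup>2) = 0"
        by (simp add: complex_norm_square del: of_real_power)
      then have "(\<Sum>t\<in>tabloids n lam. (cmod (u t))\<^sup>2) = 0" by (simp only: of_real_eq_0_iff)
      then have "u t = 0" if "t \<in> tabloids n lam" for t
        using that finite_tabloids[of n lam] by (simp add: sum_nonneg_eq_0_iff)
      then show "u = 0" using specht_support[of u n lam] u U(1) by (auto simp: fun_eq_iff)
    qed
    then have "U = {0}" using cfun.subspace_0[OF sU] by auto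
    then show ?thesis using U(3) by simp
  qed
qed

section \<open>Splitting over the alternating group\<close>

lemma invariant_subspaceD:
  "invariant_subspace G V \<Longrightarrow> cfun.subspace V"
  "invariant_subspace G V \<Longrightarrow> g \<in> G \<Longrightarrow> v \<in> V \<Longrightarrow> act g v \<in> V"
  by (auto simp: invariant_subspace_def)

lemma invariant_subspace_Int:
  "invariant_subspace G V \<Longrightarrow> invariant_subspace G W \<Longrightarrow> invariant_subspace G (V \<inter> W)"
  by (auto simp: invariant_subspace_def cfun.subspace_inter)

lemma invariant_subspace_sum:
  assumes "invariant_subspace G V" "invariant_subspace G W"
  shows "invariant_subspace G {x + y | x y. x \<in> V \<and> y \<in> W}"
  unfolding invariant_subspace_def
proof (intro conjI ballI)
  show "cfun.subspace {x + y | x y. x \<in> V \<and> y \<in> W}"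
    using assms by (intro cfun.subspace_sums) (auto simp: invariant_subspace_def)
  fix g v assume g: "g \<in> G" and "v \<in> {x + y | x y. x \<in> V \<and> y \<in> W}"
  then obtain x y where "v = x + y" "x \<in> V" "y \<in> W" by blast
  then show "act g v \<in> {x + y | x y. x \<in> V \<and> y \<in> W}"
    using clinear_add[OF clinear_act, of g x y] invariant_subspaceD(2)[OF assms(1) g]
      invariant_subspaceD(2)[OF assms(2) g] by blast
qed

lemma permutes_bijs:
  assumes "g permutes S"
  shows "bij g" "bij (inv_into UNIV g)" "inv_into UNIV (inv_into UNIV g) = g"
  using assms by (auto simp: permutes_bij bij_imp_bij_inv inv_inv_eq)

lemma alt_conjugate:
  assumes s: "\<sigma> permutes {1..n}" and g: "g \<in> carrier (alt_group n)"
  shows "\<sigma> \<circ> g \<circ> inv_into UNIV \<sigma> \<in> carrier (alt_group n)"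
proof -
  have g': "g permutes {1..n}" "evenperm g" using g by (auto simp: alt_group_carrier)
  have P: "permutation \<sigma>" "permutation g" "permutation (inv_into UNIV \<sigma>)"
    using s g' permutes_inv[OF s] permutation_permutes by blast+
  have "evenperm (\<sigma> \<circ> g \<circ> inv_into UNIV \<sigma>)"
    using P g'(2) by (simp add: evenperm_comp permutation_compose evenperm_inv)
  then show ?thesis
    using s g'(1) by (auto simp: alt_group_carrier intro!: permutes_compose permutes_inv)
qed

lemma alt_permutes: "g \<in> carrier (alt_group n) \<Longrightarrow> g permutes {1..n}"
  by (simp add: alt_group_carrier)

lemma invariant_subspace_translate:
  assumes V: "invariant_subspace (carrier (alt_group n)) V" and s: "\<sigma> permutes {1..n}"
  shows "invariant_subspace (carrier (alt_group n)) (act \<sigma> ` V)"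
  unfolding invariant_subspace_def
proof (intro conjI ballI)
  interpret l: Vector_Spaces.linear cscale cscale "act \<sigma>" by (rule clinear_act)
  show "cfun.subspace (act \<sigma> ` V)" using V l.subspace_image by (auto simp: invariant_subspace_def)
  fix g v assume g: "g \<in> carrier (alt_group n)" and "v \<in> act \<sigma> ` V"
  then obtain u where u: "u \<in> V" "v = act \<sigma> u" by blast
  note b = permutes_bijs[OF s] permutes_bijs[OF alt_permutes[OF g]]
  let ?h = "inv_into UNIV \<sigma> \<circ> g \<circ> \<sigma>"
  have "?h \<in> carrier (alt_group n)" using alt_conjugate[OF permutes_inv[OF s] g] b by simp
  then have "act ?h u \<in> V" using V u invariant_subspaceD by blast
  moreover have "act g v = act \<sigma> (act ?h u)"
  proof -
    have "\<sigma> \<circ> ?h = g \<circ> \<sigma>" using b by (simp add: o_assoc bij_comp_inv)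
    then show ?thesis using u b by (simp add: act_comp bij_comp)
  qed
  ultimately show "act g v \<in> act \<sigma> ` V" by blast
qed

lemma act_image_inv: "bij \<sigma> \<Longrightarrow> act \<sigma> ` act (inv_into UNIV \<sigma>) ` V = V"
  by (simp add: image_image act_inv_right)

lemma act_zero: "act g 0 = 0"
  using clinear_zero[OF clinear_act] .

lemma irreducible_rep_translate:
  assumes V: "irreducible_rep (carrier (alt_group n)) V" and s: "\<sigma> permutes {1..n}"
  shows "irreducible_rep (carrier (alt_group n)) (act \<sigma> ` V)"
  unfolding irreducible_rep_def
proof (intro conjI allI impI)
  note b = permutes_bijs[OF s]
  have iV: "invariant_subspace (carrier (alt_group n)) V" and V0: "V \<noteq> {0}"
    and irr: "\<And>W. W \<subseteq> V \<Longrightarrow> invariant_subspace (carrier (alt_group n)) W \<Longrightarrow> W = {0} \<or> W = V"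
    using V by (auto simp: irreducible_rep_def)
  show "invariant_subspace (carrier (alt_group n)) (act \<sigma> ` V)"
    using iV s by (rule invariant_subspace_translate)
  have inv': "act (inv_into UNIV \<sigma>) ` act \<sigma> ` U = U" for U
    by (simp add: image_image act_inv_left b(1))
  show "act \<sigma> ` V \<noteq> {0}"
  proof
    assume "act \<sigma> ` V = {0}"
    then have "V = act (inv_into UNIV \<sigma>) ` {0}" using inv'[of V] by simp
    then show False using V0 by (simp add: act_zero)
  qed
  fix W assume W: "W \<subseteq> act \<sigma> ` V \<and> invariant_subspace (carrier (alt_group n)) W"
  have "act (inv_into UNIV \<sigma>) ` W \<subseteq> V" using W inv'[of V] by blast
  moreover have "invariant_subspace (carrier (alt_group n)) (act (inv_into UNIV \<sigma>) ` W)"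
    using W invariant_subspace_translate permutes_inv[OF s] by blast
  ultimately have "act (inv_into UNIV \<sigma>) ` W = {0} \<or> act (inv_into UNIV \<sigma>) ` W = V" by (rule irr)
  then have "act \<sigma> ` act (inv_into UNIV \<sigma>) ` W = act \<sigma> ` {0} \<or> act \<sigma> ` act (inv_into UNIV \<sigma>) ` W = act \<sigma> ` V"
    by (elim disjE; simp only: simp_thms)
  then show "W = {0} \<or> W = act \<sigma> ` V" by (simp add: act_image_inv[OF b(1)] act_zero)
qed

lemma rep_character_translate:
  assumes V: "fin_dim V" "invariant_subspace (carrier (alt_group n)) V"
    and s: "\<sigma> permutes {1..n}" and h: "h \<in> carrier (alt_group n)"
  shows "rep_character (act \<sigma> ` V) (\<sigma> \<circ> h \<circ> inv_into UNIV \<sigma>) = rep_character V h"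
  unfolding rep_character_def
proof (rule trace_on_transport[OF V(1) clinear_act _ clinear_act _ clinear_act])
  note b = permutes_bijs[OF s] permutes_bijs[OF alt_permutes[OF h]]
  show "inj (act \<sigma>)" by (rule inj_act[OF b(1)])
  show "act h ` V \<subseteq> V" using V(2) h by (auto simp: invariant_subspace_def)
  show "act (\<sigma> \<circ> h \<circ> inv_into UNIV \<sigma>) (act \<sigma> v) = act \<sigma> (act h v)" for v
  proof -
    have "(\<sigma> \<circ> h \<circ> inv_into UNIV \<sigma>) \<circ> \<sigma> = \<sigma> \<circ> h" using b by (simp add: o_assoc[symmetric] bij_comp_inv)
    then show ?thesis using b by (simp add: act_comp bij_comp)
  qed
qed

section \<open>The two halves of a Specht module and their difference character\<close>

locale alt_split =
  fixes n :: nat and lam :: "nat list" and Vp Vm :: "tvec set"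
  assumes splitting: "alt_splitting n lam Vp Vm"
    and distinguished: "\<exists>w\<in>carrier (alt_group n). rep_character Vp w \<noteq> rep_character Vm w"
begin

abbreviation "G \<equiv> carrier (alt_group n)"

lemma irreducibles: "irreducible_rep G Vp" "irreducible_rep G Vm"
  and decomposition: "specht n lam = {x + y | x y. x \<in> Vp \<and> y \<in> Vm}" "Vp \<inter> Vm = {0}"
  using splitting by (auto simp: alt_splitting_def)

lemma invariants: "invariant_subspace G Vp" "invariant_subspace G Vm"
  using irreducibles by (auto simp: irreducible_rep_def)

lemma zero_mem: "0 \<in> Vp" "0 \<in> Vm"
  using decomposition(2) by auto

lemma subset_specht: "Vp \<subseteq> specht n lam" "Vm \<subseteq> specht n lam"
proof -
  show "Vp \<subseteq> specht n lam"
  proof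
    fix v assume "v \<in> Vp"
    then have "v + 0 \<in> specht n lam" unfolding decomposition(1) using zero_mem by blast
    then show "v \<in> specht n lam" by simp
  qed
  show "Vm \<subseteq> specht n lam"
  proof
    fix v assume "v \<in> Vm"
    then have "0 + v \<in> specht n lam" unfolding decomposition(1) using zero_mem by blast
    then show "v \<in> specht n lam" by simp
  qed
qed

lemma fin_dims: "fin_dim Vp" "fin_dim Vm"
  using fin_dim_subset[OF fin_dim_specht] subset_specht invariants by (auto simp: invariant_subspace_def)

text \<open>Split a nonzero \<open>w\<close> in \<open>W\<close> as \<open>a + b\<close>. Here
  \<open>b\<close> is nonzero, as otherwise \<open>w\<close> would lie in
  \<open>W \<inter> A\<close>, and \<open>b = w - a\<close> belongs to the sum of \<open>W\<close>
  and \<open>A\<close>. So that sum meets the irreducible \<open>B\<close> nontrivially and contains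
  it.\<close>

lemma complement_of_irreducible:
  assumes A: "invariant_subspace G A" and B: "irreducible_rep G B"
    and V: "specht n lam = {x + y | x y. x \<in> A \<and> y \<in> B}"
    and W: "invariant_subspace G W" "W \<subseteq> specht n lam" "W \<noteq> {0}" "W \<inter> A = {0}"
  shows "specht n lam = {x + y | x y. x \<in> W \<and> y \<in> A}" (is "_ = ?S")
proof -
  have iS: "invariant_subspace G ?S" using W(1) A by (rule invariant_subspace_sum)
  have sS: "cfun.subspace ?S" using iS by (rule invariant_subspaceD)
  have sA: "cfun.subspace A" using A by (rule invariant_subspaceD)
  have sW: "cfun.subspace W" using W(1) by (rule invariant_subspaceD)
  have AS: "A \<subseteq> ?S"
  proof
    fix a assume "a \<in> A"
    then have "0 + a \<in> ?S" using cfun.subspace_0[OF sW] by blast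
    then show "a \<in> ?S" by simp
  qed
  have WS: "W \<subseteq> ?S"
  proof
    fix a assume "a \<in> W"
    then have "a + 0 \<in> ?S" using cfun.subspace_0[OF sA] by blast
    then show "a \<in> ?S" by simp
  qed
  obtain w where w: "w \<in> W" "w \<noteq> 0" using W(3) cfun.subspace_0[OF sW] by auto
  then obtain a b where ab: "w = a + b" "a \<in> A" "b \<in> B" using W(2) V by blast
  have "b \<noteq> 0"
  proof
    assume "b = 0"
    then have "w \<in> W \<inter> A" using w ab by simp
    then show False using W(4) w by simp
  qed
  have "b = w - a" using ab by simp
  moreover have "w - a \<in> ?S" by (rule cfun.subspace_diff[OF sS]) (use w ab AS WS in blast)+
  ultimately have "b \<in> ?S \<inter> B" using ab by simp
  moreover have "?S \<inter> B = {0} \<or> ?S \<inter> B = B"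
  proof -
    have "invariant_subspace G (?S \<inter> B)"
      using iS B by (intro invariant_subspace_Int) (simp_all add: irreducible_rep_def)
    moreover have "?S \<inter> B \<subseteq> B" by (rule Int_lower2)
    ultimately show ?thesis using B unfolding irreducible_rep_def by blast
  qed
  ultimately have "?S \<inter> B = B"
  proof (elim disjE)
    assume "b \<in> ?S \<inter> B" "?S \<inter> B = {0}"
    then have "b \<in> {0}" by (simp only:)
    then show ?thesis using \<open>b \<noteq> 0\<close> by simp
  qed
  then have BS: "B \<subseteq> ?S" by (simp only: inf.absorb_iff2)
  show ?thesis
  proof
    show "specht n lam \<subseteq> ?S"
    proof
      fix v assume "v \<in> specht n lam"
      then obtain x y where v: "v = x + y" and x: "x \<in> A" and y: "y \<in> B" unfolding V by blast
      show "v \<in> ?S" unfolding v by (rule cfun.subspace_add[OF sS subsetD[OF AS x] subsetD[OF BS y]])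
    qed
    show "?S \<subseteq> specht n lam"
    proof
      have s: "cfun.subspace (specht n lam)" by (simp add: specht_def)
      fix v assume "v \<in> ?S"
      then obtain x a where v: "v = x + a" and x: "x \<in> W" and a: "a \<in> A" by blast
      have "0 \<in> B" using B cfun.subspace_0[of B] by (simp add: irreducible_rep_def invariant_subspace_def)
      then have "a + 0 \<in> specht n lam" unfolding V using a by blast
      then have "a \<in> specht n lam" by simp
      then show "v \<in> specht n lam"
        unfolding v by (rule cfun.subspace_add[OF s subsetD[OF W(2) x]])
    qed
  qed
qed

lemma fin_dim_summand: "invariant_subspace G W \<Longrightarrow> W \<subseteq> specht n lam \<Longrightarrow> fin_dim W"
  using fin_dim_subset[OF fin_dim_specht] by (auto simp: invariant_subspace_def)

lemma character_summands:
  assumes "invariant_subspace G A" "A \<subseteq> specht n lam" "invariant_subspace G B" "B \<subseteq> specht n lam"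
    "specht n lam = {x + y | x y. x \<in> A \<and> y \<in> B}" "A \<inter> B = {0}" "g \<in> G"
  shows "rep_character (specht n lam) g = rep_character A g + rep_character B g"
  unfolding rep_character_def
proof (rule trace_on_direct_sum[OF clinear_act _ _ _ _ fin_dim_specht assms(5,6)])
  show "act g ` A \<subseteq> A" "act g ` B \<subseteq> B" using assms(1,3,7) by (auto simp: invariant_subspace_def)
  show "fin_dim A" "fin_dim B" using assms(1-4) by (auto intro: fin_dim_summand)
qed

text \<open>If the translate of \<open>Vp\<close> met both summands trivially it would be a complement of either,
  so \<open>Vp\<close> and \<open>Vm\<close> would have the same character.\<close>

lemma odd_swaps:
  assumes s: "\<sigma> permutes {1..n}" "\<not> evenperm \<sigma>"
  shows "act \<sigma> ` Vp = Vm"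
proof -
  let ?W = "act \<sigma> ` Vp"
  have irrW: "irreducible_rep G ?W" using irreducibles(1) s(1) by (rule irreducible_rep_translate)
  then have iW: "invariant_subspace G ?W" and W0: "?W \<noteq> {0}"
    and W_sub: "\<And>U. U \<subseteq> ?W \<Longrightarrow> invariant_subspace G U \<Longrightarrow> U = {0} \<or> U = ?W"
    by (auto simp: irreducible_rep_def)
  have WV: "?W \<subseteq> specht n lam"
    using specht_invariant[of n lam] s(1) subset_specht(1) by (auto simp: invariant_subspace_def)
  have meet: "?W = U" if U: "irreducible_rep G U" and ne: "?W \<inter> U \<noteq> {0}" for U
  proof -
    have i: "invariant_subspace G (?W \<inter> U)"
      using iW U by (intro invariant_subspace_Int) (simp_all add: irreducible_rep_def)
    have "?W \<inter> U = ?W" using W_sub[OF Int_lower1 i] ne by blast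
    moreover have "?W \<inter> U = U" using U i ne Int_lower2[of ?W U] unfolding irreducible_rep_def by blast
    ultimately show ?thesis by simp
  qed
  have notVp: "?W \<noteq> Vp"
  proof
    assume WVp: "?W = Vp"
    \<comment> \<open>Every odd permutation is an even one times \<open>\<sigma>\<close>, so if
      \<open>\<sigma>\<close> preserves \<open>Vp\<close>, the whole symmetric group does.\<close>
    have "invariant_subspace {g. g permutes {1..n}} Vp"
      unfolding invariant_subspace_def
    proof (intro conjI ballI)
      show "cfun.subspace Vp" using invariants(1) by (rule invariant_subspaceD)
      fix g v assume "g \<in> {g. g permutes {1..n}}" and v: "v \<in> Vp"
      then have g: "g permutes {1..n}" by simp
      show "act g v \<in> Vp"
      proof (cases "evenperm g")
        case True
        then show ?thesis using invariants(1) v g by (auto simp: invariant_subspace_def alt_group_carrier)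
      next
        case False
        let ?h = "g \<circ> inv_into UNIV \<sigma>"
        have P: "permutation \<sigma>" "permutation g" "permutation (inv_into UNIV \<sigma>)"
          using s(1) g permutes_inv[OF s(1)] permutation_permutes by blast+
        have "?h \<in> G" using False s P g
          by (auto simp: alt_group_carrier evenperm_comp evenperm_inv intro!: permutes_compose permutes_inv)
        moreover have "act \<sigma> v \<in> Vp" using v WVp by blast
        ultimately have "act ?h (act \<sigma> v) \<in> Vp" using invariants(1) by (auto simp: invariant_subspace_def)
        moreover have "?h \<circ> \<sigma> = g" using permutes_bijs[OF s(1)] by (simp add: o_assoc[symmetric] bij_comp_inv)
        ultimately show ?thesis
          using permutes_bijs[OF s(1)] permutes_bijs[OF g] by (simp add: act_comp bij_comp)
      qed
    qed
    then have "Vp = specht n lam"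
      using irreducibles(1) subset_specht(1) by (intro specht_irreducible) (auto simp: irreducible_rep_def)
    then have "Vm = {0}" using subset_specht(2) decomposition(2) by blast
    then show False using irreducibles(2) by (simp add: irreducible_rep_def)
  qed
  show ?thesis
  proof (rule ccontr)
    assume neq: "?W \<noteq> Vm"
    have Wp: "?W \<inter> Vp = {0}" using meet[OF irreducibles(1)] notVp by blast
    have Wm: "?W \<inter> Vm = {0}" using meet[OF irreducibles(2)] neq by blast
    have dec': "specht n lam = {x + y | x y. x \<in> Vm \<and> y \<in> Vp}"
      unfolding decomposition(1) by (metis (no_types, opaque_lifting) add.commute)
    have 1: "specht n lam = {x + y | x y. x \<in> ?W \<and> y \<in> Vp}"
      by (rule complement_of_irreducible[OF invariants(1) irreducibles(2) decomposition(1) iW WV W0 Wp])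
    have 2: "specht n lam = {x + y | x y. x \<in> ?W \<and> y \<in> Vm}"
      by (rule complement_of_irreducible[OF invariants(2) irreducibles(1) dec' iW WV W0 Wm])
    obtain w where w: "w \<in> G" "rep_character Vp w \<noteq> rep_character Vm w" using distinguished by blast
    \<comment> \<open>Both \<open>Vp\<close> and \<open>Vm\<close> are complements of the translate,
      so each of their characters is that of the Specht module minus that of the translate.\<close>
    show False
      using w(2) character_summands[OF iW WV invariants(1) subset_specht(1) 1 Wp w(1)]
        character_summands[OF iW WV invariants(2) subset_specht(2) 2 Wm w(1)] by simp
  qed
qed

definition \<Delta> :: "(nat \<Rightarrow> nat) \<Rightarrow> complex" where
  "\<Delta> g = rep_character Vp g - rep_character Vm g"

lemma \<Delta>_conj:
  assumes s: "\<sigma> permutes {1..n}" and h: "h \<in> G"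
  shows "\<Delta> (\<sigma> \<circ> h \<circ> inv_into UNIV \<sigma>) = of_int (sign \<sigma>) * \<Delta> h"
proof (cases "evenperm \<sigma>")
  case True
  then have sG: "\<sigma> \<in> G" using s by (simp add: alt_group_carrier)
  have iG: "inv_into UNIV \<sigma> \<in> G" using sG by (rule alt_group_inv_closed)
  note b = permutes_bijs[OF s]
  have im: "act \<sigma> ` V = V" if "invariant_subspace G V" for V
  proof
    show "act \<sigma> ` V \<subseteq> V" using that sG by (auto simp: invariant_subspace_def)
    have "act (inv_into UNIV \<sigma>) ` V \<subseteq> V" using that iG by (auto simp: invariant_subspace_def)
    then show "V \<subseteq> act \<sigma> ` V" using act_image_inv[OF b(1), of V] by blast
  qed
  show ?thesis
    using rep_character_translate[OF fin_dims(1) invariants(1) s h]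
      rep_character_translate[OF fin_dims(2) invariants(2) s h] True
    by (simp add: \<Delta>_def im invariants sign_def)
next
  case False
  note b = permutes_bijs[OF s]
  have pm: "act \<sigma> ` Vp = Vm" using s False by (rule odd_swaps)
  have "permutation \<sigma>" using s permutation_permutes by blast
  then have "\<not> evenperm (inv_into UNIV \<sigma>)" using False by (simp add: evenperm_inv)
  \<comment> \<open>The inverse is odd as well; read backwards, this shows that
    \<open>\<sigma>\<close> also maps \<open>Vm\<close> onto \<open>Vp\<close>.\<close>
  then have "act (inv_into UNIV \<sigma>) ` Vp = Vm" using permutes_inv[OF s] by (intro odd_swaps)
  then have mp: "act \<sigma> ` Vm = Vp" using act_image_inv[OF b(1), of Vp] by simp
  show ?thesis
    using rep_character_translate[OF fin_dims(1) invariants(1) s h]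
      rep_character_translate[OF fin_dims(2) invariants(2) s h] False
    by (simp add: \<Delta>_def pm mp sign_def)
qed

lemma \<Delta>_commutes_odd:
  assumes "\<sigma> permutes {1..n}" "\<not> evenperm \<sigma>" "h \<in> G" "\<sigma> \<circ> h = h \<circ> \<sigma>"
  shows "\<Delta> h = 0"
proof -
  have "\<sigma> \<circ> h \<circ> inv_into UNIV \<sigma> = h"
    unfolding assms(4) o_assoc[symmetric] by (simp add: bij_comp_inv permutes_bij[OF assms(1)])
  then have "\<Delta> h = - \<Delta> h" using \<Delta>_conj[OF assms(1,3)] assms(2) by (simp add: sign_def)
  then show ?thesis by simp
qed

end

section \<open>Eigenvalue multiplicities from characters of powers\<close>

lemma alt_group_funpow: "w \<in> carrier (alt_group n) \<Longrightarrow> w ^^ k \<in> carrier (alt_group n)"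
proof (induction k)
  case 0
  then show ?case by (simp add: alt_group_carrier permutes_id evenperm_id flip: id_def)
next
  case (Suc k)
  then have "permutation w" "permutation (w ^^ k)" using alt_group_carrier' by blast+
  then show ?case
    using Suc unfolding alt_group_carrier funpow.simps(2) by (simp add: evenperm_comp permutes_compose)
qed

text \<open>The mean over \<open>k\<close> of \<open>inverse z ^ k\<close> times the action of
  \<open>w ^^ k\<close> is the projection onto the eigenspace of \<open>z\<close>, so its trace is
  the multiplicity. The inverse here is what later puts \<open>- i\<close> into the exponential
  sums.\<close>

lemma eigen_mult_eq_character_sum:
  assumes V: "fin_dim V" "invariant_subspace (carrier (alt_group n)) V"
    and w: "w \<in> carrier (alt_group n)" and m: "m > 0" "w ^^ m = id" and z: "z ^ m = 1"
  shows "of_nat (eigen_mult V w z) = (\<Sum>k<m. inverse z ^ k * rep_character V (w ^^ k)) / of_nat m"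
proof -
  have z0: "z \<noteq> 0" using z m by (metis power_0_left zero_neq_one less_numeral_extra(3))
  have b: "bij (w ^^ k)" for k using alt_group_funpow[OF w] alt_permutes permutes_bij by blast
  have bw: "bij w" using b[of 1] by simp
  let ?c = "\<lambda>k. inverse z ^ k / of_nat m :: complex"
  define P where "P = (\<lambda>v. \<Sum>k<m. cscale (?c k) (act (w ^^ k) v))"
  have linP: "clinear P"
  proof -
    have "P (x + y) = P x + P y" for x y
      unfolding P_def sum.distrib[symmetric] cfun.scale_right_distrib[symmetric]
      by (intro sum.cong refl arg_cong[where f = "cscale _"]) (rule clinear_add[OF clinear_act])
    moreover have "P (cscale a x) = cscale a (P x)" for a x
      unfolding P_def cfun.scale_sum_right
      by (intro sum.cong refl) (simp add: clinear_cscale[OF clinear_act] cfun.scale_left_commute)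
    ultimately show ?thesis by (simp add: clinear_iff)
  qed
  have actk: "act (w ^^ k) v \<in> V" if "v \<in> V" for k v
    using alt_group_funpow[OF w] that V(2) by (auto simp: invariant_subspace_def)
  have sV: "cfun.subspace V" using V(2) by (rule invariant_subspaceD)
  have PV: "P v \<in> V" if "v \<in> V" for v
    unfolding P_def using that by (intro cfun.subspace_sum[OF sV] cfun.subspace_scale[OF sV] actk)
  have actP: "act w (P v) = cscale z (P v)" for v
  proof -
    let ?f = "\<lambda>k. cscale (z * ?c k) (act (w ^^ k) v)"
    have "act w (P v) = (\<Sum>k<m. cscale (?c k) (act (w ^^ Suc k) v))"
      unfolding P_def clinear_sum[OF clinear_act] clinear_cscale[OF clinear_act]
      by (simp add: act_comp bw b)
    also have "\<dots> = (\<Sum>k<m. ?f (Suc k))" using z0 by (intro sum.cong) auto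
    \<comment> \<open>Applying \<open>w\<close> shifts the summation cyclically: the term at
      \<open>m\<close> equals the term at 0, since \<open>w ^^ m = id\<close> and
      \<open>z ^ m = 1\<close>.\<close>
    also have "\<dots> = (\<Sum>k<Suc m. ?f k) - ?f 0" by (subst sum.lessThan_Suc_shift) (simp add: algebra_simps)
    also have "\<dots> = (\<Sum>k<m. ?f k) + ?f m - ?f 0" by simp
    also have "?f m = ?f 0" using m z by (simp add: power_inverse)
    also have "(\<Sum>k<m. ?f k) + ?f 0 - ?f 0 = (\<Sum>k<m. ?f k)" by (rule add_diff_cancel_right')
    also have "\<dots> = cscale z (P v)" by (simp add: P_def cfun.scale_sum_right)
    finally show ?thesis .
  qed
  have fix_iff: "P v = v \<longleftrightarrow> act w v = cscale z v" for v
  proof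
    assume "P v = v" then show "act w v = cscale z v" using actP[of v] by simp
  next
    assume e: "act w v = cscale z v"
    have "act (w ^^ k) v = cscale (z ^ k) v" for k
    proof (induction k)
      case 0 then show ?case using act_id[of v] by (simp add: id_def)
    next
      case (Suc k)
      have "act (w ^^ Suc k) v = act w (act (w ^^ k) v)"
        by (simp only: act_comp[OF bw b] funpow.simps(2))
      also have "\<dots> = cscale (z ^ Suc k) v" by (simp add: Suc e clinear_cscale[OF clinear_act] mult.commute)
      finally show ?case .
    qed
    then have "P v = (\<Sum>k<m. cscale (1 / of_nat m) v)"
      unfolding P_def using z0 by (intro sum.cong) (auto simp: power_inverse)
    also have "\<dots> = cscale (of_nat m * (1 / of_nat m)) v"
      by (simp only: cfun.scale_sum_left[symmetric] sum_constant card_lessThan)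
    finally show "P v = v" using m by simp
  qed
  have "trace_on V P = of_nat (cfun.dim {v \<in> V. P v = v})"
    by (rule trace_on_projection[OF V(1) linP]) (use PV actP fix_iff in auto)
  moreover have "trace_on V P = (\<Sum>k<m. ?c k * trace_on V (act (w ^^ k)))"
    unfolding P_def by (rule trace_on_sum[OF V(1) clinear_act]) (use actk in auto)
  ultimately show ?thesis
    by (simp add: eigen_mult_def fix_iff rep_character_def sum_divide_distrib mult.commute)
qed

section \<open>Cycles and powers of a permutation\<close>

lemma card_orbit_eq_funpow_dist1:
  assumes "permutation f"
  shows "card (orbit f x) = funpow_dist1 f x x"
proof -
  have x: "x \<in> orbit f x" using assms by (rule permutation_self_in_orbit)
  have "inj_on (\<lambda>n. (f ^^ n) x) {0..<funpow_dist1 f x x}" using x by (rule inj_on_funpow_dist1)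
  then show ?thesis unfolding orbit_conv_funpow_dist1[OF x] by (simp add: card_image)
qed

lemma funpow_eq_iff_cong:
  assumes "permutation f"
  shows "(f ^^ a) x = (f ^^ b) x \<longleftrightarrow> [a = b] (mod card (orbit f x))"
proof -
  let ?d = "funpow_dist1 f x x"
  have x: "x \<in> orbit f x" using assms by (rule permutation_self_in_orbit)
  have inj: "inj_on (\<lambda>n. (f ^^ n) x) {0..<?d}" using x by (rule inj_on_funpow_dist1)
  have per: "(f ^^ ?d) x = x" using x by (rule funpow_dist1_prop)
  have red: "(f ^^ (a mod ?d)) x = (f ^^ a) x" for a by (rule funpow_mod_eq[OF per])
  have "(f ^^ a) x = (f ^^ b) x \<longleftrightarrow> (f ^^ (a mod ?d)) x = (f ^^ (b mod ?d)) x" by (simp only: red)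
  also have "\<dots> \<longleftrightarrow> a mod ?d = b mod ?d"
    using inj_on_eq_iff[OF inj, of "a mod ?d" "b mod ?d"] by simp
  finally show ?thesis by (simp add: cong_def card_orbit_eq_funpow_dist1[OF assms])
qed

lemma orbit_funpow:
  assumes "permutation f" "y \<in> orbit f x"
  obtains a where "y = (f ^^ a) x"
  using assms by (auto simp: orbit_altdef_permutation)

lemma funpow_mem_orbit: "permutation f \<Longrightarrow> (f ^^ a) x \<in> orbit f x"
  by (auto simp: orbit_altdef_permutation)

lemma orbit_eq_of_mem: "permutation f \<Longrightarrow> y \<in> orbit f x \<Longrightarrow> orbit f y = orbit f x"
  by (rule orbit_cyclic_eq3[OF cyclic_on_orbit'])

text \<open>\<open>A\<close> holds one point of each 2-cycle, so \<open>\<tau>\<close> is a product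
  of \<open>card A\<close> disjoint transpositions; the induction splits off the one through
  \<open>y\<close>.\<close>

lemma sign_involution:
  assumes "finite A" "\<And>z. \<tau> (\<tau> z) = z" "A \<inter> \<tau> ` A = {}" "\<And>z. z \<notin> A \<union> \<tau> ` A \<Longrightarrow> \<tau> z = z"
  shows "permutation \<tau> \<and> sign \<tau> = (-1) ^ card A"
  using assms
proof (induction A arbitrary: \<tau> rule: finite_induct)
  case empty
  then have "\<tau> = id" by auto
  then show ?case by simp
next
  case (insert y A)
  have inv: "\<tau> (\<tau> z) = z" for z by (rule insert.prems(1))
  have inj: "\<tau> a = \<tau> b \<longleftrightarrow> a = b" for a b using inv by metis
  have yt: "\<tau> y \<noteq> y" "\<tau> y \<notin> A" "\<And>a. a \<in> A \<Longrightarrow> \<tau> a \<noteq> y" "\<And>a. a \<in> A \<Longrightarrow> \<tau> a \<notin> A"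
    using insert.prems(2) by auto
  define \<tau>' where "\<tau>' = transpose y (\<tau> y) \<circ> \<tau>"
  have \<tau>'_simps: "\<tau>' y = y" "\<tau>' (\<tau> y) = \<tau> y" "\<And>z. z \<noteq> y \<Longrightarrow> z \<noteq> \<tau> y \<Longrightarrow> \<tau>' z = \<tau> z"
    using inv yt(1) inj by (auto simp: \<tau>'_def transpose_def)
  have A: "\<tau>' a = \<tau> a" if "a \<in> A" for a
    using that insert.hyps yt(2) by (intro \<tau>'_simps) auto
  have im: "\<tau>' ` A = \<tau> ` A" using A by (intro image_cong) auto
  have IH: "permutation \<tau>' \<and> sign \<tau>' = (-1) ^ card A"
  proof (rule insert.IH)
    show "\<tau>' (\<tau>' z) = z" for z
    proof (cases "z = y \<or> z = \<tau> y")
      case True then show ?thesis using \<tau>'_simps by auto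
    next
      case False
      then have "\<tau> z \<noteq> y" "\<tau> z \<noteq> \<tau> y" using inv inj by metis+
      then show ?thesis using False \<tau>'_simps inv by auto
    qed
    show "A \<inter> \<tau>' ` A = {}" unfolding im using yt(4) by auto
    fix z assume "z \<notin> A \<union> \<tau>' ` A"
    then have z: "z \<notin> A \<union> \<tau> ` A" unfolding im .
    show "\<tau>' z = z"
    proof (cases "z = y \<or> z = \<tau> y")
      case True then show ?thesis using \<tau>'_simps by auto
    next
      case False
      then have "\<tau> z = z" using z by (intro insert.prems(3)) auto
      then show ?thesis using False \<tau>'_simps by auto
    qed
  qed
  have eq: "\<tau> = transpose y (\<tau> y) \<circ> \<tau>'"
    by (simp add: \<tau>'_def o_assoc)
  have "permutation (transpose y (\<tau> y))" by (rule permutation_swap_id)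
  then have "permutation \<tau>" "sign \<tau> = sign (transpose y (\<tau> y)) * sign \<tau>'"
    using IH by (subst eq, simp add: permutation_compose, subst eq, simp add: sign_compose)
  then show ?case using IH insert.hyps yt(1) by (simp add: sign_swap_id)
qed

lemma cycle_lengths:
  assumes "cycle_type n w = mset \<mu>"
  shows "(\<lambda>x. card (orbit w x)) ` {1..n} = set \<mu>"
proof -
  have "set_mset (cycle_type n w) = set \<mu>" using assms by simp
  then show ?thesis by (simp add: cycle_type_def image_image)
qed

lemma perm_order_dvd:
  assumes w: "w permutes {1..n::nat}" and "\<And>x. x \<in> {1..n} \<Longrightarrow> card (orbit w x) dvd m"
  shows "w ^^ m = id"
proof
  fix x
  have P: "permutation w" by (rule permutes_imp_permutation[OF finite_atLeastAtMost w])
  have "card (orbit w x) dvd m"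
  proof (cases "x \<in> {1..n}")
    case False
    then have "w x = x" using w by (auto simp: permutes_def)
    then have "orbit w x = {x}" by (simp add: orbit_eq_singleton_iff)
    then show ?thesis by simp
  qed (rule assms(2))
  then have "[m = 0] (mod card (orbit w x))" by (simp add: cong_0_iff)
  then show "(w ^^ m) x = id x" using funpow_eq_iff_cong[OF P, of m x 0] by simp
qed

text \<open>After a base point is fixed in every cycle, \<open>g\<close> sends the point at exponent
  \<open>a\<close> to the point at exponent \<open>k * a\<close>. Multiplication by \<open>k\<close>
  permutes the exponents modulo the cycle length because the two are coprime.\<close>

lemma power_conjugate:
  assumes w: "w permutes {1..n::nat}" and cop: "\<And>x. x \<in> {1..n} \<Longrightarrow> coprime k (card (orbit w x))"
  shows "\<exists>g. g permutes {1..n} \<and> g \<circ> w \<circ> inv_into UNIV g = w ^^ k"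
proof -
  have P: "permutation w" by (rule permutes_imp_permutation[OF finite_atLeastAtMost w])
  \<comment> \<open>The choice depends on the orbit only as a set, hence is constant on each
    cycle.\<close>
  define \<rho> where "\<rho> = (\<lambda>y. SOME z. z \<in> orbit w y)"
  define \<alpha> where "\<alpha> = (\<lambda>y. SOME a. (w ^^ a) (\<rho> y) = y)"
  define g where "g = (\<lambda>y. (w ^^ (k * \<alpha> y)) (\<rho> y))"
  have \<rho>: "\<rho> y \<in> orbit w y" for y
    unfolding \<rho>_def using permutation_self_in_orbit[OF P] by (rule someI)
  have orb: "orbit w (\<rho> y) = orbit w y" for y by (rule orbit_eq_of_mem[OF P \<rho>])
  have \<rho>_eq: "\<rho> y = \<rho> z" if "y \<in> orbit w z" for y z
    using orbit_eq_of_mem[OF P that] by (simp add: \<rho>_def)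
  have \<alpha>: "(w ^^ \<alpha> y) (\<rho> y) = y" for y
  proof -
    have "y \<in> orbit w (\<rho> y)" using orb permutation_self_in_orbit[OF P] by blast
    then have "\<exists>a. (w ^^ a) (\<rho> y) = y" using orbit_funpow[OF P] by metis
    then show ?thesis unfolding \<alpha>_def by (rule someI_ex)
  qed
  have g_orb: "g y \<in> orbit w y" for y
    using funpow_mem_orbit[OF P, of "k * \<alpha> y" "\<rho> y"] by (simp only: orb g_def)
  have fix_out: "orbit w y = {y}" if "y \<notin> {1..n}" for y
    using that w by (simp add: orbit_eq_singleton_iff permutes_def)
  \<comment> \<open>Points outside \<open>{1..n}\<close> are cycles of length 1, which is coprime to
    every \<open>k\<close>.\<close>
  have cop': "coprime k (card (orbit w y))" for y
    using cop[of y] fix_out[of y] by (cases "y \<in> {1..n}") auto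
  have injg: "inj g"
  proof (rule injI)
    fix y z assume e: "g y = g z"
    have "g y \<in> orbit w y" "g z \<in> orbit w z" by (rule g_orb)+
    then have r: "\<rho> y = \<rho> z" using \<rho>_eq e by metis
    have "(w ^^ (k * \<alpha> y)) (\<rho> z) = (w ^^ (k * \<alpha> z)) (\<rho> z)" using e r by (simp add: g_def)
    then have "[k * \<alpha> y = k * \<alpha> z] (mod card (orbit w (\<rho> z)))"
      by (simp add: funpow_eq_iff_cong[OF P])
    then have "[\<alpha> y = \<alpha> z] (mod card (orbit w (\<rho> z)))"
      using cop'[of "\<rho> z"] by (simp add: cong_mult_lcancel_nat)
    then have "(w ^^ \<alpha> y) (\<rho> z) = (w ^^ \<alpha> z) (\<rho> z)" by (simp add: funpow_eq_iff_cong[OF P])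
    then show "y = z" unfolding \<alpha> r[symmetric] unfolding r \<alpha> .
  qed
  have g: "g permutes {1..n}"
  proof (rule bij_imp_permutes)
    have "g ` {1..n} \<subseteq> {1..n}"
      using g_orb permutes_orbit_subset[OF w] by blast
    moreover have ig: "inj_on g {1..n}" using injg by (rule inj_on_subset) simp
    ultimately have "g ` {1..n} = {1..n}" by (intro endo_inj_surj) auto
    then show "bij_betw g {1..n} {1..n}" using ig by (simp add: bij_betw_def)
    show "g y = y" if "y \<notin> {1..n}" for y using g_orb[of y] fix_out[OF that] by simp
  qed
  have "g (w y) = (w ^^ k) (g y)" for y
  proof -
    have wy: "w y \<in> orbit w y" by (rule orbit.base)
    have r: "\<rho> (w y) = \<rho> y" using \<rho>_eq[OF wy] .
    have "(w ^^ \<alpha> (w y)) (\<rho> y) = (w ^^ Suc (\<alpha> y)) (\<rho> y)"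
      using \<alpha>[of "w y"] \<alpha>[of y] r by simp
    then have "[\<alpha> (w y) = Suc (\<alpha> y)] (mod card (orbit w (\<rho> y)))"
      by (simp only: funpow_eq_iff_cong[OF P])
    then have "[k * \<alpha> (w y) = k * Suc (\<alpha> y)] (mod card (orbit w (\<rho> y)))"
      by (rule cong_scalar_left)
    then have "(w ^^ (k * \<alpha> (w y))) (\<rho> y) = (w ^^ (k + k * \<alpha> y)) (\<rho> y)"
      by (simp only: funpow_eq_iff_cong[OF P] mult_Suc_right)
    then show ?thesis by (simp add: g_def r funpow_add)
  qed
  then have "g \<circ> w = w ^^ k \<circ> g" by auto
  then have "g \<circ> w \<circ> inv_into UNIV g = w ^^ k \<circ> (g \<circ> inv_into UNIV g)" by (simp add: o_assoc)
  also have "g \<circ> inv_into UNIV g = id" using permutes_inv_o(1)[OF g] .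
  finally have "g \<circ> w \<circ> inv_into UNIV g = w ^^ k" by (simp only: comp_id)
  then show ?thesis using g by blast
qed

text \<open>Exchanging the residue classes \<open>0\<close> and \<open>1\<close> modulo \<open>q\<close> in one cycle of length \<open>l\<close> is a
  product of \<open>l div q\<close> transpositions that commutes with every power of \<open>w\<close> divisible by \<open>q\<close>.\<close>

lemma odd_commuting_permutation:
  assumes w: "w permutes {1..n::nat}" and x: "x \<in> {1..n}" and odd: "odd (card (orbit w x))"
    and q: "q > 1" "q dvd card (orbit w x)" "q dvd k"
  shows "\<exists>\<sigma>. \<sigma> permutes {1..n} \<and> \<not> evenperm \<sigma> \<and> \<sigma> \<circ> (w ^^ k) = (w ^^ k) \<circ> \<sigma>"
proof -
  have P: "permutation w" by (rule permutes_imp_permutation[OF finite_atLeastAtMost w])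
  let ?O = "orbit w x" and ?l = "card (orbit w x)" and ?v = "inv_into UNIV w"
  have vw: "?v (w y) = y" "w (?v y) = y" for y using permutes_inverses[OF w] by auto
  \<comment> \<open>Exponent of \<open>y\<close> relative to \<open>x\<close>, read modulo
    \<open>q\<close>. Exponents are determined modulo the cycle length, which \<open>q\<close>
    divides, so \<open>c\<close> does not depend on the choice.\<close>
  define c where "c = (\<lambda>y. (SOME a. (w ^^ a) x = y) mod q)"
  have c: "c ((w ^^ a) x) = a mod q" for a
  proof -
    have "(w ^^ (SOME b. (w ^^ b) x = (w ^^ a) x)) x = (w ^^ a) x" by (rule someI) (rule refl)
    then have "[(SOME b. (w ^^ b) x = (w ^^ a) x) = a] (mod ?l)" by (simp add: funpow_eq_iff_cong[OF P])
    then have "[(SOME b. (w ^^ b) x = (w ^^ a) x) = a] (mod q)" using q(2) by (rule cong_dvd_modulus_nat)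
    then show ?thesis by (simp add: c_def cong_def)
  qed
  have wO: "w y \<in> ?O" and cw: "c (w y) = Suc (c y) mod q" if y: "y \<in> ?O" for y
  proof -
    obtain a where a: "y = (w ^^ a) x" using orbit_funpow[OF P y] .
    have "w y = (w ^^ Suc a) x" by (simp add: a)
    then show "w y \<in> ?O" "c (w y) = Suc (c y) mod q"
      using funpow_mem_orbit[OF P, of "Suc a" x] c[of "Suc a"] c[of a] by (simp_all add: a mod_Suc_eq)
  qed
  have vO: "?v y \<in> ?O" if y: "y \<in> ?O" for y
  proof -
    obtain a where a: "y = (w ^^ a) x" using orbit_funpow[OF P y] .
    \<comment> \<open>A full turn is added so that the exponent is positive and the predecessor is
      again a forward power.\<close>
    have "[a = a + ?l] (mod ?l)" by (simp add: cong_def)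
    then have "y = (w ^^ (a + ?l)) x" using a funpow_eq_iff_cong[OF P] by blast
    moreover have "?l > 0" using odd by (rule odd_pos)
    then obtain b where "a + ?l = Suc b" by (metis add_gr_0 gr0_implies_Suc)
    ultimately have "?v y = (w ^^ b) x" by (simp add: vw)
    then show ?thesis using funpow_mem_orbit[OF P] by simp
  qed
  have cv: "c (?v y) = 0" if "y \<in> ?O" "c y = 1" for y
  proof -
    have "Suc (c (?v y)) mod q = 1" using cw[OF vO[OF that(1)]] that(2) vw by simp
    moreover have "c (?v y) < q" using q(1) by (simp add: c_def)
    ultimately show ?thesis by (auto simp: mod_Suc split: if_splits)
  qed
  have cw0: "c (w y) = 1" if "y \<in> ?O" "c y = 0" for y using cw[OF that(1)] that(2) q(1) by simp
  define \<tau> where "\<tau> = (\<lambda>y. if y \<in> ?O then if c y = 0 then w y else if c y = 1 then ?v y else y else y)"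
  define A where "A = {y \<in> ?O. c y = 0}"
  have OS: "?O \<subseteq> {1..n}" by (rule permutes_orbit_subset[OF w x])
  then have finO: "finite ?O" by (rule finite_subset) simp
  then have finA: "finite A" unfolding A_def by (rule rev_finite_subset) blast
  have inv: "\<tau> (\<tau> z) = z" for z
  proof -
    consider "z \<notin> ?O" | "z \<in> ?O" "c z = 0" | "z \<in> ?O" "c z = 1" | "z \<in> ?O" "c z \<noteq> 0" "c z \<noteq> 1" by blast
    then show ?thesis
    proof cases
      case 2
      then show ?thesis using wO[of z] cw0[of z] vw by (simp add: \<tau>_def)
    next
      case 3
      then show ?thesis using vO[of z] cv[of z] vw by (simp add: \<tau>_def)
    qed (simp_all add: \<tau>_def)
  qed
  have imA: "\<tau> ` A = {y \<in> ?O. c y = 1}"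
  proof
    show "\<tau> ` A \<subseteq> {y \<in> ?O. c y = 1}" using wO cw0 by (auto simp: \<tau>_def A_def)
    show "{y \<in> ?O. c y = 1} \<subseteq> \<tau> ` A"
    proof
      fix y assume "y \<in> {y \<in> ?O. c y = 1}"
      then have "\<tau> y \<in> A" using vO[of y] cv[of y] by (simp add: \<tau>_def A_def)
      moreover have "y = \<tau> (\<tau> y)" using inv by simp
      ultimately show "y \<in> \<tau> ` A" by blast
    qed
  qed
  have "permutation \<tau> \<and> sign \<tau> = (-1) ^ card A"
  proof (rule sign_involution[OF finA inv])
    show "A \<inter> \<tau> ` A = {}" unfolding imA by (auto simp: A_def)
    show "\<tau> z = z" if "z \<notin> A \<union> \<tau> ` A" for z
      using that unfolding imA by (auto simp: A_def \<tau>_def)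
  qed
  moreover have "card A = ?l div q"
  proof -
    obtain t where t: "?l = q * t" using q(2) by blast
    have inj: "inj_on (\<lambda>a. (w ^^ a) x) {..<?l}"
      by (rule inj_onI) (simp add: funpow_eq_iff_cong[OF P] cong_less_modulus_unique_nat)
    have "A = (\<lambda>b. (w ^^ (q * b)) x) ` {..<t}"
    proof
      show "A \<subseteq> (\<lambda>b. (w ^^ (q * b)) x) ` {..<t}"
      proof
        fix y assume y: "y \<in> A"
        then obtain a where a: "y = (w ^^ a) x" using orbit_funpow[OF P, of y x] by (auto simp: A_def)
        have "[a = a mod ?l] (mod ?l)" by simp
        then have a': "y = (w ^^ (a mod ?l)) x" using a funpow_eq_iff_cong[OF P] by blast
        have "(a mod ?l) mod q = 0" using y c[of "a mod ?l"] a' by (simp add: A_def)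
        then obtain b where b: "a mod ?l = q * b" by blast
        moreover have "a mod ?l < ?l" using odd_pos[OF odd] by simp
        ultimately have "b < t" using t q(1) by simp
        then show "y \<in> (\<lambda>b. (w ^^ (q * b)) x) ` {..<t}" using a' b by auto
      qed
      show "(\<lambda>b. (w ^^ (q * b)) x) ` {..<t} \<subseteq> A"
        using c funpow_mem_orbit[OF P] by (auto simp: A_def)
    qed
    moreover have "inj_on (\<lambda>b. (w ^^ (q * b)) x) {..<t}"
    proof (rule inj_onI)
      fix b b' assume b: "b \<in> {..<t}" "b' \<in> {..<t}" and e: "(w ^^ (q * b)) x = (w ^^ (q * b')) x"
      have "q * b \<in> {..<?l}" "q * b' \<in> {..<?l}" using b q(1) t by auto
      then have "q * b = q * b'" using e inj_onD[OF inj] by blast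
      then show "b = b'" using q(1) by simp
    qed
    ultimately have "card A = t" by (simp add: card_image)
    then show ?thesis using t q(1) by simp
  qed
  moreover have "odd (?l div q)" using odd q(2) by (metis dvd_div_mult_self even_mult_iff)
  ultimately have \<tau>odd: "\<not> evenperm \<tau>" by (auto simp: sign_def split: if_splits)
  have \<tau>p: "\<tau> permutes {1..n}"
  proof -
    have "\<tau> z = z" if "z \<notin> {1..n}" for z using that OS by (auto simp: \<tau>_def)
    moreover have "\<exists>!z. \<tau> z = y" for y by (metis inv)
    ultimately show ?thesis unfolding permutes_def by blast
  qed
  \<comment> \<open>As \<open>q\<close> divides \<open>k\<close>, \<open>w ^^ k\<close> preserves
    the class \<open>c\<close> on the cycle, and it commutes with \<open>w\<close> and its inverse;
    so it commutes with each branch of \<open>\<tau>\<close>.\<close>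
  have wk: "(w ^^ k) y \<in> ?O \<longleftrightarrow> y \<in> ?O" for y
  proof -
    have "(w ^^ k) y \<in> orbit w y" by (rule funpow_mem_orbit[OF P])
    then have "orbit w ((w ^^ k) y) = orbit w y" by (rule orbit_eq_of_mem[OF P])
    then show ?thesis using orbit_eq_of_mem[OF P] permutation_self_in_orbit[OF P] by metis
  qed
  have cwk: "c ((w ^^ k) y) = c y" if y: "y \<in> ?O" for y
  proof -
    obtain a where a: "y = (w ^^ a) x" using orbit_funpow[OF P y] .
    have "(w ^^ k) y = (w ^^ (k + a)) x" by (simp add: a funpow_add)
    then show ?thesis using c q(3) by (simp add: a mod_add_left_eq[of k, symmetric] mod_0_imp_dvd)
  qed
  have comm_w: "(w ^^ k) (w y) = w ((w ^^ k) y)" for y by (metis funpow_swap1)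
  have comm_v: "(w ^^ k) (?v y) = ?v ((w ^^ k) y)" for y by (metis comm_w vw)
  have "\<tau> ((w ^^ k) y) = (w ^^ k) (\<tau> y)" for y
    by (cases "y \<in> ?O") (simp_all add: \<tau>_def wk cwk comm_w comm_v)
  then have "\<tau> \<circ> (w ^^ k) = (w ^^ k) \<circ> \<tau>" by auto
  then show ?thesis using \<tau>p \<tau>odd by blast
qed

section \<open>Legendre symbols and integral exponential sums\<close>

lemma freshmans_dream_mod_prime:
  fixes a b :: "'a::comm_ring_1"
  assumes "prime q"
  shows "\<exists>c. (a + b) ^ q = a ^ q + b ^ q + of_nat q * c"
proof -
  have q0: "q > 0" using assms prime_gt_0_nat by blast
  let ?t = "\<lambda>k. of_nat (q choose k) * a ^ k * b ^ (q - k)"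
  have "(a + b) ^ q = (\<Sum>k\<le>q. ?t k)" by (rule binomial_ring)
  also have "{..q} = insert 0 (insert q {0<..<q})" using q0 by auto
  also have "(\<Sum>k\<in>\<dots>. ?t k) = b ^ q + (a ^ q + (\<Sum>k\<in>{0<..<q}. ?t k))"
    using q0 by simp
  also have "(\<Sum>k\<in>{0<..<q}. ?t k) = (\<Sum>k\<in>{0<..<q}. of_nat q * (of_nat ((q choose k) div q) * a ^ k * b ^ (q - k)))"
  proof (rule sum.cong[OF refl])
    fix k assume "k \<in> {0<..<q}"
    then have "q dvd (q choose k)" using assms by (intro dvd_choose_prime) auto
    then have "of_nat (q choose k) = (of_nat q * of_nat ((q choose k) div q) :: 'a)"
      by (simp flip: of_nat_mult)
    then show "?t k = of_nat q * (of_nat ((q choose k) div q) * a ^ k * b ^ (q - k))"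
      by (simp add: mult.assoc)
  qed
  also have "\<dots> = of_nat q * (\<Sum>k\<in>{0<..<q}. of_nat ((q choose k) div q) * a ^ k * b ^ (q - k))"
    by (simp add: sum_distrib_left)
  finally show ?thesis by (intro exI) (simp only: add.assoc add.commute add.left_commute)
qed

lemma Legendre_values: "Legendre a p \<in> {-1, 0, 1}"
  by (simp add: Legendre_def)

lemma Legendre_nonzero: "\<not> int p dvd a \<Longrightarrow> Legendre a (int p) \<in> {-1, 1}"
  by (simp add: Legendre_def cong_0_iff)

lemma Legendre_zero: "int p dvd a \<Longrightarrow> Legendre a (int p) = 0"
  by (simp add: Legendre_def cong_0_iff)

text \<open>Two values among -1, 0 and 1 differ by at most 2, so a congruence modulo
  \<open>q > 2\<close> is an equality. This is how symbols are read off from Euler's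
  criterion.\<close>

lemma sign_eqI:
  fixes a b :: int
  assumes "q > 2" "a \<in> {-1, 0, 1}" "b \<in> {-1, 0, 1}" "[a = b] (mod int q)"
  shows "a = b"
proof -
  have "int q dvd a - b" using assms(4) by (simp add: cong_iff_dvd_diff)
  moreover have "\<bar>a - b\<bar> < int q" using assms(1-3) by auto
  ultimately have "a - b = 0" using zdvd_imp_le[of "int q" "\<bar>a - b\<bar>"] by (cases "a = b") auto
  then show ?thesis by simp
qed

lemma Legendre_mult:
  assumes p: "prime p" "2 < p"
  shows "Legendre (a * b) (int p) = Legendre a (int p) * Legendre b (int p)"
proof (rule sign_eqI[OF p(2)])
  show "Legendre a (int p) * Legendre b (int p) \<in> {-1, 0, 1}"
    using Legendre_values[of a "int p"] Legendre_values[of b "int p"] by auto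
  have "[Legendre (a * b) p = (a * b) ^ ((p - 1) div 2)] (mod p)" by (rule euler_criterion[OF p])
  also have "(a * b) ^ ((p - 1) div 2) = a ^ ((p - 1) div 2) * b ^ ((p - 1) div 2)"
    by (rule power_mult_distrib)
  also have "[\<dots> = Legendre a p * Legendre b p] (mod p)"
    by (intro cong_mult cong_sym[OF euler_criterion[OF p]])
  finally show "[Legendre (a * b) (int p) = Legendre a (int p) * Legendre b (int p)] (mod int p)" .
qed (rule Legendre_values)

lemma Legendre_cong: "[a = b] (mod p) \<Longrightarrow> Legendre a p = Legendre b p"
proof -
  assume "[a = b] (mod p)"
  then have "[a = 0] (mod p) \<longleftrightarrow> [b = 0] (mod p)" "\<And>x. [x = a] (mod p) \<longleftrightarrow> [x = b] (mod p)"
    by (auto simp: cong_def)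
  then show ?thesis by (simp add: Legendre_def QuadRes_def)
qed

lemma Legendre_1: "prime p \<Longrightarrow> Legendre 1 (int p) = 1"
proof -
  assume p: "prime p"
  have "\<not> [1 = 0] (mod int p)" using p by (auto simp: cong_0_iff)
  moreover have "QuadRes (int p) 1" unfolding QuadRes_def by (rule exI[of _ 1]) simp
  ultimately show ?thesis by (simp add: Legendre_def)
qed

lemma Legendre_power: "prime p \<Longrightarrow> 2 < p \<Longrightarrow> Legendre (a ^ k) (int p) = Legendre a (int p) ^ k"
  by (induction k) (simp_all add: Legendre_1 Legendre_mult)

lemma Legendre_prod:
  "prime p \<Longrightarrow> 2 < p \<Longrightarrow> Legendre (\<Prod>j\<in>J. f j) (int p) = (\<Prod>j\<in>J. Legendre (f j) (int p))"
  by (induction J rule: infinite_finite_induct) (simp_all add: Legendre_1 Legendre_mult)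

lemma Legendre_minus_1:
  assumes "prime p" "2 < p"
  shows "Legendre (- 1) (int p) = (- 1) ^ ((p - 1) div 2)"
proof (rule sign_eqI[OF assms(2)])
  show "[Legendre (- 1) (int p) = (- 1) ^ ((p - 1) div 2)] (mod int p)"
    by (rule euler_criterion[OF assms])
  show "(- 1 :: int) ^ ((p - 1) div 2) \<in> {-1, 0, 1}" by (cases "even ((p - 1) div 2)") auto
qed (rule Legendre_values)

text \<open>Euler's criterion, squared and multiplied by \<open>a\<close>: the square of the symbol
  is 1 unless \<open>p\<close> divides \<open>a\<close>.\<close>

lemma fermat_int:
  fixes a :: int
  assumes p: "prime p" "2 < p"
  shows "[a ^ p = a] (mod int p)"
proof -
  have "odd p" using p prime_odd_nat by auto
  then have e: "p = Suc ((p - 1) div 2 + (p - 1) div 2)" using p(2) by presburger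
  have "[a * (a ^ ((p - 1) div 2) * a ^ ((p - 1) div 2)) = a * (Legendre a p * Legendre a p)] (mod p)"
    by (intro cong_mult cong_refl cong_sym[OF euler_criterion[OF p]])
  moreover have "a * (a ^ ((p - 1) div 2) * a ^ ((p - 1) div 2)) = a ^ p"
    by (subst (3) e) (simp add: power_add)
  moreover have "[a * (Legendre a p * Legendre a p) = a] (mod p)"
  proof (cases "int p dvd a")
    case True
    then show ?thesis by (auto simp: cong_def)
  next
    case False
    then show ?thesis using Legendre_nonzero[OF False] by auto
  qed
  ultimately show ?thesis using cong_trans by metis
qed

section \<open>Integer polynomials at roots of unity\<close>

definition ieval :: "int poly \<Rightarrow> complex \<Rightarrow> complex" where
  "ieval Q x = poly (map_poly of_int Q) x"

lemma ieval_0 [simp]: "ieval 0 x = 0"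
  by (simp add: ieval_def)

lemma ieval_pCons [simp]: "ieval (pCons a Q) x = of_int a + x * ieval Q x"
  by (simp add: ieval_def map_poly_pCons)

lemma ieval_add [simp]: "ieval (P + Q) x = ieval P x + ieval Q x"
  by (induction P Q rule: poly_induct2) (simp_all add: algebra_simps)

lemma ieval_smult [simp]: "ieval (smult a P) x = of_int a * ieval P x"
  by (induction P) (simp_all add: algebra_simps)

lemma ieval_mult [simp]: "ieval (P * Q) x = ieval P x * ieval Q x"
  by (induction P) (simp_all add: algebra_simps)

lemma ieval_1 [simp]: "ieval 1 x = 1"
  by (simp add: ieval_def)

lemma ieval_power [simp]: "ieval (P ^ k) x = ieval P x ^ k"
  by (induction k) simp_all

lemma ieval_of_nat [simp]: "ieval (of_nat k) x = of_nat k"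
  by (induction k) simp_all

lemma ieval_monom [simp]: "ieval (monom a k) x = of_int a * x ^ k"
  by (simp add: ieval_def map_poly_monom poly_monom)

lemma ieval_sum [simp]: "ieval (\<Sum>i\<in>I. P i) x = (\<Sum>i\<in>I. ieval (P i) x)"
  by (induction I rule: infinite_finite_induct) simp_all

lemma ieval_pcompose_monom: "ieval (pcompose P (monom 1 q)) x = ieval P (x ^ q)"
  by (induction P) (simp_all add: pcompose_pCons)

text \<open>Induction on the coefficients: the binomial theorem modulo \<open>q\<close> separates
  the constant term from the rest, and Fermat's little theorem replaces \<open>a ^ q\<close> by
  \<open>a\<close>.\<close>

lemma power_prime_eq_pcompose:
  fixes P :: "int poly"
  assumes q: "prime q" "2 < q"
  shows "\<exists>S. P ^ q = pcompose P (monom 1 q) + of_nat q * S"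
proof (induction P)
  case 0
  then show ?case using q by (auto intro!: exI[of _ 0])
next
  case (pCons a P)
  obtain S where S: "P ^ q = pcompose P (monom 1 q) + of_nat q * S" using pCons by blast
  obtain c where c: "([:a:] + monom 1 1 * P) ^ q = [:a:] ^ q + (monom 1 1 * P) ^ q + of_nat q * c"
    using freshmans_dream_mod_prime[OF q(1)] by blast
  obtain t where t: "a ^ q = a + int q * t"
    using fermat_int[OF q, of a] by (metis cong_iff_lin cong_sym)
  have "[:a:] ^ q = [:a ^ q:]" by (simp add: poly_const_pow)
  also have "\<dots> = [:a:] + of_nat q * [:t:]" by (simp add: t of_nat_poly)
  finally have a: "[:a:] ^ q = [:a:] + of_nat q * [:t:]" .
  have "pCons a P = [:a:] + monom 1 1 * P" by (simp add: monom_altdef)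
  then have "pCons a P ^ q = [:a:] ^ q + (monom 1 1 * P) ^ q + of_nat q * c" using c by simp
  also have "(monom 1 1 * P) ^ q = monom 1 q * (pcompose P (monom 1 q) + of_nat q * S)"
    by (simp add: power_mult_distrib S monom_power)
  also have "[:a:] ^ q + monom 1 q * (pcompose P (monom 1 q) + of_nat q * S) + of_nat q * c =
      pcompose (pCons a P) (monom 1 q) + of_nat q * ([:t:] + monom 1 q * S + c)"
    unfolding a by (simp add: pcompose_pCons algebra_simps)
  finally show ?case by blast
qed

lemma primitive_root_power_eq_1_iff:
  assumes z: "primitive_root_of_unity m z" and m: "m > 0"
  shows "z ^ i = 1 \<longleftrightarrow> m dvd i"
proof
  assume "m dvd i"
  then show "z ^ i = 1" using z by (auto simp: primitive_root_of_unity_def power_mult)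
next
  assume i: "z ^ i = 1"
  have "z ^ i = z ^ (m * (i div m) + i mod m)" by simp
  also have "\<dots> = z ^ (i mod m)"
    using z by (simp only: power_add power_mult primitive_root_of_unity_def power_one mult_1)
  finally have "z ^ (i mod m) = 1" using i by simp
  then have "i mod m = 0" using z m by (metis gr0I mod_less_divisor primitive_root_of_unity_def)
  then show "m dvd i" by auto
qed

lemma sum_powers_root:
  assumes z: "primitive_root_of_unity m z" and m: "m > 0"
  shows "(\<Sum>k<m. (z ^ k) ^ i) = (if m dvd i then of_nat m else 0)"
proof -
  have "(\<Sum>k<m. (z ^ k) ^ i) = (\<Sum>k<m. (z ^ i) ^ k)" by (simp add: power_mult[symmetric] mult.commute)
  also have "\<dots> = (if m dvd i then of_nat m else 0)"
  proof (cases "m dvd i")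
    case True
    then have "z ^ i = 1" using primitive_root_power_eq_1_iff[OF z m] by simp
    then show ?thesis by (simp only: power_one sum_constant card_lessThan True if_True mult_1_right)
  next
    case False
    then have "z ^ i \<noteq> 1" using primitive_root_power_eq_1_iff[OF z m] by simp
    moreover have "(z ^ i) ^ m = 1"
      using z by (simp add: primitive_root_of_unity_def power_commuting_commutes power_mult[symmetric])
        (simp add: mult.commute[of i] power_mult)
    ultimately show ?thesis using False by (simp add: geometric_sum)
  qed
  finally show ?thesis .
qed

text \<open>Orthogonality of the roots leaves only the exponents divisible by \<open>m\<close>, each
  contributing \<open>m\<close> times an integer. This plays the role of integrality of traces from
  the cyclotomic field.\<close>

lemma sum_ieval_roots:
  assumes z: "primitive_root_of_unity m z" and m: "m > 0"
  shows "\<exists>c::int. (\<Sum>k<m. ieval Q (z ^ k)) = of_nat m * of_int c"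
proof -
  have ev: "ieval Q x = (\<Sum>i\<le>degree Q. of_int (coeff Q i) * x ^ i)" for x
  proof -
    have "ieval Q x = ieval (\<Sum>i\<le>degree Q. monom (coeff Q i) i) x" by (subst poly_as_sum_of_monoms) simp
    then show ?thesis by simp
  qed
  have "(\<Sum>k<m. ieval Q (z ^ k)) = (\<Sum>i\<le>degree Q. of_int (coeff Q i) * (\<Sum>k<m. (z ^ k) ^ i))"
    unfolding ev by (subst sum.swap) (simp add: sum_distrib_left)
  also have "\<dots> = (\<Sum>i\<le>degree Q. of_nat m * of_int (if m dvd i then coeff Q i else 0))"
    unfolding sum_powers_root[OF z m] by (intro sum.cong) auto
  also have "\<dots> = of_nat m * of_int (\<Sum>i\<le>degree Q. if m dvd i then coeff Q i else 0)"
    by (simp add: sum_distrib_left)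
  finally show ?thesis by blast
qed

text \<open>The congruence \<open>P(X)\<^sup>q \<equiv> P(X\<^sup>q)\<close> modulo \<open>q\<close> replaces the Galois action on the \<open>m\<close>-th roots
  of unity. Multiplying by \<open>P\<close> makes the values at all roots rational, and summing over the roots
  yields an integer congruence.\<close>

lemma multiplier_eq_Legendre:
  fixes F :: "nat \<Rightarrow> complex" and D :: "nat \<Rightarrow> int" and c \<eta> :: int
  assumes z: "primitive_root_of_unity m z" and m: "m > 0"
    and F: "\<And>k. F k = (\<Sum>i<m. of_int (D i) * (z ^ k) ^ i)"
    and F0: "\<And>k. \<not> coprime k m \<Longrightarrow> F k = 0"
    and F2: "\<And>k. coprime k m \<Longrightarrow> F k ^ 2 = of_int c"
    and c0: "c \<noteq> 0"
    and q: "prime q" "2 < q" "m < q" "\<bar>c\<bar> < int q"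
    and \<eta>: "\<eta> \<in> {-1, 1}" "\<And>k. F (q * k) = of_int \<eta> * F k"
  shows "\<eta> = Legendre c (int q)"
proof -
  define P where "P = (\<Sum>i<m. monom (D i) i)"
  have ev: "ieval P (z ^ k) = F k" for k by (simp add: P_def F)
  obtain S where S: "P ^ q = pcompose P (monom 1 q) + of_nat q * S"
    using power_prime_eq_pcompose[OF q(1,2)] by blast
  have oq: "odd q" using q prime_odd_nat by auto
  then obtain h where h: "q = Suc (2 * h)" by (auto elim!: oddE)
  \<comment> \<open>With \<open>q = 2 * h + 1\<close>, the expression
    \<open>F k ^ q * F k - \<eta> * F k ^ 2\<close> equals
    \<open>c ^ (h + 1) - \<eta> * c = c * b\<close> at units and 0 elsewhere, so
    \<open>S * P\<close> takes rational values at the roots.\<close>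
  define b where "b = c ^ h - \<eta>"
  have val: "of_nat q * ieval (S * P) (z ^ k) = (if coprime k m then of_int (c * b) else 0)" for k
  proof -
    have "F k ^ q = F (q * k) + of_nat q * ieval S (z ^ k)"
    proof -
      have "ieval (P ^ q) (z ^ k) = ieval (pcompose P (monom 1 q) + of_nat q * S) (z ^ k)" by (simp only: S)
      moreover have "(z ^ k) ^ q = z ^ (q * k)" by (simp add: power_mult[symmetric] mult.commute)
      ultimately show ?thesis by (simp add: ev ieval_pcompose_monom)
    qed
    then have "of_nat q * ieval S (z ^ k) = F k ^ q - of_int \<eta> * F k" by (simp add: \<eta>(2))
    moreover have "of_nat q * ieval (S * P) (z ^ k) = (of_nat q * ieval S (z ^ k)) * F k" by (simp add: ev)
    ultimately have "of_nat q * ieval (S * P) (z ^ k) = F k ^ q * F k - of_int \<eta> * (F k ^ 2)"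
      by (simp add: left_diff_distrib power2_eq_square)
    also have "F k ^ q * F k = (F k ^ 2) ^ h * F k ^ 2"
      unfolding h by (simp add: power_mult power2_eq_square mult.assoc mult.left_commute)
    finally show ?thesis
      using F2[of k] F0[of k] by (auto simp: b_def algebra_simps)
  qed
  obtain t where t: "(\<Sum>k<m. ieval (S * P) (z ^ k)) = of_nat m * of_int t"
    using sum_ieval_roots[OF z m] by blast
  \<comment> \<open>\<open>N\<close> counts the units modulo \<open>m\<close>; since
    \<open>0 < N \<le> m < q\<close>, it can be cancelled modulo \<open>q\<close>.\<close>
  define N where "N = card {k \<in> {..<m}. coprime k m}"
  have "of_nat q * (of_nat m * of_int t) = (\<Sum>k<m. of_nat q * ieval (S * P) (z ^ k))"
    by (simp add: t[symmetric] sum_distrib_left)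
  also have "\<dots> = (\<Sum>k\<in>{k \<in> {..<m}. coprime k m}. of_int (c * b))"
    unfolding val by (rule sum.inter_filter[symmetric]) simp
  also have "\<dots> = of_nat N * of_int (c * b)" by (simp add: N_def)
  finally have "(of_int (int q * (int m * t)) :: complex) = of_int (int N * (c * b))" by simp
  then have eq: "int q * (int m * t) = int N * (c * b)" by (simp only: of_int_eq_iff)
  have qp: "prime (int q)" using q(1) by simp
  have "int q dvd int N * (c * b)" using eq by (metis dvd_triv_left)
  moreover have "\<not> int q dvd int N"
  proof
    assume "int q dvd int N"
    then have "q dvd N" by simp
    moreover have "N \<le> m" unfolding N_def using card_mono[of "{..<m}" "{k \<in> {..<m}. coprime k m}"] by auto
    moreover have "N > 0"
    proof -
      \<comment> \<open>The unit 1 is reduced modulo \<open>m\<close> so that \<open>m = 1\<close>,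
        where 0 is the only residue, is covered.\<close>
      have "1 mod m \<in> {k \<in> {..<m}. coprime k m}" using m by (cases "m = 1") auto
      then show ?thesis unfolding N_def by (subst card_gt_0_iff) auto
    qed
    ultimately show False using q(3) by (auto dest: dvd_imp_le)
  qed
  moreover have "\<not> int q dvd c" using c0 q(4) zdvd_imp_le[of "int q" "\<bar>c\<bar>"] by auto
  ultimately have "int q dvd b" using qp by (auto simp: prime_dvd_mult_iff)
  then have "[c ^ h = \<eta>] (mod int q)" by (simp add: b_def cong_iff_dvd_diff)
  moreover have "[Legendre c q = c ^ ((q - 1) div 2)] (mod q)" by (rule euler_criterion[OF q(1,2)])
  ultimately have "[\<eta> = Legendre c q] (mod q)" using h by (auto intro: cong_sym cong_trans)
  then show ?thesis using \<eta>(1) by (intro sign_eqI[OF q(2)] Legendre_values) auto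
qed

section \<open>The sign of M and quadratic reciprocity\<close>

definition psign :: "nat \<Rightarrow> int" where
  "psign a = (- 1) ^ ((a - 1) div 2)"

lemma psign_values: "psign a \<in> {-1, 1}"
  unfolding psign_def by (cases "even ((a - 1) div 2)") auto

text \<open>On odd numbers \<open>psign\<close> is the nontrivial character modulo 4, hence
  multiplicative.\<close>

lemma psign_mult:
  assumes "odd a" "odd b"
  shows "psign (a * b) = psign a * psign b"
proof -
  obtain x y where a: "a = 2 * x + 1" and b: "b = 2 * y + 1" using assms by (auto elim!: oddE)
  have "(a * b - 1) div 2 = x + y + 2 * (x * y)" by (simp add: a b algebra_simps)
  then show ?thesis by (simp add: psign_def a b power_add power_mult)
qed

lemma psign_1 [simp]: "psign (Suc 0) = 1"
  by (simp add: psign_def)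

lemma psign_power: "odd a \<Longrightarrow> psign (a ^ k) = psign a ^ k"
  by (induction k) (simp_all add: psign_mult)

lemma psign_prod: "(\<And>j. j \<in> J \<Longrightarrow> odd (f j)) \<Longrightarrow> psign (\<Prod>j\<in>J. f j) = (\<Prod>j\<in>J. psign (f j))"
proof (induction J rule: infinite_finite_induct)
  case (insert j J)
  then have "odd (\<Prod>j\<in>J. f j)" by (auto simp: even_prod_iff)
  then show ?case using insert by (simp add: psign_mult)
qed simp_all

lemma odd_prod_list: "\<forall>x\<in>set \<mu>. odd x \<Longrightarrow> odd (prod_list \<mu> :: nat)"
  by (induction \<mu>) auto

lemma sgn_eps_eq_psign: "\<forall>x\<in>set \<mu>. odd x \<Longrightarrow> sgn_eps \<mu> = psign (prod_list \<mu>)"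
proof (induction \<mu>)
  case Nil
  then show ?case by (simp add: sgn_eps_def)
next
  case (Cons a \<mu>)
  then have "odd (prod_list \<mu>)" by (simp add: odd_prod_list)
  then show ?case using Cons by (simp add: psign_mult) (simp add: sgn_eps_def psign_def power_add)
qed

text \<open>Reciprocity without a sign: \<open>psign p * p\<close> is congruent to 1 modulo 4, and
  the symbol of \<open>psign p\<close> modulo \<open>q\<close> is exactly the sign in the usual
  law.\<close>

lemma Legendre_psign_prime:
  assumes p: "prime p" "2 < p" and q: "prime q" "2 < q" and ne: "p \<noteq> q"
  shows "Legendre (psign p * int p) (int q) = Legendre (int q) (int p)"
proof -
  have "Legendre (psign p) (int q) = Legendre (- 1) (int q) ^ ((p - 1) div 2)"
    unfolding psign_def using q by (rule Legendre_power)
  then have 1: "Legendre (psign p) (int q) = (- 1) ^ ((p - 1) div 2 * ((q - 1) div 2))"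
    by (simp add: Legendre_minus_1[OF q] power_mult[symmetric] mult.commute)
  have 2: "Legendre p q * Legendre q p = (-1::int) ^ ((p - 1) div 2 * ((q - 1) div 2))"
    by (rule Quadratic_Reciprocity[OF p q ne])
  have "\<not> int q dvd int p" using p q ne primes_dvd_imp_eq by auto
  then have "Legendre p q \<in> {-1, 1}" by (rule Legendre_nonzero)
  then show ?thesis using 1 2 Legendre_mult[OF q] by auto
qed

lemma Legendre_psign_prod:
  assumes J: "\<And>j. j \<in> J \<Longrightarrow> prime (p j)" "\<And>j. j \<in> J \<Longrightarrow> 2 < p j" "\<And>j. j \<in> J \<Longrightarrow> p j \<noteq> q"
    and q: "prime q" "2 < q" and M: "M = (\<Prod>j\<in>J. p j ^ e j)"
  shows "Legendre (psign M * int M) (int q) = (\<Prod>j\<in>J. Legendre (int q) (int (p j)) ^ e j)"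
proof -
  have odd: "odd (p j)" if "j \<in> J" for j using J that prime_odd_nat by auto
  have "psign M * int M = (\<Prod>j\<in>J. (psign (p j) * int (p j)) ^ e j)"
    by (simp add: M psign_prod odd psign_power power_mult_distrib prod.distrib)
  then show ?thesis
    using J by (simp add: Legendre_prod[OF q] Legendre_power[OF q] Legendre_psign_prime[OF _ _ q])
qed

section \<open>From large primes to all residue classes\<close>

lemma exists_coprime_small_primes:
  fixes m k B :: nat
  assumes "m > 0" "coprime k m"
  shows "\<exists>k'>0. [k' = k] (mod m) \<and> (\<forall>q. prime q \<longrightarrow> q dvd k' \<longrightarrow> B < q)"
proof -
  \<comment> \<open>The witness is \<open>k + m * \<Prod>T\<close>. A prime up to \<open>B\<close>
    that does not divide \<open>k\<close> divides the second summand; one that divides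
    \<open>k\<close> divides neither \<open>m\<close>, by coprimality, nor any member of
    \<open>T\<close>. In both cases it divides exactly one summand.\<close>
  define T where "T = {q. prime q \<and> q \<le> B \<and> \<not> q dvd k}"
  have finT: "finite T" by (rule finite_subset[of _ "{..B}"]) (auto simp: T_def)
  define t where "t = \<Prod>T"
  have t0: "t > 0" unfolding t_def by (rule prod_pos) (auto simp: T_def prime_gt_0_nat)
  have "B < q" if q: "prime q" "q dvd k + m * t" for q
  proof (rule ccontr)
    assume "\<not> B < q"
    show False
    proof (cases "q dvd k")
      case False
      then have "q dvd t" unfolding t_def using finT q \<open>\<not> B < q\<close> by (intro dvd_prodI) (auto simp: T_def)
      then show False using q(2) False by (simp add: dvd_add_left_iff)
    next
      case True
      then have "q dvd m * t" using q(2) by (simp add: dvd_add_right_iff)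
      moreover have "\<not> q dvd m" using True q(1) assms(2)
        by (metis coprime_common_divisor not_prime_unit)
      ultimately have "q dvd t" using q(1) prime_dvd_mult_iff by blast
      then obtain q' where "q' \<in> T" "q dvd q'" 
        using prime_dvd_prod_iff[OF finT, of q "\<lambda>x. x"] q(1) by (auto simp: t_def)
      then show False using True q(1) primes_dvd_imp_eq[of q q'] by (auto simp: T_def)
    qed
  qed
  then show ?thesis using t0 assms(1) by (intro exI[of _ "k + m * t"]) (auto simp: cong_def)
qed

lemma multiplicative_from_primes:
  fixes F :: "nat \<Rightarrow> complex" and \<chi> :: "nat \<Rightarrow> int"
  assumes step: "\<And>q l. prime q \<Longrightarrow> B < q \<Longrightarrow> F (q * l) = of_int (\<chi> q) * F l"
    and mult: "\<chi> 1 = 1" "\<And>a b. \<chi> (a * b) = \<chi> a * \<chi> b"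
    and k: "k > 0" "\<And>q. prime q \<Longrightarrow> q dvd k \<Longrightarrow> B < q"
  shows "F k = of_int (\<chi> k) * F 1"
  using k
proof (induction k rule: less_induct)
  case (less k)
  show ?case
  proof (cases "k = 1")
    case True
    then show ?thesis using mult by simp
  next
    case False
    then obtain q where q: "prime q" "q dvd k" using prime_factor_nat by blast
    then obtain l where l: "k = q * l" by blast
    have "l < k" "l > 0" using less.prems(1) l q(1) prime_gt_1_nat by auto
    moreover have "B < q'" if "prime q'" "q' dvd l" for q' using that less.prems(2) l by auto
    ultimately have "F l = of_int (\<chi> l) * F 1" using less.IH by blast
    then show ?thesis using step[OF q(1) less.prems(2)[OF q]] by (simp add: l mult)
  qed
qed

section \<open>Gauss sums and the Chinese remainder theorem\<close>

lemma root_power_cong: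
  assumes "primitive_root_of_unity m z" "m > 0" "[a = b] (mod m)"
  shows "z ^ a = z ^ b"
proof -
  have red: "z ^ a = z ^ (a mod m)" for a
  proof -
    have "z ^ a = z ^ (m * (a div m) + a mod m)" by simp
    also have "\<dots> = (z ^ m) ^ (a div m) * z ^ (a mod m)" by (simp only: power_add power_mult)
    finally show ?thesis using assms(1) by (simp add: primitive_root_of_unity_def)
  qed
  show ?thesis using red[of a] red[of b] assms(3) by (simp add: cong_def)
qed

lemma fourier_inversion:
  assumes z: "primitive_root_of_unity m z" and m: "m > 0"
    and per: "\<And>k. F (k mod m) = F k"
    and D: "\<And>i. i < m \<Longrightarrow> D i = (\<Sum>k<m. inverse (z ^ i) ^ k * F k) / of_nat m"
  shows "F k = (\<Sum>i<m. D i * (z ^ k) ^ i)"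
proof -
  have z0: "z \<noteq> 0" using z m by (metis power_0_left zero_neq_one less_numeral_extra(3) primitive_root_of_unity_def)
  \<comment> \<open>Negative powers become natural ones through \<open>z ^ (m - 1)\<close>, the
    inverse of \<open>z\<close>.\<close>
  have iz: "inverse (z ^ i) ^ l = z ^ ((m - 1) * i * l)" for i l
  proof -
    have "z ^ ((m - 1) * i * l) * z ^ (i * l) = (z ^ m) ^ (i * l)"
      using m by (cases m) (simp_all add: power_add[symmetric] power_mult[symmetric] algebra_simps)
    then have "z ^ ((m - 1) * i * l) * z ^ (i * l) = 1" using z by (simp add: primitive_root_of_unity_def)
    then show ?thesis using z0 by (simp add: field_simps power_mult power_inverse)
  qed
  have e: "z ^ (r * i * l) * z ^ (k * i) = (z ^ i) ^ (k + r * l)" for r i l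
    by (simp add: power_add[symmetric] power_mult[symmetric] algebra_simps)
  have "(\<Sum>i<m. D i * (z ^ k) ^ i) = (\<Sum>i<m. \<Sum>l<m. F l / of_nat m * (z ^ i) ^ (k + (m - 1) * l))"
  proof (rule sum.cong[OF refl])
    fix i assume "i \<in> {..<m}"
    then have "D i * (z ^ k) ^ i = (\<Sum>l<m. z ^ ((m - 1) * i * l) * F l) / of_nat m * z ^ (k * i)"
      by (simp add: D iz power_mult)
    also have "\<dots> = (\<Sum>l<m. F l / of_nat m * (z ^ ((m - 1) * i * l) * z ^ (k * i)))"
      unfolding sum_divide_distrib sum_distrib_right by (intro sum.cong refl) simp
    also have "\<dots> = (\<Sum>l<m. F l / of_nat m * (z ^ i) ^ (k + (m - 1) * l))"
      unfolding e ..
    finally show "D i * (z ^ k) ^ i = (\<Sum>l<m. F l / of_nat m * (z ^ i) ^ (k + (m - 1) * l))" .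
  qed
  also have "\<dots> = (\<Sum>l<m. F l / of_nat m * (\<Sum>i<m. (z ^ i) ^ (k + (m - 1) * l)))"
    by (subst sum.swap) (simp add: sum_distrib_left)
  also have "\<dots> = (\<Sum>l<m. if l = k mod m then F l else 0)"
  proof (rule sum.cong[OF refl])
    fix l assume l: "l \<in> {..<m}"
    have "m dvd k + (m - 1) * l \<longleftrightarrow> [k + (m - 1) * l + l = l] (mod m)"
      by (metis add.commute add.right_neutral cong_0_iff cong_add_lcancel_nat)
    also have "k + (m - 1) * l + l = k + m * l" using m by (cases m) auto
    also have "[k + m * l = l] (mod m) \<longleftrightarrow> l = k mod m" using l by (auto simp: cong_def)
    finally show "F l / of_nat m * (\<Sum>i<m. (z ^ i) ^ (k + (m - 1) * l)) = (if l = k mod m then F l else 0)"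
      using m by (simp add: sum_powers_root[OF z m])
  qed
  also have "\<dots> = F k" using m per by simp
  finally show ?thesis by simp
qed

text \<open>The Chinese remainder bijection is taken as \<open>x * b + y * a\<close>, which fits the
  compatibility of the roots, \<open>\<zeta> (a * b) ^ b = \<zeta> a\<close>. The price is that
  \<open>\<phi>\<close> is evaluated at \<open>x * b\<close>; this is the origin of the cofactors
  \<open>m div p j ^ f j\<close> in the Legendre symbols.\<close>

lemma sum_two_coprime_moduli:
  fixes \<phi> \<psi> :: "nat \<Rightarrow> complex"
  assumes \<zeta>: "compatible_roots \<zeta>" and ab: "coprime a b" "a > 0" "b > 0"
    and per: "\<And>k. \<phi> (k mod a) = \<phi> k" "\<And>k. \<psi> (k mod b) = \<psi> k"
  shows "(\<Sum>k<a * b. \<phi> k * \<psi> k * \<zeta> (a * b) ^ (i * k)) =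
    (\<Sum>x<a. \<phi> (x * b) * \<zeta> a ^ (i * x)) * (\<Sum>y<b. \<psi> (y * a) * \<zeta> b ^ (i * y))"
proof -
  let ?h = "\<lambda>(x, y). (x * b + y * a) mod (a * b)"
  have prim: "primitive_root_of_unity (a * b) (\<zeta> (a * b))" using \<zeta> ab by (simp add: compatible_roots_def)
  have za: "\<zeta> (a * b) ^ b = \<zeta> a"
    using \<zeta> ab unfolding compatible_roots_def by (metis mult.commute)
  have zb: "\<zeta> (a * b) ^ a = \<zeta> b" using \<zeta> ab unfolding compatible_roots_def by blast
  have inj: "inj_on ?h ({..<a} \<times> {..<b})"
  proof (rule inj_onI, clarify)
    fix x y x' y' assume lt: "x < a" "y < b" "x' < a" "y' < b"
      and e: "(x * b + y * a) mod (a * b) = (x' * b + y' * a) mod (a * b)"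
    have c: "[x * b + y * a = x' * b + y' * a] (mod (a * b))" using e by (simp add: cong_def)
    have "[x * b + y * a = x' * b + y' * a] (mod a)" using c by (rule cong_dvd_modulus_nat) simp
    then have "[x * b = x' * b] (mod a)" by (simp add: cong_def)
    then have "[x = x'] (mod a)" using ab(1) by (simp add: cong_mult_rcancel_nat coprime_commute)
    moreover have "[x * b + y * a = x' * b + y' * a] (mod b)" using c by (rule cong_dvd_modulus_nat) simp
    then have "[y * a = y' * a] (mod b)" by (simp add: cong_def)
    then have "[y = y'] (mod b)" using ab(1) by (simp add: cong_mult_rcancel_nat)
    ultimately show "x = x' \<and> y = y'" using lt by (simp add: cong_less_modulus_unique_nat)
  qed
  have im: "?h ` ({..<a} \<times> {..<b}) = {..<a * b}"
  proof (rule card_subset_eq)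
    show "?h ` ({..<a} \<times> {..<b}) \<subseteq> {..<a * b}" using ab by auto
    show "card (?h ` ({..<a} \<times> {..<b})) = card {..<a * b}" using inj by (simp add: card_image)
  qed simp
  have "(\<Sum>k<a * b. \<phi> k * \<psi> k * \<zeta> (a * b) ^ (i * k)) =
      (\<Sum>c\<in>{..<a} \<times> {..<b}. \<phi> (?h c) * \<psi> (?h c) * \<zeta> (a * b) ^ (i * ?h c))"
    unfolding im[symmetric] by (rule sum.reindex[OF inj, unfolded o_def])
  also have "\<dots> = (\<Sum>(x, y)\<in>{..<a} \<times> {..<b}.
      (\<phi> (x * b) * \<zeta> a ^ (i * x)) * (\<psi> (y * a) * \<zeta> b ^ (i * y)))"
  proof (rule sum.cong[OF refl], clarify)
    fix x y
    let ?k = "(x * b + y * a) mod (a * b)"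
    have "?k mod a = (x * b) mod a" by (simp add: mod_mod_cancel)
    then have 1: "\<phi> ?k = \<phi> (x * b)" using per(1) by metis
    have "?k mod b = (y * a) mod b" by (simp add: mod_mod_cancel)
    then have 2: "\<psi> ?k = \<psi> (y * a)" using per(2) by metis
    have "\<zeta> (a * b) ^ (i * ?k) = \<zeta> (a * b) ^ (i * (x * b + y * a))"
      using ab by (intro root_power_cong[OF prim]) (auto simp: cong_def mod_mult_right_eq)
    also have "\<dots> = (\<zeta> (a * b) ^ b) ^ (i * x) * (\<zeta> (a * b) ^ a) ^ (i * y)"
      by (simp add: power_add[symmetric] power_mult[symmetric] algebra_simps)
    finally have 3: "\<zeta> (a * b) ^ (i * ?k) = \<zeta> a ^ (i * x) * \<zeta> b ^ (i * y)" by (simp add: za zb)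
    show "\<phi> ?k * \<psi> ?k * \<zeta> (a * b) ^ (i * ?k) =
        (\<phi> (x * b) * \<zeta> a ^ (i * x)) * (\<psi> (y * a) * \<zeta> b ^ (i * y))"
      unfolding 1 2 3 by (simp only: mult_ac)
  qed
  also have "\<dots> = (\<Sum>x<a. \<phi> (x * b) * \<zeta> a ^ (i * x)) * (\<Sum>y<b. \<psi> (y * a) * \<zeta> b ^ (i * y))"
    by (simp only: sum_product sum.cartesian_product)
  finally show ?thesis .
qed

lemma sum_coprime_moduli:
  fixes \<phi> :: "'j \<Rightarrow> nat \<Rightarrow> complex"
  assumes \<zeta>: "compatible_roots \<zeta>" and J: "finite J"
    and cop: "\<And>j k. j \<in> J \<Longrightarrow> k \<in> J \<Longrightarrow> j \<noteq> k \<Longrightarrow> coprime (Q j) (Q k)"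
    and pos: "\<And>j. j \<in> J \<Longrightarrow> Q j > 0"
    and per: "\<And>j k. j \<in> J \<Longrightarrow> \<phi> j (k mod Q j) = \<phi> j k"
  shows "(\<Sum>k<(\<Prod>j\<in>J. Q j). (\<Prod>j\<in>J. \<phi> j k) * \<zeta> (\<Prod>j\<in>J. Q j) ^ (i * k)) =
    (\<Prod>j\<in>J. \<Sum>x<Q j. \<phi> j (x * ((\<Prod>j\<in>J. Q j) div Q j)) * \<zeta> (Q j) ^ (i * x))"
  using J cop pos per
proof (induction J arbitrary: \<phi> rule: finite_induct)
  case empty
  have "primitive_root_of_unity 1 (\<zeta> 1)" using \<zeta> zero_less_one unfolding compatible_roots_def by blast
  then have "\<zeta> 1 = 1" by (simp add: primitive_root_of_unity_def)
  then show ?case by simp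
next
  case (insert l J)
  let ?a = "Q l" and ?b = "\<Prod>j\<in>J. Q j"
  have cab: "coprime ?a ?b" using insert.prems(1) insert.hyps by (intro prod_coprime_right) auto
  have b0: "?b > 0" using insert.prems(2) by (intro prod_pos) auto
  have dvd: "Q j dvd ?b" if "j \<in> J" for j using that insert.hyps(1) by (rule dvd_prodI[rotated])
  have perb: "(\<Prod>j\<in>J. \<phi> j (k mod ?b)) = (\<Prod>j\<in>J. \<phi> j k)" for k
  proof (rule prod.cong[OF refl])
    fix j assume j: "j \<in> J"
    have "(k mod ?b) mod Q j = k mod Q j" using dvd[OF j] by (rule mod_mod_cancel)
    then show "\<phi> j (k mod ?b) = \<phi> j k" using insert.prems(3)[of j] j by (metis insertI2)
  qed
  \<comment> \<open>The induction hypothesis is applied to the functions twisted by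
    \<open>?a\<close>, which is why they vary in the induction. The two twists multiply to the
    cofactor in the larger product.\<close>
  have IH: "(\<Sum>k<?b. (\<Prod>j\<in>J. \<phi> j (k * ?a)) * \<zeta> ?b ^ (i * k)) =
      (\<Prod>j\<in>J. \<Sum>x<Q j. \<phi> j (x * (?b div Q j) * ?a) * \<zeta> (Q j) ^ (i * x))"
  proof (rule insert.IH[of "\<lambda>j k. \<phi> j (k * ?a)"])
    fix j k assume j: "j \<in> J"
    have "\<phi> j ((k mod Q j) * ?a) = \<phi> j (((k mod Q j) * ?a) mod Q j)" using insert.prems(3) j by auto
    also have "((k mod Q j) * ?a) mod Q j = (k * ?a) mod Q j" by (rule mod_mult_left_eq)
    also have "\<phi> j \<dots> = \<phi> j (k * ?a)" using insert.prems(3) j by auto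
    finally show "\<phi> j ((k mod Q j) * ?a) = \<phi> j (k * ?a)" .
  qed (use insert.prems in auto)
  have "(\<Sum>k<(\<Prod>j\<in>insert l J. Q j). (\<Prod>j\<in>insert l J. \<phi> j k) * \<zeta> (\<Prod>j\<in>insert l J. Q j) ^ (i * k)) =
      (\<Sum>k<?a * ?b. \<phi> l k * (\<Prod>j\<in>J. \<phi> j k) * \<zeta> (?a * ?b) ^ (i * k))"
    using insert.hyps by simp
  also have "\<dots> = (\<Sum>x<?a. \<phi> l (x * ?b) * \<zeta> ?a ^ (i * x)) * (\<Sum>k<?b. (\<Prod>j\<in>J. \<phi> j (k * ?a)) * \<zeta> ?b ^ (i * k))"
    using insert.prems(2,3) b0 perb by (intro sum_two_coprime_moduli[OF \<zeta> cab]) auto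
  also have "\<dots> = (\<Prod>j\<in>insert l J. \<Sum>x<Q j. \<phi> j (x * ((\<Prod>j\<in>insert l J. Q j) div Q j)) * \<zeta> (Q j) ^ (i * x))"
  proof -
    have "(\<Prod>j\<in>insert l J. Q j) div Q l = ?b" using insert.hyps insert.prems(2)[of l] by simp
    moreover have "(\<Prod>j\<in>insert l J. Q j) div Q j = (?b div Q j) * ?a" if "j \<in> J" for j
      using insert.hyps dvd[OF that] by (simp add: div_mult_swap mult.commute)
    ultimately show ?thesis
      unfolding IH using insert.hyps by (simp add: mult.assoc cong: prod.cong)
  qed
  finally show ?case .
qed

text \<open>Write \<open>x = y + p * t\<close>. Since \<open>h\<close> depends on \<open>y\<close>
  only, the sum over \<open>t\<close> runs over all powers of a root of order
  \<open>p ^ (f - 1)\<close> and vanishes unless that number divides \<open>i\<close>. This is what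
  forces the exponent \<open>d\<close> to be \<open>f - 1\<close> or \<open>f\<close>.\<close>

lemma sum_prime_power_root:
  fixes h :: "nat \<Rightarrow> complex"
  assumes \<zeta>: "compatible_roots \<zeta>" and p: "prime p" and f: "f > 0" and per: "\<And>x. h (x mod p) = h x"
  shows "(\<Sum>x<p ^ f. h x * \<zeta> (p ^ f) ^ (i * x)) =
    (if p ^ (f - 1) dvd i then of_nat (p ^ (f - 1)) * (\<Sum>y<p. h y * \<zeta> p ^ ((i div p ^ (f - 1)) * y)) else 0)"
proof -
  let ?P = "p ^ (f - 1)"
  have p0: "p > 0" using p by (rule prime_gt_0_nat)
  have pf: "p ^ f = ?P * p" using f by (cases f) (simp_all add: mult.commute)
  have zP: "\<zeta> (p ^ f) ^ p = \<zeta> ?P" using \<zeta> p0 unfolding pf compatible_roots_def by (metis mult.commute zero_less_power)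
  have zp: "\<zeta> (p ^ f) ^ ?P = \<zeta> p" using \<zeta> p0 unfolding pf compatible_roots_def by (metis zero_less_power)
  have primP: "primitive_root_of_unity ?P (\<zeta> ?P)" using \<zeta> p0 by (simp add: compatible_roots_def)
  have "(\<Sum>x<p ^ f. h x * \<zeta> (p ^ f) ^ (i * x)) =
      (\<Sum>(t, y)\<in>{..<?P} \<times> {..<p}. h (y + p * t) * \<zeta> (p ^ f) ^ (i * (y + p * t)))"
  proof (rule sum.reindex_bij_witness[of _ "\<lambda>(t, y). y + p * t" "\<lambda>x. (x div p, x mod p)"])
    fix x assume "x \<in> {..<p ^ f}"
    then show "(x div p, x mod p) \<in> {..<?P} \<times> {..<p}" using p0 by (simp add: pf less_mult_imp_div_less)
  next
    fix c assume "c \<in> {..<?P} \<times> {..<p}"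
    then obtain t y where c: "c = (t, y)" "t < ?P" "y < p" by auto
    have "y + p * t < p * Suc t" using c by simp
    also have "\<dots> \<le> p * ?P" using c by (intro mult_le_mono2) simp
    finally show "(case c of (t, y) \<Rightarrow> y + p * t) \<in> {..<p ^ f}" by (simp add: c pf mult.commute)
    show "((case c of (t, y) \<Rightarrow> y + p * t) div p, (case c of (t, y) \<Rightarrow> y + p * t) mod p) = c"
      using c p0 by simp
  qed simp_all
  also have "\<dots> = (\<Sum>(t, y)\<in>{..<?P} \<times> {..<p}. (\<zeta> ?P ^ t) ^ i * (h y * \<zeta> (p ^ f) ^ (i * y)))"
  proof (rule sum.cong[OF refl], clarify)
    fix t y assume "y < p"
    have "h (y + p * t) = h y" using per[of "y + p * t"] per[of y] by simp
    moreover have "\<zeta> (p ^ f) ^ (i * (y + p * t)) = \<zeta> (p ^ f) ^ (i * y) * ((\<zeta> (p ^ f) ^ p) ^ t) ^ i"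
      by (simp add: power_add[symmetric] power_mult[symmetric] algebra_simps)
    ultimately show "h (y + p * t) * \<zeta> (p ^ f) ^ (i * (y + p * t)) = (\<zeta> ?P ^ t) ^ i * (h y * \<zeta> (p ^ f) ^ (i * y))"
      by (simp add: zP)
  qed
  also have "\<dots> = (\<Sum>t<?P. (\<zeta> ?P ^ t) ^ i) * (\<Sum>y<p. h y * \<zeta> (p ^ f) ^ (i * y))"
    by (simp only: sum_product sum.cartesian_product)
  also have "(\<Sum>t<?P. (\<zeta> ?P ^ t) ^ i) = (if ?P dvd i then of_nat ?P else 0)"
    using p0 by (intro sum_powers_root[OF primP]) simp
  finally have "(\<Sum>x<p ^ f. h x * \<zeta> (p ^ f) ^ (i * x)) =
      (if ?P dvd i then of_nat ?P else 0) * (\<Sum>y<p. h y * \<zeta> (p ^ f) ^ (i * y))" .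
  moreover have "\<zeta> (p ^ f) ^ (i * y) = \<zeta> p ^ ((i div ?P) * y)" if "?P dvd i" for y
  proof -
    have "\<zeta> (p ^ f) ^ (i * y) = (\<zeta> (p ^ f) ^ ?P) ^ ((i div ?P) * y)"
      using that by (simp add: power_mult[symmetric] mult.assoc[symmetric])
    then show ?thesis by (simp only: zp)
  qed
  ultimately show ?thesis by simp
qed

lemma sum_mult_permute_residues:
  fixes h :: "nat \<Rightarrow> complex"
  assumes p: "p > 0" and v: "coprime v p" and per: "\<And>x. h (x mod p) = h x"
  shows "(\<Sum>y<p. h (v * y)) = (\<Sum>y<p. h y)"
proof -
  let ?g = "\<lambda>y. (v * y) mod p"
  have inj: "inj_on ?g {..<p}"
  proof (rule inj_onI)
    fix y y' assume lt: "y \<in> {..<p}" "y' \<in> {..<p}" and "(v * y) mod p = (v * y') mod p"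
    then have "[v * y = v * y'] (mod p)" by (simp add: cong_def)
    then have "[y = y'] (mod p)" using v by (simp add: cong_mult_lcancel_nat)
    then show "y = y'" using lt by (simp add: cong_less_modulus_unique_nat)
  qed
  moreover have "?g ` {..<p} \<subseteq> {..<p}" using p by auto
  ultimately have "?g ` {..<p} = {..<p}" by (intro endo_inj_surj) auto
  then have "(\<Sum>y<p. h y) = (\<Sum>y\<in>?g ` {..<p}. h y)" by simp
  also have "\<dots> = (\<Sum>y<p. h (v * y))" by (subst sum.reindex[OF inj]) (simp add: per)
  finally show ?thesis by simp
qed

section \<open>Gauss and Ramanujan sums modulo a prime\<close>

lemma Legendre_mod: "Legendre (int (x mod p)) (int p) = Legendre (int x) (int p)"
  by (rule Legendre_cong) (simp add: cong_def zmod_int)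

text \<open>Substituting \<open>v * y\<close> for \<open>y\<close> takes out the symbol of
  \<open>v\<close>, which is its own inverse. The factor \<open>c\<close> makes room for the
  cofactor from the Chinese remainder theorem.\<close>

lemma gauss_sum_twist:
  assumes \<zeta>: "compatible_roots \<zeta>" and p: "prime p" "2 < p" and v: "\<not> p dvd v"
  shows "(\<Sum>y<p. of_int (Legendre (int y * c) (int p)) * \<zeta> p ^ (v * y)) =
    of_int (Legendre (c * int v) (int p)) * gauss_sum \<zeta> p"
proof -
  have p0: "p > 0" using p by simp
  have prim: "primitive_root_of_unity p (\<zeta> p)" using \<zeta> p0 by (simp add: compatible_roots_def)
  have cop: "coprime v p" using p(1) v by (metis coprime_commute prime_imp_coprime)
  have sq: "Legendre (int v) (int p) * Legendre (int v) (int p) = 1"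
    using Legendre_nonzero[of p "int v"] v by auto
  let ?h = "\<lambda>x. of_int (Legendre (int x) (int p)) * \<zeta> p ^ x"
  have h_per: "?h (x mod p) = ?h x" for x
    using root_power_cong[OF prim p0, of "x mod p" x] by (simp add: Legendre_mod)
  have "of_int (Legendre (int y * c) (int p)) * \<zeta> p ^ (v * y) =
      of_int (Legendre (c * int v) (int p)) * ?h (v * y)" for y
  proof -
    have "Legendre (int y * c) (int p) = Legendre (c * int v) (int p) * Legendre (int (v * y)) (int p)"
      using sq by (simp add: Legendre_mult[OF p] algebra_simps)
    then show ?thesis by simp
  qed
  then have "(\<Sum>y<p. of_int (Legendre (int y * c) (int p)) * \<zeta> p ^ (v * y)) =
      (\<Sum>y<p. of_int (Legendre (c * int v) (int p)) * ?h (v * y))" by (intro sum.cong refl)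
  also have "\<dots> = of_int (Legendre (c * int v) (int p)) * (\<Sum>y<p. ?h (v * y))" by (rule sum_distrib_left[symmetric])
  also have "(\<Sum>y<p. ?h (v * y)) = gauss_sum \<zeta> p"
    using sum_mult_permute_residues[where h = ?h, OF p0 cop] h_per by (simp add: gauss_sum_def)
  finally show ?thesis .
qed

text \<open>Otherwise every nonzero residue would be the square of some number from 1 to
  \<open>(p - 1) div 2\<close>, since \<open>x\<close> and \<open>p - x\<close> have the same
  square; there are too few of those.\<close>

lemma exists_nonresidue:
  assumes p: "prime p" "2 < p"
  shows "\<exists>v. \<not> p dvd v \<and> Legendre (int v) (int p) = -1"
proof (rule ccontr)
  assume none: "\<nexists>v. \<not> p dvd v \<and> Legendre (int v) (int p) = -1"
  let ?H = "{1..(p - 1) div 2}"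
  have "{1..<p} \<subseteq> (\<lambda>y. (y * y) mod p) ` ?H"
  proof
    fix v assume v: "v \<in> {1..<p}"
    then have nd: "\<not> p dvd v" by (auto dest: dvd_imp_le)
    then have "Legendre (int v) (int p) = 1" using none Legendre_nonzero[of p "int v"] by auto
    then obtain y where y: "[y ^ 2 = int v] (mod int p)"
      by (auto simp: Legendre_def QuadRes_def split: if_splits)
    define x where "x = nat (y mod int p)"
    have xp: "x < p" "int x = y mod int p" using p by (auto simp: x_def nat_less_iff)
    have "[int x * int x = int v] (mod int p)"
      using y by (simp add: xp cong_def power2_eq_square mod_mult_eq)
    then have xx: "[x * x = v] (mod p)" by (simp flip: cong_int_iff)
    have x0: "x \<noteq> 0"
    proof
      assume "x = 0"
      then have "[v = 0] (mod p)" using xx by (simp add: cong_sym_eq)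
      then show False using nd by (simp add: cong_0_iff)
    qed
    show "v \<in> (\<lambda>y. (y * y) mod p) ` ?H"
    proof (cases "x \<le> (p - 1) div 2")
      case True
      then show ?thesis using x0 xx v by (intro image_eqI[of _ _ x]) (auto simp: cong_def)
    next
      case False
      have "int ((p - x) * (p - x)) = int x * int x + int p * (int p - 2 * int x)"
        unfolding of_nat_mult of_nat_diff[OF less_imp_le[OF xp(1)]] by (simp add: algebra_simps)
      then have "[int ((p - x) * (p - x)) = int (x * x)] (mod int p)" by (simp add: cong_def)
      then have "[(p - x) * (p - x) = x * x] (mod p)" by (simp only: cong_int_iff)
      then have "[(p - x) * (p - x) = v] (mod p)" using xx by (rule cong_trans)
      moreover have "p - x \<in> ?H"
      proof -
        have "odd p" using p prime_odd_nat by auto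
        then obtain h where "p = 2 * h + 1" by (auto elim!: oddE)
        then show ?thesis using False xp(1) by auto
      qed
      ultimately show ?thesis using v by (intro image_eqI[of _ _ "p - x"]) (auto simp: cong_def)
    qed
  qed
  then have "card {1..<p} \<le> card ?H" by (rule surj_card_le[rotated]) simp
  then show False using p(2) by simp
qed

text \<open>Multiplication by a nonresidue permutes the residues and negates every term.\<close>

lemma sum_Legendre:
  assumes p: "prime p" "2 < p"
  shows "(\<Sum>y<p. of_int (Legendre (int y * c) (int p)) :: complex) = 0"
proof -
  obtain v where v: "\<not> p dvd v" "Legendre (int v) (int p) = -1" using exists_nonresidue[OF p] by blast
  have cop: "coprime v p" using p(1) v by (metis coprime_commute prime_imp_coprime)
  let ?h = "\<lambda>y. of_int (Legendre (int y * c) (int p)) :: complex"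
  have "(\<Sum>y<p. ?h (v * y)) = (\<Sum>y<p. ?h y)"
    using p by (intro sum_mult_permute_residues[OF _ cop]) (simp_all add: Legendre_mult Legendre_mod)
  moreover have "?h (v * y) = - ?h y" for y using v(2) by (simp add: Legendre_mult[OF p])
  ultimately have "- (\<Sum>y<p. ?h y) = (\<Sum>y<p. ?h y)" by (simp add: sum_negf)
  then show ?thesis by simp
qed

text \<open>With \<open>G v\<close> the sum twisted by \<open>v\<close>, the sum of
  \<open>G v * G (- v)\<close> over all \<open>v\<close> is evaluated twice: from \<open>G v\<close>
  being the symbol of \<open>v\<close> times the Gauss sum, and by orthogonality, which leaves the
  diagonal. The natural number \<open>(p - 1) * v\<close> represents \<open>- v\<close>.\<close>

lemma gauss_sum_squared:
  assumes \<zeta>: "compatible_roots \<zeta>" and p: "prime p" "2 < p"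
  shows "gauss_sum \<zeta> p ^ 2 = of_int (Legendre (-1) (int p)) * of_nat p"
proof -
  have p0: "p > 0" using p by simp
  have prim: "primitive_root_of_unity p (\<zeta> p)" using \<zeta> p0 by (simp add: compatible_roots_def)
  let ?L = "\<lambda>y. of_int (Legendre (int y) (int p)) :: complex"
  define G where "G = (\<lambda>v. \<Sum>y<p. ?L y * \<zeta> p ^ (v * y))"
  have G: "G v = ?L v * gauss_sum \<zeta> p" for v
  proof (cases "p dvd v")
    case True
    have "\<zeta> p ^ (v * y) = \<zeta> p ^ 0" for y
      using True by (intro root_power_cong[OF prim p0]) (auto simp: cong_0_iff)
    then show ?thesis using sum_Legendre[OF p, of 1] True by (simp add: G_def Legendre_zero)
  next
    case False
    then show ?thesis using gauss_sum_twist[OF \<zeta> p False, of 1] by (simp add: G_def)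
  qed
  have Lm: "?L ((p - 1) * v) = of_int (Legendre (-1) (int p)) * ?L v" for v
  proof -
    have "[int (p - 1) = -1] (mod int p)" using p0 by (simp add: cong_iff_dvd_diff of_nat_diff)
    then have "Legendre (int (p - 1)) (int p) = Legendre (-1) (int p)" by (rule Legendre_cong)
    then show ?thesis by (simp add: Legendre_mult[OF p])
  qed
  have L2: "?L v * ?L v = (if v = 0 then 0 else 1)" if "v < p" for v
  proof (cases "v = 0")
    case False
    then have "\<not> p dvd v" using that by (auto dest: dvd_imp_le)
    then show ?thesis using False Legendre_nonzero[of p "int v"] by auto
  qed (simp add: Legendre_zero)
  have s: "(\<Sum>v<p. ?L v * ?L v) = of_nat (p - 1)"
  proof -
    have "(\<Sum>v<p. ?L v * ?L v) = (\<Sum>v<p. if v = 0 then 0 else 1)" by (intro sum.cong) (simp_all add: L2)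
    also have "\<dots> = (\<Sum>v\<in>{..<p} - {0}. 1)" by (rule sum.mono_neutral_cong_right) auto
    also have "\<dots> = of_nat (p - 1)" using p0 by simp
    finally show ?thesis .
  qed
  have "(\<Sum>v<p. G v * G ((p - 1) * v)) = of_int (Legendre (-1) (int p)) * gauss_sum \<zeta> p ^ 2 * (\<Sum>v<p. ?L v * ?L v)"
    unfolding G Lm by (simp add: sum_distrib_left power2_eq_square mult_ac)
  moreover have "(\<Sum>v<p. G v * G ((p - 1) * v)) =
      (\<Sum>y<p. \<Sum>y'<p. ?L y * ?L y' * (\<Sum>v<p. (\<zeta> p ^ v) ^ (y + (p - 1) * y')))"
  proof -
    have e: "\<zeta> p ^ (v * y) * \<zeta> p ^ (r * v * y') = (\<zeta> p ^ v) ^ (y + r * y')" for v y y' r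
      by (simp add: power_add[symmetric] power_mult[symmetric] algebra_simps)
    have "G v * G ((p - 1) * v) = (\<Sum>y<p. \<Sum>y'<p. ?L y * ?L y' * (\<zeta> p ^ v) ^ (y + (p - 1) * y'))" for v
      unfolding G_def sum_product e[symmetric] by (intro sum.cong refl) (simp only: mult_ac)
    then have "(\<Sum>v<p. G v * G ((p - 1) * v)) =
        (\<Sum>v<p. \<Sum>y<p. \<Sum>y'<p. ?L y * ?L y' * (\<zeta> p ^ v) ^ (y + (p - 1) * y'))" by simp
    also have "\<dots> = (\<Sum>y<p. \<Sum>v<p. \<Sum>y'<p. ?L y * ?L y' * (\<zeta> p ^ v) ^ (y + (p - 1) * y'))" by (rule sum.swap)
    also have "\<dots> = (\<Sum>y<p. \<Sum>y'<p. \<Sum>v<p. ?L y * ?L y' * (\<zeta> p ^ v) ^ (y + (p - 1) * y'))"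
      by (intro sum.cong refl sum.swap)
    finally show ?thesis by (simp add: sum_distrib_left)
  qed
  moreover have "\<dots> = (\<Sum>y<p. \<Sum>y'<p. if y' = y then ?L y * ?L y' * of_nat p else 0)"
  proof (intro sum.cong refl)
    fix y y' assume lt: "y \<in> {..<p}" "y' \<in> {..<p}"
    have "p dvd y + (p - 1) * y' \<longleftrightarrow> [y + (p - 1) * y' + y' = y'] (mod p)"
      by (metis add.commute add.right_neutral cong_0_iff cong_add_lcancel_nat)
    also have "y + (p - 1) * y' + y' = y + p * y'" using p0 by (cases p) auto
    also have "[y + p * y' = y'] (mod p) \<longleftrightarrow> y' = y" using lt by (auto simp: cong_def)
    finally show "?L y * ?L y' * (\<Sum>v<p. (\<zeta> p ^ v) ^ (y + (p - 1) * y')) =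
        (if y' = y then ?L y * ?L y' * of_nat p else 0)"
      by (simp add: sum_powers_root[OF prim p0])
  qed
  moreover have "\<dots> = (\<Sum>y<p. ?L y * ?L y) * of_nat p" by (simp add: sum_distrib_right)
  ultimately have "of_int (Legendre (-1) (int p)) * gauss_sum \<zeta> p ^ 2 * of_nat (p - 1) = (of_nat (p - 1) * of_nat p :: complex)"
    by (simp only: s)
  moreover have "(of_nat (p - 1) :: complex) \<noteq> 0" using p(2) by simp
  ultimately have "of_int (Legendre (-1) (int p)) * gauss_sum \<zeta> p ^ 2 = (of_nat p :: complex)" by auto
  moreover have "\<not> int p dvd -1" using p(2) by (auto dest: zdvd_imp_le)
  then have "Legendre (-1) (int p) \<in> {-1, 1}" by (rule Legendre_nonzero)
  ultimately show ?thesis by (auto simp: minus_equation_iff[of "gauss_sum \<zeta> p ^ 2"])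
qed

lemma norm_gauss_sum:
  assumes "compatible_roots \<zeta>" "prime p" "2 < p"
  shows "cmod (gauss_sum \<zeta> p) = sqrt (real p)"
proof -
  have "\<not> int p dvd -1" using assms by (auto dest: zdvd_imp_le)
  then have "Legendre (-1) (int p) \<in> {-1, 1}" by (rule Legendre_nonzero)
  then have "cmod (gauss_sum \<zeta> p ^ 2) = real p" unfolding gauss_sum_squared[OF assms] by (auto simp: norm_mult)
  then have "cmod (gauss_sum \<zeta> p) ^ 2 = real p" by (simp add: norm_power)
  then show ?thesis by (metis norm_ge_zero real_sqrt_unique)
qed

text \<open>Ramanujan's sum: the complete sum over the \<open>p\<close>-th roots, less the term at
  0.\<close>

lemma sum_nonzero_residues:
  assumes \<zeta>: "compatible_roots \<zeta>" and p: "prime p"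
  shows "(\<Sum>y<p. (if p dvd y then 0 else 1) * \<zeta> p ^ (v * y)) = (if p dvd v then of_nat p - 1 else -1)"
proof -
  have p0: "p > 0" using p by (rule prime_gt_0_nat)
  have prim: "primitive_root_of_unity p (\<zeta> p)" using \<zeta> p0 by (simp add: compatible_roots_def)
  have "(\<Sum>y<p. (if p dvd y then 0 else 1) * \<zeta> p ^ (v * y)) = (\<Sum>y\<in>{..<p} - {0}. (\<zeta> p ^ y) ^ v)"
    by (rule sum.mono_neutral_cong_right) (auto simp: power_mult[symmetric] mult.commute dest: dvd_imp_le)
  also have "\<dots> = (\<Sum>y<p. (\<zeta> p ^ y) ^ v) - 1" using p0 by (subst sum_diff1) auto
  finally show ?thesis by (simp add: sum_powers_root[OF prim p0])
qed

section \<open>Local factors at one prime power\<close>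

context
  fixes \<zeta> :: "nat \<Rightarrow> complex" and p f d i c :: nat and u :: int
  assumes \<zeta>: "compatible_roots \<zeta>" and p: "prime p" "2 < p" and f: "f > 0" and d: "d \<le> f"
    and u: "coprime u (int p)" and i: "[int i = - (u * int p ^ d)] (mod (int p ^ f))"
    and c: "\<not> p dvd c"
begin

lemma exponent_dvd_iff: "p ^ (f - 1) dvd i \<longleftrightarrow> d = f - 1 \<or> d = f"
proof -
  have "int p ^ (f - 1) dvd int p ^ f" by (rule le_imp_power_dvd) simp
  then have "[int i = - (u * int p ^ d)] (mod (int p ^ (f - 1)))" by (rule cong_dvd_modulus[OF i])
  then have "int p ^ (f - 1) dvd int i \<longleftrightarrow> int p ^ (f - 1) dvd - (u * int p ^ d)" by (rule cong_dvd_iff)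
  also have "\<dots> \<longleftrightarrow> int p ^ (f - 1) dvd int p ^ d"
    using u by (simp add: coprime_dvd_mult_right_iff coprime_commute)
  also have "\<dots> \<longleftrightarrow> p ^ (f - 1) dvd p ^ d" by (simp only: of_nat_power[symmetric] int_dvd_int_iff)
  also have "\<dots> \<longleftrightarrow> f - 1 \<le> d" using p(2) power_dvd_imp_le[of p "f - 1" d] le_imp_power_dvd[of "f - 1" d p] by auto
  finally have "int p ^ (f - 1) dvd int i \<longleftrightarrow> f - 1 \<le> d" .
  then have "p ^ (f - 1) dvd i \<longleftrightarrow> f - 1 \<le> d" by (simp only: of_nat_power[symmetric] int_dvd_int_iff)
  then show ?thesis using d f by auto
qed

lemma exponent_div_cong:
  assumes "d = f - 1"
  shows "[int (i div p ^ (f - 1)) = - u] (mod (int p))"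
proof -
  let ?P = "int p ^ (f - 1)"
  have "p ^ (f - 1) dvd i" using exponent_dvd_iff assms by simp
  then have "int i = ?P * int (i div p ^ (f - 1))" by (simp flip: of_nat_power of_nat_mult)
  moreover have "int p ^ f = ?P * int p" using f by (cases f) simp_all
  ultimately have "[?P * int (i div p ^ (f - 1)) = ?P * (- u)] (mod (?P * int p))"
    using i assms by (simp add: mult.commute)
  then have "?P * int p dvd ?P * (int (i div p ^ (f - 1)) + u)"
    by (simp add: cong_iff_dvd_diff algebra_simps)
  then have "int p dvd int (i div p ^ (f - 1)) + u" using p by simp
  then show ?thesis by (simp add: cong_iff_dvd_diff)
qed

lemma exponent_div_dvd:
  assumes "d = f"
  shows "p dvd i div p ^ (f - 1)"
proof -
  have "[int i = 0] (mod (int p ^ f))" using i assms by (simp add: cong_iff_dvd_diff)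
  then have "int (p ^ f) dvd int i" by (simp add: cong_0_iff)
  then have "p ^ f dvd i" by (simp only: int_dvd_int_iff)
  then have "p ^ (f - 1) * p dvd i" using f by (cases f) (simp_all add: mult.commute)
  then show ?thesis using p by (auto simp: mult.assoc elim!: dvdE)
qed

text \<open>Here \<open>i\<close> represents the negative of the exponent under study, so the Gauss
  sum comes with the symbol of -1. For \<open>d = f\<close> the root of unity becomes trivial and
  the complete sum of symbols is 0, which is why primes of odd exponent only allow
  \<open>d = f - 1\<close>.\<close>

lemma local_Legendre_sum:
  "(\<Sum>x<p ^ f. of_int (Legendre (int (x * c)) (int p)) * \<zeta> (p ^ f) ^ (i * x)) =
    (if d = f - 1 then of_int (Legendre (- 1) (int p)) *
      (of_nat (p ^ (f - 1)) * of_int (Legendre (u * int c) (int p)) * gauss_sum \<zeta> p) else 0)"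
proof -
  let ?h = "\<lambda>x. of_int (Legendre (int (x * c)) (int p)) :: complex"
  let ?v = "i div p ^ (f - 1)"
  have per: "?h (x mod p) = ?h x" for x by (simp add: Legendre_mult[OF p] Legendre_mod)
  note sum_eq = sum_prime_power_root[where h = ?h and i = i, OF \<zeta> p(1) f per]
  consider "d = f - 1" | "d = f" "d \<noteq> f - 1" | "\<not> p ^ (f - 1) dvd i" "d \<noteq> f - 1"
    using exponent_dvd_iff by blast
  then show ?thesis
  proof cases
    case 1
    have v: "[int ?v = - u] (mod (int p))" using 1 by (rule exponent_div_cong)
    have pu: "\<not> int p dvd - u"
      using u p(1) by (metis coprime_common_divisor dvd_minus_iff dvd_refl not_prime_unit prime_nat_int_transfer)
    have nd: "\<not> p dvd ?v"
    proof
      assume "p dvd ?v"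
      then have "int p dvd int ?v" by (simp only: int_dvd_int_iff)
      then show False using cong_dvd_iff[OF v] pu by simp
    qed
    have "Legendre (int c * int ?v) (int p) = Legendre (- 1 * (u * int c)) (int p)"
    proof (rule Legendre_cong)
      have "[int c * int ?v = int c * - u] (mod (int p))" using v by (rule cong_scalar_left)
      then show "[int c * int ?v = - 1 * (u * int c)] (mod (int p))" by (simp add: mult.commute)
    qed
    then have L: "Legendre (int c * int ?v) (int p) = Legendre (- 1) (int p) * Legendre (u * int c) (int p)"
      by (simp only: Legendre_mult[OF p])
    have "(\<Sum>x<p ^ f. ?h x * \<zeta> (p ^ f) ^ (i * x)) =
        of_nat (p ^ (f - 1)) * (of_int (Legendre (int c * int ?v) (int p)) * gauss_sum \<zeta> p)"
      using sum_eq 1 exponent_dvd_iff gauss_sum_twist[OF \<zeta> p nd, of "int c"] by simp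
    then show ?thesis unfolding L using 1 by (simp add: mult_ac)
  next
    case 2
    have "\<zeta> p ^ (?v * y) = 1" for y
    proof -
      have "primitive_root_of_unity p (\<zeta> p)" using \<zeta> p by (simp add: compatible_roots_def)
      then show ?thesis using exponent_div_dvd[OF 2(1)] p by (subst primitive_root_power_eq_1_iff) auto
    qed
    then show ?thesis using sum_eq 2 exponent_dvd_iff sum_Legendre[OF p, of "int c"] by simp
  next
    case 3
    then show ?thesis using sum_eq by simp
  qed
qed

text \<open>A Ramanujan sum, nonzero for \<open>d = f\<close> as well. The value
  \<open>p ^ (f - 1) * (p - 1)\<close> is written with two minus signs so that the factor
  \<open>- p ^ (f - 1)\<close> is common to both cases.\<close>

lemma local_unit_sum:
  "(\<Sum>x<p ^ f. (if p dvd x * c then 0 else 1) * \<zeta> (p ^ f) ^ (i * x)) =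
    (if d = f - 1 \<or> d = f then - of_nat (p ^ (f - 1)) * (if d = f then 1 - of_nat p else 1) else 0)"
proof -
  let ?h = "\<lambda>x. (if p dvd x * c then 0 else 1) :: complex"
  let ?v = "i div p ^ (f - 1)"
  have h: "?h x = (if p dvd x then 0 else 1)" for x using p(1) c by (simp add: prime_dvd_mult_iff)
  have per: "?h (x mod p) = ?h x" for x by (simp add: h dvd_mod_iff)
  note sum_eq = sum_prime_power_root[where h = ?h and i = i, OF \<zeta> p(1) f per]
  consider "d = f - 1" "d \<noteq> f" | "d = f" | "\<not> p ^ (f - 1) dvd i" "d \<noteq> f - 1" "d \<noteq> f"
    using exponent_dvd_iff f by fastforce
  then show ?thesis
  proof cases
    case 1
    have "\<not> p dvd ?v"
    proof
      assume "p dvd ?v"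
      then have "int p dvd int ?v" by (simp only: int_dvd_int_iff)
      then have "int p dvd - u" using cong_dvd_iff[OF exponent_div_cong[OF 1(1)]] by simp
      then show False
        using u p(1) by (metis coprime_common_divisor dvd_minus_iff dvd_refl not_prime_unit prime_nat_int_transfer)
    qed
    then show ?thesis using sum_eq 1 exponent_dvd_iff sum_nonzero_residues[OF \<zeta> p(1), of ?v] by (simp add: h)
  next
    case 2
    then have "(\<Sum>x<p ^ f. ?h x * \<zeta> (p ^ f) ^ (i * x)) = of_nat (p ^ (f - 1)) * (of_nat p - 1)"
      using sum_eq exponent_dvd_iff exponent_div_dvd[OF 2] sum_nonzero_residues[OF \<zeta> p(1), of ?v]
      by (simp add: h)
    also have "\<dots> = - of_nat (p ^ (f - 1)) * (1 - of_nat p)" by (simp add: algebra_simps)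
    finally show ?thesis using 2 by simp
  next
    case 3
    then show ?thesis using sum_eq by simp
  qed
qed

end

section \<open>The difference character on the powers of a permutation\<close>

lemma funpow_conjugate:
  assumes "bij g"
  shows "(g \<circ> w \<circ> inv_into UNIV g) ^^ l = g \<circ> w ^^ l \<circ> inv_into UNIV g"
proof (induction l)
  case 0
  then show ?case using bij_comp_inv(2)[OF assms] by simp
next
  case (Suc l)
  have "(g \<circ> w \<circ> inv_into UNIV g) ^^ Suc l = (g \<circ> w \<circ> inv_into UNIV g) \<circ> (g \<circ> w ^^ l \<circ> inv_into UNIV g)"
    unfolding funpow.simps(2) Suc ..
  also have "\<dots> = g \<circ> w \<circ> (inv_into UNIV g \<circ> g) \<circ> w ^^ l \<circ> inv_into UNIV g" by (simp only: o_assoc)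
  also have "\<dots> = g \<circ> w ^^ Suc l \<circ> inv_into UNIV g"
    unfolding bij_comp_inv(1)[OF assms] funpow.simps(2) by (simp only: o_assoc comp_id)
  finally show ?case .
qed

lemma prime_dvd_prod_list:
  fixes q :: nat
  shows "prime q \<Longrightarrow> q dvd prod_list xs \<Longrightarrow> \<exists>x\<in>set xs. q dvd x"
  by (induction xs) (auto simp: prime_dvd_mult_iff)

lemma (in alt_split) difference_character_powers:
  assumes \<mu>: "\<forall>x\<in>set \<mu>. odd x" and m: "m = Lcm (set \<mu>)" and m0: "m > 0"
    and w: "w \<in> carrier (alt_group n)" "cycle_type n w = mset \<mu>"
  shows "w ^^ m = id"
    and "\<not> coprime k m \<Longrightarrow> \<Delta> (w ^^ k) = 0"
    and "coprime k m \<Longrightarrow> \<exists>\<eta>::int. \<eta> \<in> {-1, 1} \<and> (\<forall>l. \<Delta> (w ^^ (k * l)) = of_int \<eta> * \<Delta> (w ^^ l))"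
proof -
  have wp: "w permutes {1..n}" using w(1) by (rule alt_permutes)
  have len: "card (orbit w x) \<in> set \<mu>" if "x \<in> {1..n}" for x
    using cycle_lengths[OF w(2)] that by blast
  have len_dvd: "card (orbit w x) dvd m" if "x \<in> {1..n}" for x
    unfolding m using len[OF that] by (rule dvd_Lcm)
  show "w ^^ m = id" using wp len_dvd by (rule perm_order_dvd)
  show "\<Delta> (w ^^ k) = 0" if ncop: "\<not> coprime k m"
  proof -
    have "gcd k m \<noteq> 1" using ncop coprime_iff_gcd_eq_1 by blast
    then obtain q where q0: "prime q" "q dvd gcd k m" using prime_factor_nat by blast
    then have q: "prime q" "q dvd k" "q dvd m" by simp_all
    \<comment> \<open>A prime dividing the least common multiple divides the product of the parts,
      hence some part, which is the length of a cycle.\<close>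
    have "m dvd prod_list \<mu>" unfolding m by (rule Lcm_least) (rule prod_list_dvd)
    then have "q dvd prod_list \<mu>" using q(3) by (rule dvd_trans[rotated])
    then obtain y where y: "y \<in> set \<mu>" "q dvd y" using prime_dvd_prod_list[OF q(1)] by blast
    then have "y \<in> (\<lambda>x. card (orbit w x)) ` {1..n}" unfolding cycle_lengths[OF w(2)] by simp
    then obtain x where x: "x \<in> {1..n}" "card (orbit w x) = y" by auto
    have "odd (card (orbit w x))" "q dvd card (orbit w x)" using x(2) y \<mu> by auto
    then obtain \<sigma> where "\<sigma> permutes {1..n}" "\<not> evenperm \<sigma>" "\<sigma> \<circ> (w ^^ k) = (w ^^ k) \<circ> \<sigma>"
      using odd_commuting_permutation[OF wp x(1) _ prime_gt_1_nat[OF q(1)] _ q(2)] by blast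
    then show ?thesis using alt_group_funpow[OF w(1)] by (intro \<Delta>_commutes_odd)
  qed
  show "\<exists>\<eta>::int. \<eta> \<in> {-1, 1} \<and> (\<forall>l. \<Delta> (w ^^ (k * l)) = of_int \<eta> * \<Delta> (w ^^ l))" if cop: "coprime k m"
  proof -
    have "coprime k (card (orbit w x))" if "x \<in> {1..n}" for x
      using cop len_dvd[OF that] by (rule coprime_divisors[OF dvd_refl, rotated])
    then obtain g where g: "g permutes {1..n}" "g \<circ> w \<circ> inv_into UNIV g = w ^^ k"
      using power_conjugate[OF wp] by blast
    have "\<Delta> (w ^^ (k * l)) = of_int (sign g) * \<Delta> (w ^^ l)" for l
    proof -
      have "w ^^ (k * l) = (w ^^ k) ^^ l" by (simp add: funpow_mult)
      also have "\<dots> = g \<circ> w ^^ l \<circ> inv_into UNIV g"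
        unfolding g(2)[symmetric] by (rule funpow_conjugate[OF permutes_bij[OF g(1)]])
      finally show ?thesis using \<Delta>_conj[OF g(1) alt_group_funpow[OF w(1)], of l] by simp
    qed
    moreover have "sign g \<in> {-1, 1}" by (simp add: sign_def)
    ultimately show ?thesis by blast
  qed
qed

text \<open>The values at large primes are determined by \<open>multiplier_eq_Legendre\<close> and quadratic
  reciprocity; every residue class prime to \<open>m\<close> contains a product of large primes.\<close>

lemma multiplier_eq_Legendre_prod:
  fixes F :: "nat \<Rightarrow> complex" and D :: "nat \<Rightarrow> int" and p e :: "nat \<Rightarrow> nat"
  assumes z: "primitive_root_of_unity m z" and m: "m > 0"
    and F: "\<And>k. F k = (\<Sum>i<m. of_int (D i) * (z ^ k) ^ i)"
    and per: "\<And>k. F (k mod m) = F k"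
    and F0: "\<And>k. \<not> coprime k m \<Longrightarrow> F k = 0"
    and twist: "\<And>k. coprime k m \<Longrightarrow> \<exists>\<eta>::int. \<eta> \<in> {-1, 1} \<and> (\<forall>l. F (k * l) = of_int \<eta> * F l)"
    and F1: "F 1 ^ 2 = of_int (psign M * int M)"
    and p: "\<And>j. j \<in> {1..r} \<Longrightarrow> prime (p j)" "\<And>j. j \<in> {1..r} \<Longrightarrow> 2 < p j" "\<And>j. j \<in> {1..r} \<Longrightarrow> p j dvd m"
    and M: "M = (\<Prod>j=1..r. p j ^ e j)" "M > 0" and s: "s \<le> r"
    and e: "\<And>j. j \<in> {1..s} \<Longrightarrow> odd (e j)" "\<And>j. j \<in> {s+1..r} \<Longrightarrow> even (e j)"
    and k: "coprime k m"
  shows "F k = of_int (\<Prod>j=1..s. Legendre (int k) (int (p j))) * F 1"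
proof -
  define \<chi> where "\<chi> = (\<lambda>k. \<Prod>j=1..s. Legendre (int k) (int (p j)))"
  let ?c = "psign M * int M"
  \<comment> \<open>Primes above \<open>B\<close> are odd, do not divide \<open>m\<close>, and
    exceed both \<open>m\<close> and the absolute value of \<open>?c\<close>, as
    \<open>multiplier_eq_Legendre\<close> requires.\<close>
  define B where "B = max 2 (max m M)"
  have absc: "\<bar>?c\<bar> = int M" using psign_values[of M] by auto
  have F2: "F k ^ 2 = of_int ?c" if cop: "coprime k m" for k
  proof -
    obtain \<eta> :: int where \<eta>: "\<eta> \<in> {-1, 1}" "\<forall>l. F (k * l) = of_int \<eta> * F l" using twist[OF cop] by blast
    have "F k = of_int \<eta> * F 1" using \<eta>(2)[rule_format, of 1] by simp
    then have "F k ^ 2 = of_int (\<eta> ^ 2) * F 1 ^ 2" by (simp add: power_mult_distrib)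
    moreover have "\<eta> ^ 2 = 1" using \<eta>(1) by auto
    ultimately show ?thesis by (simp only: F1 of_int_1 mult_1)
  qed
  have step: "F (q * l) = of_int (\<chi> q) * F l" if q: "prime q" "B < q" for q l
  proof -
    have qm: "m < q" "2 < q" "M < q" using q(2) by (auto simp: B_def)
    have nd: "\<not> q dvd m" using qm m by (auto dest: dvd_imp_le)
    then have "coprime q m" using q(1) by (rule prime_imp_coprime[rotated])
    then obtain \<eta> :: int where \<eta>: "\<eta> \<in> {-1, 1}" "\<And>l. F (q * l) = of_int \<eta> * F l" using twist by blast
    have "\<eta> = Legendre ?c (int q)"
      by (rule multiplier_eq_Legendre[OF z m F F0 F2 _ q(1) qm(2,1) _ \<eta>]) (use M(2) absc qm psign_values[of M] in auto)
    also have "\<dots> = (\<Prod>j=1..r. Legendre (int q) (int (p j)) ^ e j)"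
    proof (rule Legendre_psign_prod[OF _ _ _ q(1) qm(2) M(1)])
      fix j assume j: "j \<in> {1..r}"
      show "prime (p j)" "2 < p j" using j by (rule p)+
      show "p j \<noteq> q" using p(3)[OF j] nd by blast
    qed
    \<comment> \<open>The symbols are 1 or -1, so an even exponent gives 1 and an odd one the symbol
      itself.\<close>
    also have "\<dots> = (\<Prod>j=1..r. if j \<le> s then Legendre (int q) (int (p j)) else 1)"
    proof (rule prod.cong[OF refl])
      fix j assume j: "j \<in> {1..r}"
      have "\<not> p j dvd q"
        using p(1,3)[OF j] nd q(1) by (metis primes_dvd_imp_eq)
      then have "\<not> int (p j) dvd int q" by (simp only: int_dvd_int_iff not_False_eq_True)
      then have L: "Legendre (int q) (int (p j)) \<in> {-1, 1}" by (rule Legendre_nonzero)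
      show "Legendre (int q) (int (p j)) ^ e j = (if j \<le> s then Legendre (int q) (int (p j)) else 1)"
      proof (cases "j \<le> s")
        case True
        then show ?thesis using e(1)[of j] j L by auto
      next
        case False
        then have "j \<in> {s+1..r}" using j by auto
        then have "even (e j)" by (rule e(2))
        then show ?thesis using False L by auto
      qed
    qed
    also have "\<dots> = \<chi> q"
      unfolding \<chi>_def using s by (intro prod.mono_neutral_cong_right) auto
    finally show ?thesis using \<eta>(2) by simp
  qed
  obtain k' where k': "k' > 0" "[k' = k] (mod m)" "\<And>q. prime q \<Longrightarrow> q dvd k' \<Longrightarrow> B < q"
    using exists_coprime_small_primes[OF m k, of B] by blast
  have "F k' = of_int (\<chi> k') * F 1"
  proof (rule multiplicative_from_primes[OF step _ _ k'(1,3)])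
    show "\<chi> 1 = 1" unfolding \<chi>_def using p(1) s by (intro prod.neutral) (simp add: Legendre_1)
    show "\<chi> (a * b) = \<chi> a * \<chi> b" for a b
      unfolding \<chi>_def prod.distrib[symmetric] of_nat_mult using p s by (intro prod.cong refl Legendre_mult) auto
  qed
  moreover have "F k' = F k" using per[of k'] per[of k] k'(2) by (simp add: cong_def)
  moreover have "\<chi> k' = \<chi> k"
    unfolding \<chi>_def
  proof (rule prod.cong[OF refl])
    fix j assume "j \<in> {1..s}"
    then have "j \<in> {1..r}" using s by simp
    then have "[k' = k] (mod (p j))" by (rule cong_dvd_modulus_nat[OF k'(2) p(3)])
    then have "[int k' = int k] (mod (int (p j)))" by (simp only: cong_int_iff)
    then show "Legendre (int k') (int (p j)) = Legendre (int k) (int (p j))" by (rule Legendre_cong)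
  qed
  ultimately have "F k = of_int (\<chi> k) * F 1" by (simp only:)
  then show ?thesis by (simp only: \<chi>_def)
qed

section \<open>The explicit formula for the multiplicity difference\<close>

lemma psign_eq_prod_Legendre:
  fixes p e :: "nat \<Rightarrow> nat"
  assumes p: "\<And>j. j \<in> {1..r} \<Longrightarrow> prime (p j)" "\<And>j. j \<in> {1..r} \<Longrightarrow> 2 < p j"
    and M: "M = (\<Prod>j=1..r. p j ^ e j)" and s: "s \<le> r"
    and e: "\<And>j. j \<in> {1..s} \<Longrightarrow> odd (e j)" "\<And>j. j \<in> {s+1..r} \<Longrightarrow> even (e j)"
  shows "psign M = (\<Prod>j=1..s. Legendre (- 1) (int (p j)))"
proof -
  have odd: "odd (p j)" if "j \<in> {1..r}" for j using p[OF that] prime_odd_nat by auto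
  have "psign M = (\<Prod>j=1..r. psign (p j ^ e j))" unfolding M by (rule psign_prod) (simp add: odd)
  also have "\<dots> = (\<Prod>j=1..r. psign (p j) ^ e j)" by (intro prod.cong refl psign_power odd)
  also have "\<dots> = (\<Prod>j=1..r. if j \<le> s then psign (p j) else 1)"
  proof (rule prod.cong[OF refl])
    fix j assume j: "j \<in> {1..r}"
    show "psign (p j) ^ e j = (if j \<le> s then psign (p j) else 1)"
    proof (cases "j \<le> s")
      case True
      then show ?thesis using e(1)[of j] j psign_values[of "p j"] by auto
    next
      case False
      then have "j \<in> {s+1..r}" using j by auto
        then have "even (e j)" by (rule e(2))
      then show ?thesis using False psign_values[of "p j"] by auto
    qed
  qed
  also have "\<dots> = (\<Prod>j=1..s. psign (p j))"
    using s by (intro prod.mono_neutral_cong_right) auto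
  also have "\<dots> = (\<Prod>j=1..s. Legendre (- 1) (int (p j)))"
    using p s by (intro prod.cong refl) (simp add: psign_def Legendre_minus_1)
  finally show ?thesis .
qed

text \<open>The formula carries the factor \<open>of_int (sgn_eps \<mu>)\<close>, which the English
  wording omits. A multiplicity is an average against inverse powers of the eigenvalue, so each of
  the \<open>s\<close> Gauss sums brings the symbol of -1, and these multiply to
  \<open>sgn_eps \<mu>\<close>. An example: let \<open>\<mu> = [3]\<close>, let the exponent be 1,
  let \<open>\<zeta> 3\<close> have positive imaginary part and let \<open>R\<close> be the square
  root of -3 that has positive imaginary part. Then \<open>w\<close> acts on \<open>Vp\<close> as
  \<open>\<zeta> 3\<close> and \<open>D = 1\<close>, whereas
  \<open>R / 3 * gauss_sum \<zeta> 3 = - 1\<close>.\<close>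

theorem theorem3p1:
  fixes n M m r s :: nat and \<mu> :: "nat list" and i :: int
    and p e f d :: "nat \<Rightarrow> nat" and u :: "nat \<Rightarrow> int"
    and \<zeta> :: "nat \<Rightarrow> complex" and R :: complex
    and w :: "nat \<Rightarrow> nat" and Vp Vm :: "tvec set" and D :: int
  assumes roots: "compatible_roots \<zeta>"
    and n: "n \<ge> 2"
    and mu: "is_partition \<mu>" "sum_list \<mu> = n" "distinct \<mu>" "\<forall>x\<in>set \<mu>. odd x"
    and M: "M = prod_list \<mu>"
    and m: "m = Lcm (set \<mu>)"
    and primes: "s \<le> r" "inj_on p {1..r}" "\<forall>j\<in>{1..r}. prime (p j)"
    and M_fact: "M = (\<Prod>j=1..r. p j ^ e j)"
    and e_odd: "\<forall>j\<in>{1..s}. odd (e j)"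
    and e_even: "\<forall>j\<in>{s+1..r}. even (e j) \<and> e j > 0"
    and m_fact: "m = (\<Prod>j=1..r. p j ^ f j)"
    and i_cong: "\<forall>j\<in>{1..r}. [i = u j * int (p j) ^ d j] (mod (int (p j) ^ f j))"
    and u_coprime: "\<forall>j\<in>{1..r}. coprime (u j) (int (p j))"
    and d_le: "\<forall>j\<in>{1..r}. d j \<le> f j"
    and w: "w \<in> carrier (alt_group n)" "cycle_type n w = mset \<mu>"
    and split: "alt_splitting n (phi \<mu>) Vp Vm"
    and R: "R ^ 2 = of_int (sgn_eps \<mu>) * of_nat M"
    and char_p: "rep_character Vp w = (of_int (sgn_eps \<mu>) + R) / 2"
    and char_m: "rep_character Vm w = (of_int (sgn_eps \<mu>) - R) / 2"
    and D: "D = int (eigen_mult Vp w (\<zeta> m powi i)) - int (eigen_mult Vm w (\<zeta> m powi i))"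
  shows "(D \<noteq> 0 \<longleftrightarrow>
      (\<forall>j\<in>{1..s}. d j = f j - 1) \<and> (\<forall>j\<in>{s+1..r}. d j \<in> {f j - 1, f j}))
    \<and> (D \<noteq> 0 \<longrightarrow>
      of_int D = of_int (sgn_eps \<mu>) *
        (R / of_nat m
         * (\<Prod>j=1..s. of_nat (p j ^ (f j - 1))
              * of_int (Legendre (u j * int (m div p j ^ f j)) (int (p j)))
              * gauss_sum \<zeta> (p j))
         * (\<Prod>j=s+1..r. - of_nat (p j ^ (f j - 1)))
         * (\<Prod>j\<in>{j\<in>{1..r}. d j = f j}. 1 - of_nat (p j))))
    \<and> (D \<noteq> 0 \<longrightarrow>
      real_of_int \<bar>D\<bar> = sqrt (real M / (\<Prod>j=1..s. real (p j)))
        * ((\<Prod>j\<in>{j\<in>{1..r}. d j = f j}. real (p j) - 1) / (\<Prod>j=s+1..r. real (p j))))"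
proof -
  let ?z = "\<zeta> m"
  have p: "prime (p j)" if "j \<in> {1..r}" for j using primes(3) that by blast
  have M0: "M > 0" and m0: "m > 0"
    unfolding M_fact m_fact using prime_gt_0_nat[OF p] by (auto intro!: prod_pos)
  have odd_M: "odd M" unfolding M using mu(4) by (rule odd_prod_list)
  have odd_e: "odd (e j)" if "j \<in> {1..s}" for j using e_odd that by blast
  have even_e: "even (e j)" "e j > 0" if "j \<in> {s+1..r}" for j using e_even that by blast+
  have e0: "e j > 0" if "j \<in> {1..r}" for j
  proof (cases "j \<le> s")
    case True
    then show ?thesis using odd_e[of j] that by (simp add: odd_pos)
  next
    case False
    then show ?thesis using even_e(2)[of j] that by simp
  qed
  have pM: "p j dvd M" if j: "j \<in> {1..r}" for j
  proof -
    have "p j dvd p j ^ e j" using e0[OF j] by (simp add: dvd_power)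
    also have "p j ^ e j dvd M" unfolding M_fact using j by (intro dvd_prodI) auto
    finally show ?thesis .
  qed
  have p2: "2 < p j" if j: "j \<in> {1..r}" for j
  proof -
    have "p j \<noteq> 2" using pM[OF j] odd_M by auto
    then show ?thesis using prime_ge_2_nat[OF p[OF j]] by simp
  qed
  have pm: "p j dvd m" if j: "j \<in> {1..r}" for j
  proof -
    obtain x where "x \<in> set \<mu>" "p j dvd x" using prime_dvd_prod_list[OF p[OF j]] pM[OF j] M by blast
    then show ?thesis unfolding m using dvd_Lcm dvd_trans by blast
  qed
  have p_inj: "p j \<noteq> p k" if "j \<in> {1..r}" "k \<in> {1..r}" "j \<noteq> k" for j k
    using inj_onD[OF primes(2) _ that(1,2)] that(3) by blast
  have cop: "coprime (p j ^ f j) (p k ^ f k)" if "j \<in> {1..r}" "k \<in> {1..r}" "j \<noteq> k" for j k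
    using primes_coprime[OF p[OF that(1)] p[OF that(2)] p_inj[OF that]] by simp
  \<comment> \<open>Since \<open>p j\<close> divides a part and hence \<open>m\<close>, it must
    occur in the factorization of \<open>m\<close>, and by distinctness of the primes only at the
    index \<open>j\<close>. So \<open>f j - 1\<close> is a genuine subtraction.\<close>
  have f0: "f j > 0" if j: "j \<in> {1..r}" for j
  proof (rule ccontr)
    assume "\<not> f j > 0"
    obtain k where k: "k \<in> {1..r}" "p j dvd p k ^ f k"
      using pm[OF j] p[OF j] unfolding m_fact by (auto simp: prime_dvd_prod_iff)
    then have "p j dvd p k" using p[OF j] prime_dvd_power by blast
    then have "p j = p k" using p j k primes_dvd_imp_eq by blast
    then have "j = k" using p_inj j k by blast
    then show False using k \<open>\<not> f j > 0\<close> p[OF j] by auto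
  qed
  have eps: "sgn_eps \<mu> = psign M" unfolding M using mu(4) by (rule sgn_eps_eq_psign)
  have R2: "R ^ 2 = of_int (psign M * int M)" using R eps by simp
  have R0: "R \<noteq> 0"
  proof
    assume "R = 0"
    then have "(of_int (psign M * int M) :: complex) = 0" unfolding R2[symmetric] by simp
    then have "psign M * int M = 0" by (simp only: of_int_eq_0_iff)
    then show False using M0 psign_values[of M] by auto
  qed
  have diff: "rep_character Vp w - rep_character Vm w = R" unfolding char_p char_m by (simp add: field_simps)
  \<comment> \<open>\<open>w\<close> itself is the element that tells the two characters
    apart.\<close>
  then have "rep_character Vp w \<noteq> rep_character Vm w" using R0 by auto
  then interpret alt_split n "phi \<mu>" Vp Vm
    using split w(1) by unfold_locales auto
  define F where "F = (\<lambda>k. \<Delta> (w ^^ k))"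
  note powers = difference_character_powers[OF mu(4) m m0 w]
  have F1: "F 1 = R" using diff by (simp add: F_def \<Delta>_def)
  have prim: "primitive_root_of_unity m ?z" using roots m0 by (simp add: compatible_roots_def)
  have per: "F (k mod m) = F k" for k
  proof -
    have "w ^^ k = w ^^ (k mod m + m * (k div m))" by simp
    also have "\<dots> = w ^^ (k mod m) \<circ> (w ^^ m) ^^ (k div m)" by (simp only: funpow_add funpow_mult)
    also have "\<dots> = w ^^ (k mod m)" by (simp add: powers(1))
    finally show ?thesis by (simp add: F_def)
  qed
  have mult: "of_int (int (eigen_mult Vp w x) - int (eigen_mult Vm w x)) = (\<Sum>k<m. inverse x ^ k * F k) / of_nat m"
    if "x ^ m = 1" for x
    unfolding F_def \<Delta>_def
    using eigen_mult_eq_character_sum[OF fin_dims(1) invariants(1) w(1) m0 powers(1) that]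
      eigen_mult_eq_character_sum[OF fin_dims(2) invariants(2) w(1) m0 powers(1) that]
    by (simp add: right_diff_distrib sum_subtractf diff_divide_distrib)
  \<comment> \<open>The differences at all exponents below \<open>m\<close> are taken together:
    Fourier inversion then exhibits \<open>F\<close> as an exponential sum with integer
    coefficients.\<close>
  define D' where "D' = (\<lambda>l. int (eigen_mult Vp w (?z ^ l)) - int (eigen_mult Vm w (?z ^ l)))"
  have z_root: "(?z ^ l) ^ m = 1" for l
    using primitive_root_power_eq_1_iff[OF prim m0, of "l * m"] by (simp add: power_mult)
  have D': "of_int (D' l) = (\<Sum>k<m. inverse (?z ^ l) ^ k * F k) / of_nat m" for l
    unfolding D'_def by (rule mult[OF z_root])
  have Fourier: "F k = (\<Sum>l<m. of_int (D' l) * (?z ^ k) ^ l)" for k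
    by (rule fourier_inversion[OF prim m0 per D'])
  have F_cop: "F k = of_int (\<Prod>j=1..s. Legendre (int k) (int (p j))) * R" if "coprime k m" for k
  proof -
    have "F k = of_int (\<Prod>j=1..s. Legendre (int k) (int (p j))) * F 1"
    proof (rule multiplier_eq_Legendre_prod[OF prim m0 Fourier per _ _ _ p p2 pm M_fact M0 primes(1) odd_e even_e(1) that])
      show "F k = 0" if "\<not> coprime k m" for k using powers(2)[OF that] by (simp add: F_def)
      show "\<exists>\<eta>::int. \<eta> \<in> {-1, 1} \<and> (\<forall>l. F (k * l) = of_int \<eta> * F l)" if "coprime k m" for k
        using powers(3)[OF that] by (simp add: F_def)
      show "F 1 ^ 2 = of_int (psign M * int M)" using F1 R2 by simp
    qed
    then show ?thesis by (simp only: F1)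
  qed
  \<comment> \<open>Local factor at \<open>p j\<close>: the Legendre symbol for odd
    \<open>e j\<close>, the indicator of units for even \<open>e j\<close>. Either vanishes at
    multiples of \<open>p j\<close>, so one product also covers the \<open>k\<close> that are not
    prime to \<open>m\<close>.\<close>
  define \<phi> where "\<phi> = (\<lambda>j k. if j \<le> s then of_int (Legendre (int k) (int (p j))) else if p j dvd k then 0 else 1 :: complex)"
  have cop_iff: "coprime k m \<longleftrightarrow> (\<forall>j\<in>{1..r}. \<not> p j dvd k)" for k
  proof
    assume "coprime k m"
    then have "\<not> p j dvd k" if "j \<in> {1..r}" for j
      using coprime_common_divisor[of k m "p j"] pm[OF that] p[OF that] not_prime_unit by blast
    then show "\<forall>j\<in>{1..r}. \<not> p j dvd k" by blast
  next
    assume nd: "\<forall>j\<in>{1..r}. \<not> p j dvd k"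
    have "coprime k (p j ^ f j)" if "j \<in> {1..r}" for j
    proof -
      have "coprime (p j) k" using p[OF that] nd that by (intro prime_imp_coprime) auto
      then show ?thesis by (simp add: coprime_commute)
    qed
    then show "coprime k m" unfolding m_fact by (intro prod_coprime_right)
  qed
  have F_prod: "F k = R * (\<Prod>j=1..r. \<phi> j k)" for k
  proof (cases "coprime k m")
    case True
    have "(\<Prod>j=1..r. \<phi> j k) = (\<Prod>j=1..s. of_int (Legendre (int k) (int (p j))))"
      using primes(1) True by (intro prod.mono_neutral_cong_right) (auto simp: \<phi>_def cop_iff)
    then show ?thesis using F_cop[OF True] by simp
  next
    case False
    then obtain j where j: "j \<in> {1..r}" "p j dvd k" using cop_iff by blast
    then have "\<phi> j k = 0" by (simp add: \<phi>_def Legendre_zero)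
    then have "(\<Prod>j=1..r. \<phi> j k) = 0" using j(1) by (intro prod_zero) auto
    then show ?thesis using powers(2)[OF False] by (simp add: F_def)
  qed
  \<comment> \<open>The exponential sums take natural exponents; \<open>i'\<close> is the residue of
    \<open>- i\<close> modulo \<open>m\<close>.\<close>
  define i' where "i' = nat ((- i) mod int m)"
  have i': "[int i' = - i] (mod (int m))" using m0 by (simp add: i'_def cong_def)
  have inv_z: "inverse (?z powi i) = ?z ^ i'"
  proof -
    have z0: "?z \<noteq> 0" using prim m0 by (metis power_0_left zero_neq_one less_numeral_extra(3) primitive_root_of_unity_def)
    obtain t where t: "int i' = - i + int m * t" using i' by (metis cong_iff_lin cong_sym)
    have "?z ^ i' = ?z powi int i'" by simp
    also have "\<dots> = ?z powi (- i + int m * t)" by (simp only: t)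
    also have "\<dots> = ?z powi (- i) * (?z powi int m) powi t"
      by (simp only: power_int_add[OF disjI1[OF z0]] power_int_mult)
    also have "?z powi int m = 1" using prim by (simp add: primitive_root_of_unity_def)
    finally show ?thesis by (simp add: power_int_minus)
  qed
  define c where "c = (\<lambda>j. m div p j ^ f j)"
  define L where "L = (\<lambda>j. \<Sum>x<p j ^ f j. \<phi> j (x * c j) * \<zeta> (p j ^ f j) ^ (i' * x))"
  have D_eq: "of_int D = R / of_nat m * (\<Prod>j=1..r. L j)"
  proof -
    have "(?z powi i) ^ m = 1"
    proof -
      have "(inverse (?z powi i)) ^ m = 1" unfolding inv_z by (rule z_root)
      then show ?thesis by (simp add: power_inverse)
    qed
    then have "of_int D = (\<Sum>k<m. (?z ^ i') ^ k * F k) / of_nat m"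
      unfolding D by (subst mult) (simp_all only: inv_z)
    also have "(\<Sum>k<m. (?z ^ i') ^ k * F k) = R * (\<Sum>k<m. (\<Prod>j=1..r. \<phi> j k) * ?z ^ (i' * k))"
      unfolding F_prod sum_distrib_left power_mult by (intro sum.cong refl) (simp only: mult_ac)
    also have "(\<Sum>k<m. (\<Prod>j=1..r. \<phi> j k) * ?z ^ (i' * k)) = (\<Prod>j=1..r. L j)"
      unfolding L_def c_def m_fact
    proof (rule sum_coprime_moduli[OF roots])
      show "\<phi> j (k mod p j ^ f j) = \<phi> j k" if j: "j \<in> {1..r}" for j k
      proof -
        have "p j dvd p j ^ f j" using f0[OF j] by (simp add: dvd_power)
        then have e: "(k mod p j ^ f j) mod p j = k mod p j" by (rule mod_mod_cancel)
        have "Legendre (int (k mod p j ^ f j)) (int (p j)) = Legendre (int k) (int (p j))"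
          using Legendre_mod[of "k mod p j ^ f j" "p j"] Legendre_mod[of k "p j"] e by simp
        moreover have "p j dvd k mod p j ^ f j \<longleftrightarrow> p j dvd k" using e by (simp add: dvd_eq_mod_eq_0)
        ultimately show ?thesis by (simp add: \<phi>_def)
      qed
    qed (use cop prime_gt_0_nat[OF p] in auto)
    finally show ?thesis by (simp add: mult_ac)
  qed
  have c_ndvd: "\<not> p j dvd c j" if j: "j \<in> {1..r}" for j
  proof -
    have "m = p j ^ f j * (\<Prod>k\<in>{1..r} - {j}. p k ^ f k)"
      unfolding m_fact using j by (simp add: prod.remove)
    then have "c j = (\<Prod>k\<in>{1..r} - {j}. p k ^ f k)"
      using prime_gt_0_nat[OF p[OF j]] by (simp add: c_def)
    moreover have "coprime (p j) (\<Prod>k\<in>{1..r} - {j}. p k ^ f k)"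
    proof (rule prod_coprime_right)
      fix k assume "k \<in> {1..r} - {j}"
      then have k: "k \<in> {1..r}" "j \<noteq> k" by auto
      show "coprime (p j) (p k ^ f k)" using primes_coprime[OF p[OF j] p[OF k(1)] p_inj[OF j k]] by simp
    qed
    ultimately have "coprime (p j) (c j)" by (simp only:)
    then have "is_unit (p j)" if "p j dvd c j" using that by (rule coprime_common_divisor[OF _ dvd_refl])
    then show ?thesis using p[OF j] not_prime_unit by blast
  qed
  have i'_loc: "[int i' = - (u j * int (p j) ^ d j)] (mod (int (p j) ^ f j))" if j: "j \<in> {1..r}" for j
  proof -
    have "p j ^ f j dvd m" unfolding m_fact using j by (intro dvd_prodI) auto
    then have "int (p j) ^ f j dvd int m" by (simp only: of_nat_power[symmetric] int_dvd_int_iff)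
    then have "[int i' = - i] (mod (int (p j) ^ f j))" by (rule cong_dvd_modulus[OF i'])
    also have "[- i = - (u j * int (p j) ^ d j)] (mod (int (p j) ^ f j))"
      using i_cong j by (simp add: cong_minus_minus_iff)
    finally show ?thesis .
  qed
  have uj: "coprime (u j) (int (p j))" and dj: "d j \<le> f j" if "j \<in> {1..r}" for j
    using u_coprime d_le that by blast+
  have L_odd: "L j = (if d j = f j - 1 then of_int (Legendre (- 1) (int (p j))) *
      (of_nat (p j ^ (f j - 1)) * of_int (Legendre (u j * int (c j)) (int (p j))) * gauss_sum \<zeta> (p j)) else 0)"
    if j: "j \<in> {1..s}" for j
  proof -
    have jr: "j \<in> {1..r}" and js: "j \<le> s" using j primes(1) by auto
    show ?thesis
      using local_Legendre_sum[OF roots p[OF jr] p2[OF jr] f0[OF jr] dj[OF jr] uj[OF jr] i'_loc[OF jr] c_ndvd[OF jr]] js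
      by (simp only: L_def \<phi>_def if_True)
  qed
  have L_even: "L j = (if d j = f j - 1 \<or> d j = f j then
      - of_nat (p j ^ (f j - 1)) * (if d j = f j then 1 - of_nat (p j) else 1) else 0)"
    if j: "j \<in> {s+1..r}" for j
  proof -
    have jr: "j \<in> {1..r}" and js: "\<not> j \<le> s" using j by auto
    show ?thesis
      using local_unit_sum[OF roots p[OF jr] p2[OF jr] f0[OF jr] dj[OF jr] uj[OF jr] i'_loc[OF jr] c_ndvd[OF jr]] js
      by (simp only: L_def \<phi>_def if_False)
  qed
  let ?C = "(\<forall>j\<in>{1..s}. d j = f j - 1) \<and> (\<forall>j\<in>{s+1..r}. d j \<in> {f j - 1, f j})"
  have leg_nz: "Legendre (- 1) (int (p j)) \<in> {-1, 1}" "Legendre (u j * int (c j)) (int (p j)) \<in> {-1, 1}"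
    if j: "j \<in> {1..r}" for j
  proof -
    have pp: "prime (int (p j))" using p[OF j] by simp
    then have "\<not> int (p j) dvd - 1" unfolding dvd_minus_iff using not_prime_unit by blast
    then show "Legendre (- 1) (int (p j)) \<in> {-1, 1}" by (rule Legendre_nonzero)
    have "is_unit (int (p j))" if "int (p j) dvd u j"
      by (rule coprime_common_divisor[OF uj[OF j] that dvd_refl])
    then have "\<not> int (p j) dvd u j" using pp not_prime_unit by blast
    then have "\<not> int (p j) dvd u j * int (c j)"
      using c_ndvd[OF j] pp by (simp add: prime_dvd_mult_iff)
    then show "Legendre (u j * int (c j)) (int (p j)) \<in> {-1, 1}" by (rule Legendre_nonzero)
  qed
  have g_nz: "gauss_sum \<zeta> (p j) \<noteq> 0" if j: "j \<in> {1..r}" for j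
    using norm_gauss_sum[OF roots p[OF j] p2[OF j]] p2[OF j] by auto
  have split_r: "{1..r} = {1..s} \<union> {s+1..r}" and disj: "{1..s} \<inter> {s+1..r} = {}" using primes(1) by auto
  have L_nz: "L j \<noteq> 0 \<longleftrightarrow> (if j \<le> s then d j = f j - 1 else d j \<in> {f j - 1, f j})" if j: "j \<in> {1..r}" for j
  proof (cases "j \<le> s")
    case True
    then have js: "j \<in> {1..s}" using j by simp
    have "of_nat (p j ^ (f j - 1)) \<noteq> (0::complex)" using p2[OF j] by simp
    then show ?thesis using L_odd[OF js] True leg_nz[OF j] g_nz[OF j] by auto
  next
    case False
    then have js: "j \<in> {s+1..r}" using j by simp
    have "of_nat (p j ^ (f j - 1)) \<noteq> (0::complex)" "1 - of_nat (p j) \<noteq> (0::complex)" using p2[OF j] by auto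
    then show ?thesis using L_even[OF js] False by auto
  qed
  have iff: "D \<noteq> 0 \<longleftrightarrow> ?C"
  proof -
    have "D \<noteq> 0 \<longleftrightarrow> of_int D \<noteq> (0 :: complex)" by simp
    also have "\<dots> \<longleftrightarrow> (\<forall>j\<in>{1..r}. L j \<noteq> 0)" unfolding D_eq using R0 m0 by simp
    also have "\<dots> \<longleftrightarrow> (\<forall>j\<in>{1..r}. if j \<le> s then d j = f j - 1 else d j \<in> {f j - 1, f j})" using L_nz by blast
    also have "\<dots> \<longleftrightarrow> ?C" using primes(1) by (auto split: if_splits)
    finally show ?thesis .
  qed
  \<comment> \<open>Collects the symbols at -1 from the local sums into the sign in front of the
    formula.\<close>
  have psM: "psign M = (\<Prod>j=1..s. Legendre (- 1) (int (p j)))"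
    by (rule psign_eq_prod_Legendre[OF p p2 M_fact primes(1) odd_e even_e(1)])
  have formula: "of_int D = of_int (sgn_eps \<mu>) *
        (R / of_nat m
         * (\<Prod>j=1..s. of_nat (p j ^ (f j - 1))
              * of_int (Legendre (u j * int (m div p j ^ f j)) (int (p j)))
              * gauss_sum \<zeta> (p j))
         * (\<Prod>j=s+1..r. - of_nat (p j ^ (f j - 1)))
         * (\<Prod>j\<in>{j\<in>{1..r}. d j = f j}. 1 - of_nat (p j)))" if C: ?C
  proof -
    have "(\<Prod>j=1..r. L j) = (\<Prod>j=1..s. L j) * (\<Prod>j=s+1..r. L j)"
      unfolding split_r by (rule prod.union_disjoint[OF _ _ disj]) auto
    also have "(\<Prod>j=1..s. L j) = (\<Prod>j=1..s. of_int (Legendre (- 1) (int (p j))) *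
      (of_nat (p j ^ (f j - 1)) * of_int (Legendre (u j * int (c j)) (int (p j))) * gauss_sum \<zeta> (p j)))"
      using C L_odd by (intro prod.cong) auto
    also have "\<dots> = of_int (sgn_eps \<mu>) * (\<Prod>j=1..s. of_nat (p j ^ (f j - 1)) *
        of_int (Legendre (u j * int (c j)) (int (p j))) * gauss_sum \<zeta> (p j))"
      unfolding eps psM of_int_prod by (rule prod.distrib)
    also have "(\<Prod>j=s+1..r. L j) = (\<Prod>j=s+1..r. - of_nat (p j ^ (f j - 1)) * (if d j = f j then 1 - of_nat (p j) else 1))"
      using C L_even by (intro prod.cong refl) auto
    also have "\<dots> = (\<Prod>j=s+1..r. - of_nat (p j ^ (f j - 1))) * (\<Prod>j=s+1..r. if d j = f j then 1 - of_nat (p j) else 1)"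
      by (rule prod.distrib)
    \<comment> \<open>An index \<open>j \<le> s\<close> has \<open>d j = f j - 1 < f j\<close>, so
      \<open>d j = f j\<close> occurs only among the primes of even exponent.\<close>
    also have "(\<Prod>j=s+1..r. if d j = f j then 1 - of_nat (p j) else 1 :: complex) =
        (\<Prod>j\<in>{j\<in>{1..r}. d j = f j}. 1 - of_nat (p j))"
    proof (rule prod.mono_neutral_cong)
      fix j assume j: "j \<in> {j \<in> {1..r}. d j = f j} - {s+1..r}"
      then have "j \<in> {1..s}" "j \<in> {1..r}" by auto
      then have "d j = f j - 1" "f j > 0" using C f0 by auto
      moreover have "d j = f j" using j by simp
      ultimately have False by linarith
      then show "1 - of_nat (p j) = (1 :: complex)" ..
    qed auto
    finally show ?thesis unfolding D_eq c_def by (simp only: mult_ac)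
  qed
  have norm_value: "real_of_int \<bar>D\<bar> = sqrt (real M / (\<Prod>j=1..s. real (p j)))
        * ((\<Prod>j\<in>{j\<in>{1..r}. d j = f j}. real (p j) - 1) / (\<Prod>j=s+1..r. real (p j)))" if C: ?C
  proof -
    have nR: "cmod R = sqrt (real M)"
    proof -
      have "cmod R ^ 2 = cmod (R ^ 2)" by (simp add: norm_power)
      also have "\<dots> = real M" unfolding R2 using psign_values[of M] by (auto simp: norm_mult)
      finally show ?thesis by (metis norm_ge_zero real_sqrt_unique)
    qed
    have neps: "cmod (of_int (sgn_eps \<mu>)) = 1" using eps psign_values[of M] by auto
    have n1: "cmod (\<Prod>j=1..s. of_nat (p j ^ (f j - 1)) * of_int (Legendre (u j * int (c j)) (int (p j))) * gauss_sum \<zeta> (p j))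
        = (\<Prod>j=1..s. real (p j ^ (f j - 1)) * sqrt (real (p j)))"
      unfolding prod_norm[symmetric]
    proof (rule prod.cong[OF refl])
      fix j assume "j \<in> {1..s}"
      then have j: "j \<in> {1..r}" using primes(1) by auto
      have "cmod (of_int (Legendre (u j * int (c j)) (int (p j)))) = 1" using leg_nz(2)[OF j] by auto
      then show "cmod (of_nat (p j ^ (f j - 1)) * of_int (Legendre (u j * int (c j)) (int (p j))) * gauss_sum \<zeta> (p j)) =
          real (p j ^ (f j - 1)) * sqrt (real (p j))"
        unfolding norm_mult norm_of_nat norm_gauss_sum[OF roots p[OF j] p2[OF j]] by simp
    qed
    have n2: "cmod (\<Prod>j=s+1..r. - of_nat (p j ^ (f j - 1))) = (\<Prod>j=s+1..r. real (p j ^ (f j - 1)))"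
      unfolding prod_norm[symmetric] norm_minus_cancel norm_of_nat ..
    have n3: "cmod (\<Prod>j\<in>{j\<in>{1..r}. d j = f j}. 1 - of_nat (p j)) = (\<Prod>j\<in>{j\<in>{1..r}. d j = f j}. real (p j) - 1)"
      unfolding prod_norm[symmetric]
    proof (rule prod.cong[OF refl])
      fix j assume "j \<in> {j\<in>{1..r}. d j = f j}"
      then have "2 < p j" using p2 by auto
      moreover have "1 - of_nat (p j) = (of_real (1 - real (p j)) :: complex)" by simp
      ultimately show "cmod (1 - of_nat (p j)) = real (p j) - 1" by (simp only: norm_of_real)
    qed
    have mm: "real m = (\<Prod>j=1..s. real (p j ^ (f j - 1)) * real (p j)) * (\<Prod>j=s+1..r. real (p j ^ (f j - 1)) * real (p j))"
    proof -
      have "real m = (\<Prod>j=1..r. real (p j ^ (f j - 1)) * real (p j))"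
        unfolding m_fact of_nat_prod
      proof (rule prod.cong[OF refl])
        fix j assume "j \<in> {1..r}"
        then have "f j > 0" by (rule f0)
        then show "real (p j ^ f j) = real (p j ^ (f j - 1)) * real (p j)" by (cases "f j") simp_all
      qed
      then show ?thesis unfolding split_r by (subst (asm) prod.union_disjoint[OF _ _ disj]) auto
    qed
    let ?A = "\<Prod>j=1..s. real (p j ^ (f j - 1))" and ?B = "\<Prod>j=s+1..r. real (p j ^ (f j - 1))"
    let ?S = "\<Prod>j=1..s. sqrt (real (p j))" and ?Q = "\<Prod>j=s+1..r. real (p j)"
    let ?T = "\<Prod>j\<in>{j\<in>{1..r}. d j = f j}. real (p j) - 1"
    have "p j > 0" if "j \<in> {1..r}" for j using p2[OF that] by simp
    then have ps: "p j > 0" if "j \<in> {1..s}" for j using that primes(1) by auto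
    have pr: "p j > 0" if "j \<in> {s+1..r}" for j using that p2[of j] by simp
    have pos: "?A \<noteq> 0" "?B \<noteq> 0" "?S \<noteq> 0" "?Q \<noteq> 0"
      using ps pr by (force simp: prod_zero_iff)+
    have SS: "(\<Prod>j=1..s. real (p j)) = ?S * ?S" by (simp add: prod.distrib[symmetric])
    \<comment> \<open>\<open>a\<close> and \<open>b\<close> collect the powers
      \<open>p j ^ (f j - 1)\<close> for odd and even exponents and cancel against \<open>m\<close>.
      Of the remaining \<open>p j\<close> with \<open>j \<le> s\<close>, the Gauss sums remove one
      square root, collected in \<open>t\<close>; the other passes under the root of
      \<open>M\<close>.\<close>
    have cancel: "x / (a * (t * t) * (b * q)) * (a * t) * b * y = x / t * (y / q)"
      if "a \<noteq> 0" "b \<noteq> 0" "t \<noteq> 0" "q \<noteq> 0" for x a b t q y :: real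
      using that by (simp add: field_simps)
    have "real_of_int \<bar>D\<bar> = cmod (of_int D)" by simp
    also have "\<dots> = sqrt (real M) / real m * (?A * ?S) * ?B * ?T"
      unfolding formula[OF C] norm_mult norm_divide neps nR norm_of_nat n1[unfolded c_def] n2 n3
      by (simp only: prod.distrib mult_1_left)
    also have "\<dots> = sqrt (real M) / ?S * (?T / ?Q)"
      unfolding mm prod.distrib SS by (rule cancel[OF pos])
    also have "sqrt (real M) / ?S = sqrt (real M / (\<Prod>j=1..s. real (p j)))"
      unfolding real_sqrt_divide SS using ps by (simp add: prod_nonneg)
    finally show ?thesis .
  qed
  show ?thesis using iff formula norm_value by blast
qed

end
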